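(* The function $$Z_{\mathrm{4D}}(\boldsymbol{T},s)=\sum_{\lambda\in\mathcal{P}}\left(\frac{\dim\lambda}{|\lambda|!}\right)^2\left(\frac{\Lambda}{\hbar}\right)^{2|\lambda|+s(s+1)}\exp\Big(\sum_{k=1}^\infty T_k\phi^{\mathrm{4D}}_k(s,\lambda)\Big)$$ of $\boldsymbol{T}=(T_1,T_2,\ldots)$ and $s\in\mathbb{Z}$ is a tau function of the 1D Toda hierarchy.
   Context: $\mathcal{P}$ is the set of all partitions $\lambda=(\lambda_1\ge\lambda_2\ge\cdots\ge0)$ with finitely many nonzero parts, $|\lambda|=\sum_i\lambda_i$, and $\dim\lambda$ is the number of standard Young tableaux of shape $\lambda$; $\hbar\neq0$ and $\Lambda$ are parameters. The potentials are $$\phi^{\mathrm{4D}}_k(s,\lambda)=\sum_{i=1}^\infty\big((\lambda_i-i+1+s)^k-(-i+1+s)^k\big)+c_k(s),$$ $$c_k(s)=\begin{cases}1^k+2^k+\cdots+s^k & (s>0),\\ 0&(s=0),\\ -(-1)^k-(-2)^k-\cdots-(s+1)^k&(s<0),\end{cases}$$ (the last sum being empty, hence $0$, for $s=-1$). $Z_{\mathrm{4D}}(\boldsymbol{T},s)$ is regarded as a formal power series in $T_1,T_2,\ldots$ with coefficients in formal power series in $\Lambda^2$. Toda tau functions: write $[w]=(w,w^2/2,\ldots,w^k/k,\ldots)$ and $\xi(\boldsymbol{t},z)=\sum_{k\ge1}t_kz^k$, and let $\oint\frac{dz}{2\pi i}$ mean extracting the coefficient of $z^{-1}$. A family $\tau(\boldsymbol{t},\bar{\boldsymbol{t}},s)$,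 $s\in\mathbb{Z}$, of nonzero formal power series in $\boldsymbol{t}=(t_1,t_2,\ldots)$, $\bar{\boldsymbol{t}}=(\bar t_1,\bar t_2,\ldots)$ is a tau function of the 2D Toda hierarchy if $$\oint\frac{dz}{2\pi i}z^{s'-s}e^{\xi(\boldsymbol{t}'-\boldsymbol{t},z)}\tau(\boldsymbol{t}'-[z^{-1}],\bar{\boldsymbol{t}}',s')\tau(\boldsymbol{t}+[z^{-1}],\bar{\boldsymbol{t}},s)=\oint\frac{dz}{2\pi i}z^{s'-s}e^{\xi(\bar{\boldsymbol{t}}'-\bar{\boldsymbol{t}},z^{-1})}\tau(\boldsymbol{t}',\bar{\boldsymbol{t}}'-[z],s'+1)\tau(\boldsymbol{t},\bar{\boldsymbol{t}}+[z],s-1)$$ holds identically in $\boldsymbol{t},\boldsymbol{t}',\bar{\boldsymbol{t}},\bar{\boldsymbol{t}}'$ for all $s,s'\in\mathbb{Z}$. A family $\tau(\boldsymbol{t},s)$, $s\in\mathbb{Z}$, is a tau function of the 1D Toda hierarchy if $\tau(\boldsymbol{t}-\bar{\boldsymbol{t}},s)$ is a tau function of the 2D Toda hierarchy. *)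

theory Defs
  imports
    "HOL-Analysis.Analysis"
    "HOL-Computational_Algebra.Formal_Laurent_Series"
    "HOL-Library.Poly_Mapping"
begin

section \<open>Formal power series in arbitrarily many variables\<close>

text \<open>
  A monomial in the variables \<^typ>\<open>'v\<close> is a finitely supported exponent function
  \<^typ>\<open>'v \<Rightarrow>\<^sub>0 nat\<close>; a formal power series is an arbitrary family of coefficients.
\<close>

typedef ('v, 'a) mps = "UNIV :: (('v \<Rightarrow>\<^sub>0 nat) \<Rightarrow> 'a) set"
  morphisms mps_coeff Abs_mps ..

lemma mps_coeff_Abs [simp]: "mps_coeff (Abs_mps f) = f"
  by (simp add: Abs_mps_inverse)

lemma mps_eqI: "(\<And>m. mps_coeff f m = mps_coeff g m) \<Longrightarrow> f = g"
  by (metis mps_coeff_inject ext)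

lemma mps_eq_iff: "f = g \<longleftrightarrow> (\<forall>m. mps_coeff f m = mps_coeff g m)"
  by (auto intro: mps_eqI)

definition monom_splits :: "('v \<Rightarrow>\<^sub>0 nat) \<Rightarrow> (('v \<Rightarrow>\<^sub>0 nat) \<times> ('v \<Rightarrow>\<^sub>0 nat)) set" where
  "monom_splits m = {(a, b). a + b = m}"

lemma finite_monom_splits [simp]: "finite (monom_splits m)"
proof -
  let ?A = "{a. \<exists>b. a + b = m}"
  let ?r = "\<lambda>a. restrict (Poly_Mapping.lookup a) (Poly_Mapping.keys m)"
  have le: "Poly_Mapping.lookup a v \<le> Poly_Mapping.lookup m v" if "a \<in> ?A" for a v
    using that by (auto simp: lookup_add)
  have inj: "inj_on ?r ?A"
  proof (rule inj_onI)
    fix a a' assume *: "a \<in> ?A" "a' \<in> ?A" "?r a = ?r a'"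
    show "a = a'"
    proof (rule poly_mapping_eqI)
      fix v
      show "Poly_Mapping.lookup a v = Poly_Mapping.lookup a' v"
      proof (cases "v \<in> Poly_Mapping.keys m")
        case True
        then show ?thesis using *(3) by (metis restrict_apply)
      next
        case False
        then have "Poly_Mapping.lookup m v = 0" by (simp add: in_keys_iff)
        then show ?thesis using le[OF *(1), of v] le[OF *(2), of v] by simp
      qed
    qed
  qed
  have "?r ` ?A \<subseteq> Pi\<^sub>E (Poly_Mapping.keys m) (\<lambda>v. {..Poly_Mapping.lookup m v})"
    by (intro image_subsetI restrict_PiE_iff[THEN iffD2]) (simp add: le)
  then have "finite (?r ` ?A)"
    by (rule finite_subset) (auto intro!: finite_PiE)
  from finite_imageD[OF this inj] have fin: "finite ?A" .
  have "monom_splits m \<subseteq> (\<lambda>a. (a, m - a)) ` ?A"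
  proof
    fix p assume "p \<in> monom_splits m"
    then have "fst p + snd p = m" by (auto simp: monom_splits_def)
    then show "p \<in> (\<lambda>a. (a, m - a)) ` ?A"
      by (intro image_eqI[of _ _ "fst p"]) (auto simp: prod_eq_iff)
  qed
  then show ?thesis by (rule finite_subset) (rule finite_imageI[OF fin])
qed

lemma monom_splits_0 [simp]: "monom_splits 0 = {(0, 0)}"
proof -
  have *: "a = 0" if "a + b = 0" for a b :: "'a \<Rightarrow>\<^sub>0 nat"
  proof (rule poly_mapping_eqI)
    fix v
    have "Poly_Mapping.lookup (a + b) v = 0" using that by simp
    then show "Poly_Mapping.lookup a v = Poly_Mapping.lookup 0 v" by (simp add: lookup_add)
  qed
  have "a + b = 0 \<longleftrightarrow> a = 0 \<and> b = 0" for a b :: "'a \<Rightarrow>\<^sub>0 nat"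
    using *[of a b] by auto
  then show ?thesis by (auto simp only: monom_splits_def)
qed

instantiation mps :: (type, comm_ring_1) comm_ring_1
begin

definition "0 = Abs_mps (\<lambda>_. 0)"
definition "1 = Abs_mps (\<lambda>m. if m = 0 then 1 else 0)"
definition "f + g = Abs_mps (\<lambda>m. mps_coeff f m + mps_coeff g m)"
definition "f - g = Abs_mps (\<lambda>m. mps_coeff f m - mps_coeff g m)"
definition "- f = Abs_mps (\<lambda>m. - mps_coeff f m)"
definition "f * g = Abs_mps (\<lambda>m. \<Sum>(a, b)\<in>monom_splits m. mps_coeff f a * mps_coeff g b)"

lemmas mps_ring_defs = zero_mps_def one_mps_def plus_mps_def minus_mps_def uminus_mps_def
  times_mps_def

instance
proof
  fix f g h :: "('a, 'b) mps"
  show "f * g * h = f * (g * h)"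
  proof (rule mps_eqI)
    fix m
    let ?f = "mps_coeff f" and ?g = "mps_coeff g" and ?h = "mps_coeff h"
    have "mps_coeff (f * g * h) m =
        (\<Sum>p\<in>monom_splits m. \<Sum>q\<in>monom_splits (fst p). ?f (fst q) * ?g (snd q) * ?h (snd p))"
      by (simp add: times_mps_def case_prod_unfold sum_distrib_right)
    also have "\<dots> = (\<Sum>(p, q)\<in>(SIGMA p:monom_splits m. monom_splits (fst p)).
        ?f (fst q) * ?g (snd q) * ?h (snd p))"
      by (rule sum.Sigma) auto
    also have "\<dots> = (\<Sum>(p, q)\<in>(SIGMA p:monom_splits m. monom_splits (snd p)).
        ?f (fst p) * (?g (fst q) * ?h (snd q)))"
      by (rule sum.reindex_bij_witness[
            where i = "\<lambda>(p, q). ((fst p + fst q, snd q), (fst p, fst q))"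
              and j = "\<lambda>(p, q). ((fst q, snd q + snd p), (snd q, snd p))"])
        (auto simp: monom_splits_def add_ac mult_ac)
    also have "\<dots> = (\<Sum>p\<in>monom_splits m. \<Sum>q\<in>monom_splits (snd p).
        ?f (fst p) * (?g (fst q) * ?h (snd q)))"
      by (rule sum.Sigma[symmetric]) auto
    also have "\<dots> = mps_coeff (f * (g * h)) m"
      by (simp add: times_mps_def case_prod_unfold sum_distrib_left)
    finally show "mps_coeff (f * g * h) m = mps_coeff (f * (g * h)) m" .
  qed
  show "f * g = g * f"
  proof (rule mps_eqI)
    fix m
    have "(\<Sum>(a, b)\<in>monom_splits m. mps_coeff f a * mps_coeff g b)
        = (\<Sum>(a, b)\<in>monom_splits m. mps_coeff g a * mps_coeff f b)"
      by (rule sum.reindex_bij_witness[where i = prod.swap and j = prod.swap])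
        (auto simp: monom_splits_def add_ac mult_ac)
    then show "mps_coeff (f * g) m = mps_coeff (g * f) m"
      by (simp add: times_mps_def)
  qed
  show "1 * f = f"
  proof (rule mps_eqI)
    fix m
    have "(\<Sum>(a, b)\<in>monom_splits m. mps_coeff 1 a * mps_coeff f b)
        = (\<Sum>(a, b)\<in>{(0, m)}. mps_coeff 1 a * mps_coeff f b)"
      by (rule sum.mono_neutral_right, simp) (auto simp: monom_splits_def one_mps_def split: if_splits)
    then show "mps_coeff (1 * f) m = mps_coeff f m"
      by (simp add: times_mps_def one_mps_def)
  qed
qed (auto simp: mps_ring_defs mps_eq_iff case_prod_unfold sum.distrib algebra_simps)

end

lemma mps_coeff_0 [simp]: "mps_coeff 0 m = 0"
  and mps_coeff_1: "mps_coeff 1 m = (if m = 0 then 1 else 0)"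
  and mps_coeff_add [simp]: "mps_coeff (f + g) m = mps_coeff f m + mps_coeff g m"
  and mps_coeff_diff [simp]: "mps_coeff (f - g) m = mps_coeff f m - mps_coeff g m"
  and mps_coeff_uminus [simp]: "mps_coeff (- f) m = - mps_coeff f m"
  and mps_coeff_mult:
    "mps_coeff (f * g) m = (\<Sum>(a, b)\<in>monom_splits m. mps_coeff f a * mps_coeff g b)"
  by (simp_all add: mps_ring_defs)

lemma mps_coeff_sum [simp]: "mps_coeff (sum f A) m = (\<Sum>x\<in>A. mps_coeff (f x) m)"
  by (induction A rule: infinite_finite_induct) auto

definition mps_const :: "'a::comm_ring_1 \<Rightarrow> ('v, 'a) mps" where
  "mps_const c = Abs_mps (\<lambda>m. if m = 0 then c else 0)"

definition mps_var :: "'v \<Rightarrow> ('v, 'a::comm_ring_1) mps" where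
  "mps_var v = Abs_mps (\<lambda>m. if m = Poly_Mapping.single v 1 then 1 else 0)"

definition mps_map :: "('a \<Rightarrow> 'b) \<Rightarrow> ('v, 'a) mps \<Rightarrow> ('v, 'b) mps" where
  "mps_map h f = Abs_mps (\<lambda>m. h (mps_coeff f m))"

lemma mps_coeff_const_mult:
  fixes f :: "('v, 'a::comm_ring_1) mps"
  shows "mps_coeff (mps_const c * f) m = c * mps_coeff f m"
proof -
  have "mps_coeff (mps_const c * f) m
      = (\<Sum>(a, b)\<in>{(0 :: 'v \<Rightarrow>\<^sub>0 nat, m)}. mps_coeff (mps_const c) a * mps_coeff f b)"
    unfolding mps_coeff_mult
    by (rule sum.mono_neutral_right, simp) (auto simp: monom_splits_def mps_const_def split: if_splits)
  then show ?thesis by (simp add: mps_const_def)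
qed

subsection \<open>Infinite sums of power series\<close>

text \<open>
  Series carry the topology of coefficientwise convergence.  The coefficient rings used below are
  \<^typ>\<open>complex fps\<close> and \<^typ>\<open>complex fps fls\<close>, whose library topology is the adic one, so that
  \<^const>\<open>infsum\<close> is the usual notion of an infinite sum of formal power series; the usual topology
  of \<^typ>\<open>complex\<close> plays no role.
\<close>

instantiation mps :: (type, topological_space) topological_space
begin

definition open_mps_def: "open U \<longleftrightarrow> open (Abs_mps -` U)"

instance
  by standard (auto simp: open_mps_def vimage_Union)

end

lemma open_mps_coeff:
  fixes U :: "'a::topological_space set"
  assumes "open U"
  shows "open {f. mps_coeff f m \<in> U}"
  using product_topology_basis'[of "{m}" "\<lambda>_. U" id] assms
  by (simp add: open_mps_def vimage_def)

instance mps :: (type, t2_space) t2_space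
proof
  fix f g :: "('a, 'b) mps"
  assume "f \<noteq> g"
  then obtain m where "mps_coeff f m \<noteq> mps_coeff g m" by (auto simp: mps_eq_iff)
  then obtain U V where "open U" "open V" "mps_coeff f m \<in> U" "mps_coeff g m \<in> V" "U \<inter> V = {}"
    by (meson hausdorff)
  then show "\<exists>U V. open U \<and> open V \<and> f \<in> U \<and> g \<in> V \<and> U \<inter> V = {}"
    by (intro exI[of _ "{f. mps_coeff f m \<in> U}"] exI[of _ "{f. mps_coeff f m \<in> V}"])
      (auto simp: open_mps_coeff)
qed

lemma tendsto_mps_iff:
  fixes f :: "'c \<Rightarrow> ('v, 'a::topological_space) mps"
  shows "(f \<longlongrightarrow> l) F \<longleftrightarrow> (\<forall>m. ((\<lambda>x. mps_coeff (f x) m) \<longlongrightarrow> mps_coeff l m) F)"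
proof safe
  fix m assume lim: "(f \<longlongrightarrow> l) F"
  show "((\<lambda>x. mps_coeff (f x) m) \<longlongrightarrow> mps_coeff l m) F"
  proof (rule topological_tendstoI)
    fix S :: "'a set" assume "open S" "mps_coeff l m \<in> S"
    then have "eventually (\<lambda>x. f x \<in> {g. mps_coeff g m \<in> S}) F"
      by (intro topological_tendstoD[OF lim]) (auto simp: open_mps_coeff)
    then show "eventually (\<lambda>x. mps_coeff (f x) m \<in> S) F" by simp
  qed
next
  assume lim: "\<forall>m. ((\<lambda>x. mps_coeff (f x) m) \<longlongrightarrow> mps_coeff l m) F"
  show "(f \<longlongrightarrow> l) F"
  proof (rule topological_tendstoI)
    fix S assume S: "open S" "l \<in> S"
    have "openin (product_topology (\<lambda>_. euclidean) UNIV) (Abs_mps -` S)"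
      using S(1) by (simp add: open_mps_def open_fun_def)
    moreover have "mps_coeff l \<in> Abs_mps -` S"
      using S(2) by (simp add: mps_coeff_inverse)
    ultimately obtain X where X: "mps_coeff l \<in> Pi\<^sub>E UNIV X" "\<And>i. open (X i)"
        "finite {i. X i \<noteq> UNIV}" "Pi\<^sub>E UNIV X \<subseteq> Abs_mps -` S"
      using product_topology_open_contains_basis[of "\<lambda>_. euclidean" UNIV "Abs_mps -` S" "mps_coeff l"]
      by (auto simp flip: open_openin)
    have "eventually (\<lambda>x. \<forall>i\<in>{i. X i \<noteq> UNIV}. mps_coeff (f x) i \<in> X i) F"
      using X lim by (intro eventually_ball_finite ballI) (auto intro!: topological_tendstoD)
    then show "eventually (\<lambda>x. f x \<in> S) F"
    proof (rule eventually_mono)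
      fix x assume "\<forall>i\<in>{i. X i \<noteq> UNIV}. mps_coeff (f x) i \<in> X i"
      then have "mps_coeff (f x) \<in> Pi\<^sub>E UNIV X" by (auto simp: PiE_iff)
      then show "f x \<in> S" using X(4) by (auto simp: mps_coeff_inverse)
    qed
  qed
qed

lemma has_sum_mps_iff:
  fixes f :: "'c \<Rightarrow> ('v, 'a::{comm_ring_1, topological_space}) mps"
  shows "(f has_sum s) A \<longleftrightarrow> (\<forall>m. ((\<lambda>x. mps_coeff (f x) m) has_sum mps_coeff s m) A)"
  unfolding has_sum_def tendsto_mps_iff by simp

definition mps_exp :: "('v, 'a::{comm_ring_1, inverse, t2_space}) mps \<Rightarrow> ('v, 'a) mps" where
  "mps_exp f = (\<Sum>\<^sub>\<infinity>n. mps_const (inverse (of_nat (fact n))) * f ^ n)"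

text \<open>
  \<open>mps_subst h \<sigma> f\<close> substitutes the series \<open>\<sigma> v\<close> for the variable \<open>v\<close> in \<open>f\<close>, where \<open>h\<close> maps the
  old coefficient ring into the new one.
\<close>

definition mps_subst ::
  "('a \<Rightarrow> 'b::{comm_ring_1, t2_space}) \<Rightarrow> ('v \<Rightarrow> ('w, 'b) mps) \<Rightarrow> ('v, 'a) mps \<Rightarrow> ('w, 'b) mps" where
  "mps_subst h \<sigma> f = (\<Sum>\<^sub>\<infinity>m. mps_const (h (mps_coeff f m)) *
     (\<Prod>v\<in>Poly_Mapping.keys m. \<sigma> v ^ Poly_Mapping.lookup m v))"


section \<open>Tau functions of the Toda hierarchies\<close>

text \<open>
  All alphabets are indexed from 0: the variable with index \<open>n :: nat\<close> is the one the literature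
  calls \<open>t\<^sub>n\<^sub>+\<^sub>1\<close>.  The coefficients are formal power series in one variable (which will
  be \<open>\<Lambda>\<^sup>2\<close>) over the complex numbers.
\<close>

datatype toda_var = Tm nat | Tb nat

text \<open>Variables of the bilinear identity: \<open>t\<close>, \<open>t'\<close> and their barred counterparts.\<close>

datatype bilin_var = Um nat | Um' nat | Ub nat | Ub' nat

text \<open>
  The two sides of the bilinear identity are power series in the time variables whose coefficients
  are Laurent series (\<^typ>\<open>complex fps fls\<close>) in \<open>w = z\<^sup>-\<^sup>1\<close> on the left and in \<open>w = z\<close> on the right.
  In both cases the shifts are by \<open>[w]\<close> and the exponent is \<open>\<xi>(_, w\<^sup>-\<^sup>1)\<close>.
\<close>

definition miwa_shift :: "nat \<Rightarrow> ('v, complex fps fls) mps" where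
  "miwa_shift n = mps_const (inverse (of_nat (Suc n)) * fls_X ^ Suc n)"

definition toda_xi :: "(nat \<Rightarrow> ('v, complex fps fls) mps) \<Rightarrow> ('v, complex fps fls) mps" where
  "toda_xi x = (\<Sum>\<^sub>\<infinity>n. x n * mps_const (fls_X_inv ^ Suc n))"

definition toda_eval ::
  "(toda_var, complex fps) mps \<Rightarrow> (nat \<Rightarrow> ('v, complex fps fls) mps) \<Rightarrow>
   (nat \<Rightarrow> ('v, complex fps fls) mps) \<Rightarrow> ('v, complex fps fls) mps" where
  "toda_eval \<tau> x y = mps_subst fls_const (case_toda_var x y) \<tau>"

text \<open>Here \<open>w = z\<^sup>-\<^sup>1\<close>: \<open>z\<^sup>s\<^sup>'\<^sup>-\<^sup>s\<close> is \<open>w\<^sup>s\<^sup>-\<^sup>s\<^sup>'\<close>, and the coefficient of \<open>z\<^sup>-\<^sup>1\<close> is that of \<open>w\<^sup>1\<close>.\<close>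

definition toda_bilinear_lhs ::
  "(int \<Rightarrow> (toda_var, complex fps) mps) \<Rightarrow> int \<Rightarrow> int \<Rightarrow> (bilin_var, complex fps) mps" where
  "toda_bilinear_lhs \<tau> s s' =
     mps_map (\<lambda>g. fls_nth g 1)
       (mps_const (fls_X_intpow (s - s'))
        * mps_exp (toda_xi (\<lambda>n. mps_var (Um' n) - mps_var (Um n)))
        * toda_eval (\<tau> s') (\<lambda>n. mps_var (Um' n) - miwa_shift n) (\<lambda>n. mps_var (Ub' n))
        * toda_eval (\<tau> s) (\<lambda>n. mps_var (Um n) + miwa_shift n) (\<lambda>n. mps_var (Ub n)))"

text \<open>Here \<open>w = z\<close>.\<close>

definition toda_bilinear_rhs ::
  "(int \<Rightarrow> (toda_var, complex fps) mps) \<Rightarrow> int \<Rightarrow> int \<Rightarrow> (bilin_var, complex fps) mps" where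
  "toda_bilinear_rhs \<tau> s s' =
     mps_map (\<lambda>g. fls_nth g (- 1))
       (mps_const (fls_X_intpow (s' - s))
        * mps_exp (toda_xi (\<lambda>n. mps_var (Ub' n) - mps_var (Ub n)))
        * toda_eval (\<tau> (s' + 1)) (\<lambda>n. mps_var (Um' n)) (\<lambda>n. mps_var (Ub' n) - miwa_shift n)
        * toda_eval (\<tau> (s - 1)) (\<lambda>n. mps_var (Um n)) (\<lambda>n. mps_var (Ub n) + miwa_shift n))"

definition tau_2D_toda :: "(int \<Rightarrow> (toda_var, complex fps) mps) \<Rightarrow> bool" where
  "tau_2D_toda \<tau> \<longleftrightarrow>
     (\<forall>s. \<tau> s \<noteq> 0) \<and> (\<forall>s s'. toda_bilinear_lhs \<tau> s s' = toda_bilinear_rhs \<tau> s s')"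

definition tau_1D_toda :: "(int \<Rightarrow> (nat, complex fps) mps) \<Rightarrow> bool" where
  "tau_1D_toda \<tau> \<longleftrightarrow>
     tau_2D_toda (\<lambda>s. mps_subst (\<lambda>c. c) (\<lambda>n. mps_var (Tm n) - mps_var (Tb n)) (\<tau> s))"


section \<open>The partition function\<close>

text \<open>The part \<open>\<lambda>\<^sub>i\<close>, \<open>i \<ge> 1\<close>, of a partition is \<open>lam (i - 1)\<close>.\<close>

definition partitions :: "(nat \<Rightarrow> nat) set" where
  "partitions = {lam. antimono lam \<and> finite {i. lam i \<noteq> 0}}"

definition partition_size :: "(nat \<Rightarrow> nat) \<Rightarrow> nat" where
  "partition_size lam = Sum_any lam"

definition young_diagram :: "(nat \<Rightarrow> nat) \<Rightarrow> (nat \<times> nat) set" where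
  "young_diagram lam = {(i, j). j < lam i}"

definition standard_tableaux :: "(nat \<Rightarrow> nat) \<Rightarrow> (nat \<times> nat \<Rightarrow> nat) set" where
  "standard_tableaux lam =
     {t \<in> extensional (young_diagram lam).
        bij_betw t (young_diagram lam) {1..partition_size lam} \<and>
        (\<forall>i j j'. j < j' \<and> (i, j') \<in> young_diagram lam \<longrightarrow> t (i, j) < t (i, j')) \<and>
        (\<forall>i i' j. i < i' \<and> (i', j) \<in> young_diagram lam \<longrightarrow> t (i, j) < t (i', j))}"

definition dim_partition :: "(nat \<Rightarrow> nat) \<Rightarrow> nat" where
  "dim_partition lam = card (standard_tableaux lam)"

definition c_4D :: "nat \<Rightarrow> int \<Rightarrow> int" where
  "c_4D k s = (if s > 0 then \<Sum>j=1..s. j ^ k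
               else if s = 0 then 0
               else - (\<Sum>j=s+1..-1. j ^ k))"

definition phi_4D :: "nat \<Rightarrow> int \<Rightarrow> (nat \<Rightarrow> nat) \<Rightarrow> int" where
  "phi_4D k s lam =
     Sum_any (\<lambda>i. (int (lam i) - int i + s) ^ k - (- int i + s) ^ k) + c_4D k s"

text \<open>
  The variable \<^const>\<open>fps_X\<close> of the coefficient ring is \<open>\<Lambda>\<^sup>2\<close>.  Since \<open>s (s + 1)\<close> is even and
  nonnegative, \<open>(\<Lambda> / \<hbar>)\<^sup>2\<^sup>|\<^sup>\<lambda>\<^sup>|\<^sup>+\<^sup>s\<^sup>(\<^sup>s\<^sup>+\<^sup>1\<^sup>)\<close> is the power of \<open>\<Lambda>\<^sup>2 / \<hbar>\<^sup>2\<close> with exponent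
  \<open>|\<lambda>| + s (s + 1) / 2\<close>.
\<close>

definition Z_4D :: "complex \<Rightarrow> int \<Rightarrow> (nat, complex fps) mps" where
  "Z_4D hbar s =
     (\<Sum>\<^sub>\<infinity>lam\<in>partitions.
        mps_const (fps_const ((of_nat (dim_partition lam) / fact (partition_size lam))\<^sup>2)
          * (fps_const (1 / hbar\<^sup>2) * fps_X) ^ (partition_size lam + nat (s * (s + 1) div 2)))
        * mps_exp (\<Sum>\<^sub>\<infinity>n. mps_var n * mps_const (of_int (phi_4D (Suc n) s lam))))"


section \<open>Well-definedness\<close>

text \<open>
  Since \<^const>\<open>infsum\<close> is 0 for families that are not summable, we record convergence of the
  sums over partitions and of those in \<^const>\<open>mps_exp\<close>, \<^const>\<open>toda_xi\<close> and \<^const>\<open>toda_eval\<close>.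
\<close>

lemma summable_on_mps_iff:
  fixes f :: "'c \<Rightarrow> ('v, 'a::{comm_ring_1, topological_space}) mps"
  shows "f summable_on A \<longleftrightarrow> (\<forall>m. (\<lambda>x. mps_coeff (f x) m) summable_on A)"
proof
  assume "\<forall>m. (\<lambda>x. mps_coeff (f x) m) summable_on A"
  then obtain s where "\<forall>m. ((\<lambda>x. mps_coeff (f x) m) has_sum s m) A"
    unfolding summable_on_def by metis
  then show "f summable_on A"
    unfolding summable_on_def has_sum_mps_iff by (intro exI[of _ "Abs_mps s"]) simp
qed (auto simp: summable_on_def has_sum_mps_iff)

lemma summable_on_finite_support:
  fixes f :: "'c \<Rightarrow> 'a::{comm_monoid_add, topological_space}"
  assumes "finite {x \<in> A. f x \<noteq> 0}"
  shows "f summable_on A"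
proof -
  have "f summable_on {x \<in> A. f x \<noteq> 0}" using assms by (rule summable_on_finite)
  moreover have "f summable_on {x \<in> A. f x \<noteq> 0} \<longleftrightarrow> f summable_on A"
    by (rule summable_on_cong_neutral) auto
  ultimately show ?thesis by simp
qed

lemma summable_on_fps:
  fixes g :: "'c \<Rightarrow> 'a::comm_ring_1 fps"
  assumes "\<And>n. finite {x \<in> A. fps_nth (g x) n \<noteq> 0}"
  shows "g summable_on A"
proof -
  let ?S = "\<lambda>n. {x \<in> A. fps_nth (g x) n \<noteq> 0}"
  let ?s = "Abs_fps (\<lambda>n. \<Sum>x\<in>?S n. fps_nth (g x) n)"
  have "(g has_sum ?s) A"
    unfolding has_sum_def
  proof (rule tendsto_fpsI)
    fix n
    have "eventually (\<lambda>X. finite X \<and> ?S n \<subseteq> X \<and> X \<subseteq> A) (finite_subsets_at_top A)"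
      unfolding eventually_finite_subsets_at_top using assms by (intro exI[of _ "?S n"]) auto
    then show "eventually (\<lambda>X. fps_nth (sum g X) n = fps_nth ?s n) (finite_subsets_at_top A)"
    proof (rule eventually_mono)
      fix X assume "finite X \<and> ?S n \<subseteq> X \<and> X \<subseteq> A"
      then have "(\<Sum>x\<in>X. fps_nth (g x) n) = (\<Sum>x\<in>?S n. fps_nth (g x) n)"
        by (intro sum.mono_neutral_right) auto
      then show "fps_nth (sum g X) n = fps_nth ?s n" by (simp add: fps_sum_nth)
    qed
  qed
  then show ?thesis by (auto simp: summable_on_def)
qed

definition mdeg :: "('v \<Rightarrow>\<^sub>0 nat) \<Rightarrow> nat" where
  "mdeg m = Sum_any (Poly_Mapping.lookup m)"

lemma mdeg_add: "mdeg (a + b) = mdeg a + mdeg b"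
  unfolding mdeg_def lookup_add by (rule Sum_any.distrib) auto

lemma mdeg_pos: "a \<noteq> 0 \<Longrightarrow> mdeg a > 0"
proof -
  assume "a \<noteq> 0"
  then obtain v where v: "v \<in> Poly_Mapping.keys a" by fastforce
  have "mdeg a = (\<Sum>v\<in>Poly_Mapping.keys a. Poly_Mapping.lookup a v)"
    unfolding mdeg_def Sum_any.expand_set by (simp add: keys.rep_eq)
  moreover have "Poly_Mapping.lookup a v > 0" using v by (simp add: in_keys_iff)
  ultimately show ?thesis using v by (metis finite_keys member_le_sum le0 gr0I leD)
qed

lemma mps_coeff_power_eq_0:
  fixes f :: "('v, 'a::comm_ring_1) mps"
  assumes "mps_coeff f 0 = 0" "mdeg m < n"
  shows "mps_coeff (f ^ n) m = 0"
  using assms(2)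
proof (induction n arbitrary: m)
  case (Suc n)
  have "mps_coeff f a * mps_coeff (f ^ n) b = 0" if "a + b = m" for a b
  proof (cases "a = 0")
    case False
    then have "mdeg b < n" using mdeg_pos[of a] mdeg_add[of a b] that Suc.prems by simp
    then show ?thesis using Suc.IH by simp
  qed (simp add: assms)
  then show ?case
    unfolding power_Suc mps_coeff_mult by (intro sum.neutral) (auto simp: monom_splits_def)
qed simp

lemma mps_exp_summable:
  fixes f :: "('v, 'a::{comm_ring_1, inverse, t2_space}) mps"
  assumes "mps_coeff f 0 = 0"
  shows "(\<lambda>n. mps_const (inverse (of_nat (fact n))) * f ^ n) summable_on UNIV"
  unfolding summable_on_mps_iff
proof
  fix m
  have "{n \<in> UNIV. mps_coeff (mps_const (inverse (of_nat (fact n))) * f ^ n) m \<noteq> 0} \<subseteq> {..mdeg m}"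
    using mps_coeff_power_eq_0[OF assms, of m] by (auto simp: mps_coeff_const_mult not_less[symmetric])
  then show "(\<lambda>n. mps_coeff (mps_const (inverse (of_nat (fact n))) * f ^ n) m) summable_on UNIV"
    by (intro summable_on_finite_support) (rule finite_subset, auto)
qed

lemma finite_partitions_of_size: "finite {lam \<in> partitions. partition_size lam = n}"
proof -
  let ?A = "{lam \<in> partitions. partition_size lam = n}"
  have bound: "lam i \<le> n" "i \<ge> n \<Longrightarrow> lam i = 0" if "lam \<in> ?A" for lam i
  proof -
    have fin: "finite {i. lam i \<noteq> 0}" and mono: "antimono lam"
      and size: "(\<Sum>i | lam i \<noteq> 0. lam i) = n"
      using that by (auto simp: partitions_def partition_size_def Sum_any.expand_set)
    have le: "(\<Sum>i\<in>I. lam i) \<le> n" if "finite I" for I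
    proof -
      have "(\<Sum>i\<in>I. lam i) = (\<Sum>i\<in>{i \<in> I. lam i \<noteq> 0}. lam i)"
        using that by (intro sum.mono_neutral_right) auto
      also have "\<dots> \<le> (\<Sum>i | lam i \<noteq> 0. lam i)" using fin by (intro sum_mono2) auto
      finally show ?thesis using size by simp
    qed
    show "lam i \<le> n" using le[of "{i}"] by simp
    show "lam i = 0" if "i \<ge> n"
    proof (rule ccontr)
      assume "lam i \<noteq> 0"
      then have "lam j \<ge> 1" if "j \<le> n" for j
        using antimonoD[OF mono, of j i] that \<open>i \<ge> n\<close> by linarith
      then have "(\<Sum>j\<le>n. 1) \<le> (\<Sum>j\<le>n. lam j)" by (intro sum_mono) auto
      with le[of "{..n}"] show False by simp
    qed
  qed
  have "finite {lam :: nat \<Rightarrow> nat. \<forall>i. (i \<in> {..<n} \<longrightarrow> lam i \<in> {..n}) \<and> (i \<notin> {..<n} \<longrightarrow> lam i = 0)}"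
    by (rule finite_set_of_finite_funs) auto
  then show ?thesis by (rule finite_subset[rotated]) (use bound in auto)
qed

lemma Z_4D_summable:
  "(\<lambda>lam. mps_const (fps_const ((of_nat (dim_partition lam) / fact (partition_size lam))\<^sup>2)
      * (fps_const (1 / hbar\<^sup>2) * fps_X) ^ (partition_size lam + nat (s * (s + 1) div 2)))
    * F lam) summable_on partitions"
    (is "(\<lambda>lam. mps_const (?c lam * ?q ^ ?e lam) * F lam) summable_on _")
  for F :: "(nat \<Rightarrow> nat) \<Rightarrow> (nat, complex fps) mps"
  unfolding summable_on_mps_iff
proof (intro allI summable_on_fps)
  fix m n
  have "fps_nth (mps_coeff (mps_const (?c lam * ?q ^ ?e lam) * F lam) m) n = 0"
    if "n < partition_size lam" for lam
  proof -
    have "mps_coeff (mps_const (?c lam * ?q ^ ?e lam) * F lam) m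
        = fps_X ^ ?e lam * (?c lam * fps_const (1 / hbar\<^sup>2) ^ ?e lam * mps_coeff (F lam) m)"
      unfolding mps_coeff_const_mult by (simp add: power_mult_distrib mult_ac)
    then show ?thesis using that by (simp add: fps_X_power_mult_nth)
  qed
  then have "{lam \<in> partitions. fps_nth (mps_coeff (mps_const (?c lam * ?q ^ ?e lam) * F lam) m) n \<noteq> 0}
      \<subseteq> (\<Union>k\<in>{..n}. {lam \<in> partitions. partition_size lam = k})"
    by (fastforce simp: not_less[symmetric])
  then show "finite {lam \<in> partitions. fps_nth (mps_coeff (mps_const (?c lam * ?q ^ ?e lam) * F lam) m) n \<noteq> 0}"
    by (rule finite_subset) (intro finite_UN_I finite_atMost finite_partitions_of_size)
qed


lemma dist_fps_to_fls: "dist (fps_to_fls f) (fps_to_fls g) = dist f (g :: 'a::group_add fps)"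
  unfolding dist_fls_def dist_fps_def
  by (simp add: fls_subdegree_fls_to_fps fps_to_fls_eq_iff flip: fps_to_fls_minus)

lemma summable_on_fls:
  fixes g :: "'c \<Rightarrow> 'a::comm_ring_1 fls"
  assumes neg: "\<And>x k. x \<in> A \<Longrightarrow> k < 0 \<Longrightarrow> fls_nth (g x) k = 0"
    and fin: "\<And>n. finite {x \<in> A. fls_nth (g x) (int n) \<noteq> 0}"
  shows "g summable_on A"
proof -
  define h where "h x = fls_regpart (g x)" for x
  have gh: "g x = fps_to_fls (h x)" if "x \<in> A" for x
    using neg[OF that] by (intro fls_eqI) (auto simp: h_def)
  have "h summable_on A" by (rule summable_on_fps) (use fin in \<open>simp add: h_def\<close>)
  then obtain l where l: "(h has_sum l) A" by (auto simp: summable_on_def)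
  have "((\<lambda>x. fps_to_fls (h x)) has_sum fps_to_fls l) A"
    unfolding has_sum_def
  proof -
    have *: "(\<Sum>x\<in>X. fps_to_fls (h x)) = fps_to_fls (sum h X)" for X
      by (induction X rule: infinite_finite_induct) auto
    show "(sum (\<lambda>x. fps_to_fls (h x)) \<longlongrightarrow> fps_to_fls l) (finite_subsets_at_top A)"
      using l unfolding has_sum_def tendsto_iff * dist_fps_to_fls .
  qed
  then have "(g has_sum fps_to_fls l) A" using gh by (metis (mono_tags, lifting) has_sum_cong)
  then show ?thesis by (auto simp: summable_on_def)
qed

text \<open>
  \<open>filt \<omega> N\<close> is the filtration by total weight, where the Laurent variable has weight 1 and the
  variable \<open>v\<close> has weight \<open>\<omega> v\<close>.
\<close>

definition wt :: "('v \<Rightarrow> nat) \<Rightarrow> ('v \<Rightarrow>\<^sub>0 nat) \<Rightarrow> nat" where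
  "wt \<omega> m = Sum_any (\<lambda>v. \<omega> v * Poly_Mapping.lookup m v)"

lemma wt_add: "wt \<omega> (a + b) = wt \<omega> a + wt \<omega> b"
proof -
  have "finite {v. \<omega> v * Poly_Mapping.lookup c v \<noteq> 0}" for c
    by (rule finite_subset[of _ "Poly_Mapping.keys c"]) (auto simp: in_keys_iff)
  then show ?thesis unfolding wt_def lookup_add distrib_left by (intro Sum_any.distrib)
qed

lemma wt_sum: "wt \<omega> m = (\<Sum>v\<in>Poly_Mapping.keys m. \<omega> v * Poly_Mapping.lookup m v)"
  unfolding wt_def by (rule Sum_any.expand_superset) (auto simp: in_keys_iff)

definition filt :: "('w \<Rightarrow> nat) \<Rightarrow> nat \<Rightarrow> ('w, 'a::comm_ring_1 fls) mps set" where
  "filt \<omega> N = {f. \<forall>M k. fls_nth (mps_coeff f M) k \<noteq> 0 \<longrightarrow> 0 \<le> k \<and> int N \<le> k + int (wt \<omega> M)}"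

lemma filt_add: "f \<in> filt \<omega> N \<Longrightarrow> g \<in> filt \<omega> N \<Longrightarrow> f + g \<in> filt \<omega> N"
  unfolding filt_def
proof (intro CollectI allI impI)
  assume fg: "f \<in> {f. \<forall>M k. fls_nth (mps_coeff f M) k \<noteq> 0 \<longrightarrow> 0 \<le> k \<and> int N \<le> k + int (wt \<omega> M)}"
    "g \<in> {f. \<forall>M k. fls_nth (mps_coeff f M) k \<noteq> 0 \<longrightarrow> 0 \<le> k \<and> int N \<le> k + int (wt \<omega> M)}"
  fix M k assume "fls_nth (mps_coeff (f + g) M) k \<noteq> 0"
  then have "fls_nth (mps_coeff f M) k \<noteq> 0 \<or> fls_nth (mps_coeff g M) k \<noteq> 0" by auto
  then show "0 \<le> k \<and> int N \<le> k + int (wt \<omega> M)" using fg by blast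
qed

lemma filt_diff: "f \<in> filt \<omega> N \<Longrightarrow> g \<in> filt \<omega> N \<Longrightarrow> f - g \<in> filt \<omega> N"
proof -
  assume f: "f \<in> filt \<omega> N" and "g \<in> filt \<omega> N"
  then have "- g \<in> filt \<omega> N" by (simp add: filt_def)
  from filt_add[OF f this] show ?thesis by simp
qed

lemma fls_mult_nonzeroE:
  fixes f g :: "'a::comm_ring_1 fls"
  assumes "fls_nth (f * g) k \<noteq> 0"
  obtains i j where "i + j = k" "fls_nth f i \<noteq> 0" "fls_nth g j \<noteq> 0"
proof -
  have "\<exists>i. fls_nth f i * fls_nth g (k - i) \<noteq> 0"
    using assms unfolding fls_times_nth(2) by (meson sum.neutral)
  then show ?thesis using that by (metis add.commute diff_add_cancel mult_zero_left mult_zero_right)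
qed

lemma filt_mult:
  assumes "f \<in> filt \<omega> a" "g \<in> filt \<omega> b"
  shows "f * g \<in> filt \<omega> (a + b)"
  unfolding filt_def
proof (intro CollectI allI impI)
  fix M k assume "fls_nth (mps_coeff (f * g) M) k \<noteq> 0"
  then have "(\<Sum>p\<in>monom_splits M. fls_nth (mps_coeff f (fst p) * mps_coeff g (snd p)) k) \<noteq> 0"
    by (simp add: mps_coeff_mult case_prod_unfold fls_nth_sum)
  then obtain p where p: "p \<in> monom_splits M" "fls_nth (mps_coeff f (fst p) * mps_coeff g (snd p)) k \<noteq> 0"
    by (meson sum.neutral)
  then obtain i j where ij: "i + j = k" "fls_nth (mps_coeff f (fst p)) i \<noteq> 0" "fls_nth (mps_coeff g (snd p)) j \<noteq> 0"
    using fls_mult_nonzeroE by blast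
  have "0 \<le> i \<and> int a \<le> i + int (wt \<omega> (fst p))" "0 \<le> j \<and> int b \<le> j + int (wt \<omega> (snd p))"
    using assms ij(2,3) by (auto simp: filt_def)
  moreover have "wt \<omega> M = wt \<omega> (fst p) + wt \<omega> (snd p)"
    using p(1) by (auto simp: monom_splits_def wt_add)
  ultimately show "0 \<le> k \<and> int (a + b) \<le> k + int (wt \<omega> M)" using ij(1) by auto
qed

lemma filt_1: "1 \<in> filt \<omega> 0"
  by (auto simp: filt_def mps_coeff_1)

lemma filt_power: "f \<in> filt \<omega> a \<Longrightarrow> f ^ n \<in> filt \<omega> (a * n)"
  by (induction n) (auto simp: filt_1 filt_mult)

lemma filt_prod: "(\<And>i. i \<in> I \<Longrightarrow> f i \<in> filt \<omega> (a i)) \<Longrightarrow> prod f I \<in> filt \<omega> (sum a I)"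
  by (induction I rule: infinite_finite_induct) (auto simp: filt_1 filt_mult)

lemma filt_var: "mps_var v \<in> filt \<omega> (\<omega> v)"
proof -
  have "wt \<omega> (Poly_Mapping.single v 1) = \<omega> v" by (simp add: wt_sum)
  then show ?thesis by (auto simp: filt_def mps_var_def)
qed

lemma filt_miwa: "miwa_shift n \<in> filt \<omega> (Suc n)"
proof -
  have "fls_nth (inverse (of_nat (Suc n)) * fls_X ^ Suc n :: complex fps fls) k \<noteq> 0 \<Longrightarrow> k = int (Suc n)" for k
    unfolding fls_inverse_of_nat fls_X_power_conv_shift_1 by (auto simp: fls_shift_def split: if_splits)
  then show ?thesis by (fastforce simp: filt_def miwa_shift_def mps_const_def)
qed

primrec toda_wt :: "toda_var \<Rightarrow> nat" where
  "toda_wt (Tm n) = Suc n" | "toda_wt (Tb n) = Suc n"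

lemma finite_toda_wt: "finite {m. wt toda_wt m \<le> B}"
proof -
  let ?V = "Tm ` {..<B} \<union> Tb ` {..<B}"
  let ?F = "{f. \<forall>v. (v \<in> ?V \<longrightarrow> f v \<in> {..B}) \<and> (v \<notin> ?V \<longrightarrow> f v = 0)}"
  have "Poly_Mapping.lookup m v \<le> B \<and> (v \<notin> ?V \<longrightarrow> Poly_Mapping.lookup m v = 0)" if "wt toda_wt m \<le> B" for m v
  proof (cases "v \<in> Poly_Mapping.keys m")
    case True
    then have "toda_wt v * Poly_Mapping.lookup m v \<le> wt toda_wt m"
      unfolding wt_sum by (intro member_le_sum) auto
    moreover have "toda_wt v * 1 \<le> toda_wt v * Poly_Mapping.lookup m v"
      using True by (intro mult_le_mono) (auto simp: in_keys_iff)
    moreover have "1 * Poly_Mapping.lookup m v \<le> toda_wt v * Poly_Mapping.lookup m v"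
      by (intro mult_le_mono) (cases v; auto)+
    ultimately have "toda_wt v \<le> B" "Poly_Mapping.lookup m v \<le> B" using that by linarith+
    then show ?thesis by (cases v) auto
  qed (simp add: in_keys_iff)
  then have sub: "Poly_Mapping.lookup ` {m. wt toda_wt m \<le> B} \<subseteq> ?F"
    by (intro image_subsetI CollectI) simp
  have "finite ?V" "finite {..B}" by simp_all
  then have "finite ?F" by (rule finite_set_of_finite_funs)
  from finite_subset[OF sub this] show ?thesis
    by (rule finite_imageD) (rule inj_onI, rule lookup_inject[THEN iffD1])
qed

lemma toda_eval_summable:
  assumes "\<And>n. x n \<in> filt \<omega> (Suc n)" "\<And>n. y n \<in> filt \<omega> (Suc n)"
  shows "(\<lambda>m. mps_const (fls_const (mps_coeff \<tau> m)) *
     (\<Prod>v\<in>Poly_Mapping.keys m. case_toda_var x y v ^ Poly_Mapping.lookup m v)) summable_on UNIV"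
    (is "(\<lambda>m. mps_const (?c m) * ?p m) summable_on _")
  unfolding summable_on_mps_iff mps_coeff_const_mult
proof (intro allI summable_on_fls)
  have "case_toda_var x y v \<in> filt \<omega> (toda_wt v)" for v
    using assms by (cases v) auto
  then have p: "?p m \<in> filt \<omega> (wt toda_wt m)" for m
    unfolding wt_sum by (intro filt_prod filt_power)
  have *: "0 \<le> k \<and> int (wt toda_wt m) \<le> k + int (wt \<omega> M)"
    if "fls_nth (?c m * mps_coeff (?p m) M) k \<noteq> 0" for m M k
  proof -
    have "fls_nth (mps_coeff (?p m) M) k \<noteq> 0" using that by auto
    then show ?thesis using p[of m] unfolding filt_def by blast
  qed
  fix M
  show "fls_nth (?c m * mps_coeff (?p m) M) k = 0" if "k < 0" for m k
    using *[of m M k] that by force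
  show "finite {m \<in> UNIV. fls_nth (?c m * mps_coeff (?p m) M) (int n) \<noteq> 0}" for n
    by (rule finite_subset[OF _ finite_toda_wt[of "n + wt \<omega> M"]]) (use * in fastforce)
qed

lemma toda_xi_summable:
  fixes c :: "nat \<Rightarrow> 'a::{comm_ring_1, topological_space}"
  assumes "inj a" "inj b"
  shows "(\<lambda>n. (mps_var (a n) - mps_var (b n)) * mps_const (c n)) summable_on UNIV"
  unfolding summable_on_mps_iff
proof
  fix M
  have inj_single: "inj (\<lambda>n. Poly_Mapping.single (d n) (1::nat))" if "inj d" for d :: "nat \<Rightarrow> 'b"
    using that by (auto simp: inj_on_def dest!: arg_cong[where f = Poly_Mapping.keys])
  have "finite ((\<lambda>n. Poly_Mapping.single (d n) (1::nat)) -` {M})" if "inj d" for d :: "nat \<Rightarrow> 'b"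
    by (intro finite_vimageI inj_single that) simp
  then have "finite ((\<lambda>n. Poly_Mapping.single (a n) (1::nat)) -` {M} \<union>
      (\<lambda>n. Poly_Mapping.single (b n) (1::nat)) -` {M})"
    using assms by blast
  then show "(\<lambda>n. mps_coeff ((mps_var (a n) - mps_var (b n)) * mps_const (c n)) M) summable_on UNIV"
    by (intro summable_on_finite_support, elim finite_subset[rotated])
      (auto simp: mult.commute[of _ "mps_const _"] mps_coeff_const_mult mps_var_def split: if_splits)
qed

end

theory Submission
  imports Defs
begin

text \<open>
  Encode a pair of a charge \<open>s\<close> and a partition by its Maya diagram, the set of the integers
  \<open>\<lambda>\<^sub>i - i + 1 + s\<close>. The potentials are the regularised power sums of the diagram, so shifting the
  times by \<open>[z\<^sup>-\<^sup>1]\<close> multiplies the summands of the left-hand side that belong to the diagrams \<open>A\<close> (charge \<open>s'\<close>)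
  and \<open>B\<close> (charge \<open>s\<close>) by the rational function \<open>\<Prod>(z - a) / \<Prod>(z - b)\<close>, \<open>a \<in> A - B\<close>, \<open>b \<in> B - A\<close>,
  expanded at infinity; the prefactor \<open>z\<^sup>s\<^sup>'\<^sup>-\<^sup>s\<close> is exactly what is needed. Its residue is a sum over
  \<open>x \<in> B - A\<close>. The right-hand side is likewise a sum over diagrams \<open>A'\<close>, \<open>B'\<close> and \<open>x \<in> A' - B'\<close>, and
  the two sums agree term by term under \<open>A' = A \<union> {x}\<close>, \<open>B' = B - {x}\<close>: the exponentials match because
  moving \<open>x\<close> changes the power sums by the power of \<open>x\<close> supplied by \<open>\<xi>\<close>, and the weights match because
  \<open>dim \<lambda> / |\<lambda>|!\<close> is a Vandermonde product divided by factorials.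
\<close>

section \<open>Divided powers and exponentials of linear forms\<close>

text \<open>As a whole, the integrand is not rational: the factor exp \<xi> has infinitely many
  powers of z. It becomes rational one monomial in the times at a time. The exponent is linear in
  the times, so the coefficient of a fixed monomial in the exponential is a polynomial in z, and its
  residue against the rational factor is a finite sum over simple poles. One residue lemma then
  serves both sides, the polynomial variable being z on the left and z^(-1) on the right. The
  residue at x is a ratio p / q on the left and q / p on the right; the discrepancy p^2 / q^2 is
  what the square of dim \<lambda> / |\<lambda>|! provides. The power of \<Lambda> is preserved by
  the exchange because |\<lambda>| + s(s+1)/2 is the first potential. Since the exchange changes the
  charges, Vandermonde products of different lengths have to be compared; this works because beads
  become shifted parts by a translation that does not depend on the charge.\<close>

abbreviation expo :: "('v \<Rightarrow>\<^sub>0 nat) \<Rightarrow> 'v \<Rightarrow> nat" where "expo \<equiv> Poly_Mapping.lookup"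
abbreviation supp :: "('v \<Rightarrow>\<^sub>0 nat) \<Rightarrow> 'v set" where "supp \<equiv> Poly_Mapping.keys"
abbreviation unit_exp :: "'v \<Rightarrow> ('v \<Rightarrow>\<^sub>0 nat)" where "unit_exp v \<equiv> Poly_Mapping.single v (Suc 0)"

text \<open>Every coefficient below is a product over the variables of a function of one exponent.
  With value 1 at exponent 0 it may be taken over any finite superset of the support, so monomials
  with different supports can be multiplied.\<close>

definition mon_prod :: "('v \<Rightarrow> nat \<Rightarrow> 'a::comm_monoid_mult) \<Rightarrow> ('v \<Rightarrow>\<^sub>0 nat) \<Rightarrow> 'a" where
  "mon_prod f m = (\<Prod>v\<in>supp m. f v (expo m v))"

lemma mon_prod_superset:
  assumes "finite K" "supp m \<subseteq> K" "\<And>v. f v 0 = 1"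
  shows "mon_prod f m = (\<Prod>v\<in>K. f v (expo m v))"
  unfolding mon_prod_def using assms by (intro prod.mono_neutral_left) (auto simp: in_keys_iff)

lemma mon_prod_0 [simp]: "mon_prod f 0 = 1"
  by (simp add: mon_prod_def)

lemma supp_splits:
  assumes "(a, b) \<in> monom_splits m"
  shows "supp a \<subseteq> supp m" "supp b \<subseteq> supp m"
  using assms by (auto simp: monom_splits_def in_keys_iff lookup_add)

text \<open>A factorisation of a monomial is an independent choice, for each variable of its
  support, of the exponent given to the first factor.\<close>

lemma bij_monom_splits:
  "bij_betw (\<lambda>p. restrict (expo (fst p)) (supp m)) (monom_splits m) (Pi\<^sub>E (supp m) (\<lambda>v. {..expo m v}))"
proof (rule bij_betw_byWitness[where f' = "\<lambda>g.
      (Abs_poly_mapping (\<lambda>v. if v \<in> supp m then g v else 0),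
       Abs_poly_mapping (\<lambda>v. if v \<in> supp m then expo m v - g v else 0))"])
  have fin: "finite {v. (if v \<in> supp m then g v else (0::nat)) \<noteq> 0}" for g
    by (rule finite_subset[of _ "supp m"]) auto
  show "\<forall>p\<in>monom_splits m.
      (Abs_poly_mapping (\<lambda>v. if v \<in> supp m then restrict (expo (fst p)) (supp m) v else 0),
       Abs_poly_mapping (\<lambda>v. if v \<in> supp m then expo m v - restrict (expo (fst p)) (supp m) v else 0)) = p"
  proof
    fix p assume p: "p \<in> monom_splits m"
    then have m: "m = fst p + snd p" by (auto simp: monom_splits_def)
    have "(\<lambda>v. if v \<in> supp m then restrict (expo (fst p)) (supp m) v else 0) = expo (fst p)"
      by (auto simp: m fun_eq_iff in_keys_iff lookup_add)
    moreover have "(\<lambda>v. if v \<in> supp m then expo m v - restrict (expo (fst p)) (supp m) v else 0) = expo (snd p)"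
      by (auto simp: m fun_eq_iff in_keys_iff lookup_add)
    ultimately show "(Abs_poly_mapping (\<lambda>v. if v \<in> supp m then restrict (expo (fst p)) (supp m) v else 0),
       Abs_poly_mapping (\<lambda>v. if v \<in> supp m then expo m v - restrict (expo (fst p)) (supp m) v else 0)) = p"
      by (simp only: Poly_Mapping.lookup_inverse prod.collapse)
  qed
  show "\<forall>g\<in>Pi\<^sub>E (supp m) (\<lambda>v. {..expo m v}).
     restrict (expo (fst (Abs_poly_mapping (\<lambda>v. if v \<in> supp m then g v else 0),
       Abs_poly_mapping (\<lambda>v. if v \<in> supp m then expo m v - g v else 0)))) (supp m) = g"
    by (auto simp: lookup_Abs_poly_mapping[OF fin] PiE_def extensional_def fun_eq_iff)
  show "(\<lambda>p. restrict (expo (fst p)) (supp m)) ` monom_splits m \<subseteq> Pi\<^sub>E (supp m) (\<lambda>v. {..expo m v})"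
    by (auto simp: monom_splits_def lookup_add)
  show "(\<lambda>g. (Abs_poly_mapping (\<lambda>v. if v \<in> supp m then g v else 0),
       Abs_poly_mapping (\<lambda>v. if v \<in> supp m then expo m v - g v else 0))) ` Pi\<^sub>E (supp m) (\<lambda>v. {..expo m v})
     \<subseteq> monom_splits m"
    by (auto simp: monom_splits_def lookup_Abs_poly_mapping[OF fin] lookup_add in_keys_iff PiE_iff
        intro!: poly_mapping_eqI)
qed

text \<open>Distributing the product over the one-variable convolutions picks one splitting of each
  exponent, which by \<open>bij_monom_splits\<close> is one splitting of the monomial. Both
  multivariate binomial expansions below are instances.\<close>

lemma mon_prod_convolution:
  fixes f g h :: "'v \<Rightarrow> nat \<Rightarrow> 'a::comm_semiring_1"
  assumes "\<And>v. f v 0 = 1" "\<And>v. g v 0 = 1"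
    and h: "\<And>v n. h v n = (\<Sum>i\<le>n. f v i * g v (n - i))"
  shows "mon_prod h m = (\<Sum>(a, b)\<in>monom_splits m. mon_prod f a * mon_prod g b)"
proof -
  have "mon_prod h m = (\<Prod>v\<in>supp m. \<Sum>i\<in>{..expo m v}. f v i * g v (expo m v - i))"
    by (simp add: mon_prod_def h)
  also have "\<dots> = (\<Sum>k\<in>Pi\<^sub>E (supp m) (\<lambda>v. {..expo m v}). \<Prod>v\<in>supp m. f v (k v) * g v (expo m v - k v))"
    by (rule prod_sum_PiE) auto
  also have "\<dots> = (\<Sum>p\<in>monom_splits m. \<Prod>v\<in>supp m. f v (restrict (expo (fst p)) (supp m) v) *
      g v (expo m v - restrict (expo (fst p)) (supp m) v))"
    by (rule sum.reindex_bij_betw[OF bij_monom_splits, symmetric])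
  also have "\<dots> = (\<Sum>p\<in>monom_splits m. mon_prod f (fst p) * mon_prod g (snd p))"
  proof (rule sum.cong[OF refl])
    fix p assume p: "p \<in> monom_splits m"
    then have e: "expo m v = expo (fst p) v + expo (snd p) v" for v
      by (auto simp: monom_splits_def lookup_add)
    have s: "supp (fst p) \<subseteq> supp m" "supp (snd p) \<subseteq> supp m"
      using supp_splits[of "fst p" "snd p" m] p by auto
    have "mon_prod f (fst p) * mon_prod g (snd p) =
        (\<Prod>v\<in>supp m. f v (expo (fst p) v)) * (\<Prod>v\<in>supp m. g v (expo (snd p) v))"
      using s assms by (simp add: mon_prod_superset[of "supp m"])
    also have "\<dots> = (\<Prod>v\<in>supp m. f v (restrict (expo (fst p)) (supp m) v) *
      g v (expo m v - restrict (expo (fst p)) (supp m) v))"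
      by (auto simp: e prod.distrib[symmetric] intro!: prod.cong)
    finally show "(\<Prod>v\<in>supp m. f v (restrict (expo (fst p)) (supp m) v) *
      g v (expo m v - restrict (expo (fst p)) (supp m) v)) = mon_prod f (fst p) * mon_prod g (snd p)" ..
  qed
  finally show ?thesis by (simp add: case_prod_unfold)
qed

text \<open>
  The coefficient rings \<^typ>\<open>complex fps\<close> and \<^typ>\<open>complex fps fls\<close> are not fields, but the
  factorials are units in them.
\<close>

class fact_inverse = comm_ring_1 + inverse +
  assumes inverse_fact: "inverse (of_nat (fact n)) * of_nat (fact n) = 1"

instance fps :: (field_char_0) fact_inverse
proof
  fix n :: nat
  show "inverse (of_nat (fact n)) * of_nat (fact n) = (1 :: 'a fps)"
    by (simp only: fps_of_nat[symmetric] fps_const_inverse fps_const_mult) simp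
qed

instance fls :: (fact_inverse) fact_inverse
proof
  fix n :: nat
  have "inverse (of_nat (fact n)) * of_nat (fact n) = fls_const (inverse (of_nat (fact n)) * of_nat (fact n) :: 'a)"
    by (simp only: fls_of_nat fls_inverse_const fls_const_mult_const)
  then show "inverse (of_nat (fact n)) * of_nat (fact n) = (1 :: 'a fls)"
    by (simp add: inverse_fact)
qed

abbreviation inv_fact :: "nat \<Rightarrow> 'a::fact_inverse" where "inv_fact n \<equiv> inverse (of_nat (fact n))"

lemma inverse_1_fact_inverse [simp]: "inverse (1::'a::fact_inverse) = 1"
  using inverse_fact[of 0, where ?'a = 'a] by simp

lemma inv_fact_Suc: "of_nat (Suc n) * inv_fact (Suc n) = (inv_fact n :: 'a::fact_inverse)"
proof -
  have "of_nat (Suc n) * inv_fact (Suc n) =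
      of_nat (Suc n) * inv_fact (Suc n) * (of_nat (fact n) * (inv_fact n :: 'a))"
    by (simp only: inverse_fact mult.commute[of "of_nat (fact n)"] mult_1_right)
  also have "\<dots> = (inv_fact (Suc n) * of_nat (fact (Suc n))) * inv_fact n"
    by (simp only: fact_Suc of_nat_mult of_nat_id mult_ac)
  also have "\<dots> = inv_fact n" by (simp only: inverse_fact mult_1)
  finally show ?thesis .
qed

lemma inv_fact_binomial:
  assumes "i \<le> n"
  shows "inv_fact n * of_nat (n choose i) = (inv_fact i * inv_fact (n - i) :: 'a::fact_inverse)"
proof -
  have "inv_fact n * of_nat (n choose i) =
      inv_fact n * of_nat (n choose i) * ((inv_fact i * of_nat (fact i)) * (inv_fact (n - i) * (of_nat (fact (n - i)) :: 'a)))"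
    by (simp only: inverse_fact mult_1_right)
  also have "\<dots> = (inv_fact n * of_nat (fact i * fact (n - i) * (n choose i))) * (inv_fact i * inv_fact (n - i))"
    by (simp only: of_nat_mult mult_ac)
  also have "\<dots> = inv_fact i * inv_fact (n - i)"
    using assms by (simp only: binomial_fact_lemma inverse_fact mult_1)
  finally show ?thesis .
qed

text \<open>The divided power c^m / m!, the coefficient of m in the exponential of the linear form
  with coefficients c.\<close>

definition dpow :: "('v \<Rightarrow> 'a::fact_inverse) \<Rightarrow> ('v \<Rightarrow>\<^sub>0 nat) \<Rightarrow> 'a" where
  "dpow c = mon_prod (\<lambda>v n. inv_fact n * c v ^ n)"

lemma dpow_0 [simp]: "dpow c 0 = 1" by (simp add: dpow_def)

lemma dpow_add_fun: "dpow (\<lambda>v. c v + d v) m = (\<Sum>(a, b)\<in>monom_splits m. dpow c a * dpow d b)"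
  unfolding dpow_def
proof (rule mon_prod_convolution)
  fix v n
  have "inv_fact n * (c v + d v) ^ n = (\<Sum>i\<le>n. (inv_fact n * of_nat (n choose i)) * c v ^ i * d v ^ (n - i))"
    by (simp add: binomial_ring sum_distrib_left mult.assoc)
  also have "\<dots> = (\<Sum>i\<le>n. inv_fact i * c v ^ i * (inv_fact (n - i) * d v ^ (n - i)))"
    by (intro sum.cong refl) (simp only: inv_fact_binomial atMost_iff mult_ac)
  finally show "inv_fact n * (c v + d v) ^ n = (\<Sum>i\<le>n. inv_fact i * c v ^ i * (inv_fact (n - i) * d v ^ (n - i)))" .
qed simp_all

text \<open>The coefficient form of d/dx exp(c x) = c exp(c x) in a single variable. It drives both
  the multinomial theorem and the logarithmic derivative of the Miwa factor.\<close>

lemma dpow_rec: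
  assumes "v \<in> supp m"
  shows "c v * dpow c (m - unit_exp v) = of_nat (expo m v) * dpow c m"
proof -
  let ?f = "\<lambda>v n. inv_fact n * c v ^ n"
  obtain k where k: "expo m v = Suc k" using assms by (auto simp: in_keys_iff gr0_conv_Suc)
  have e: "expo (m - unit_exp v) w = (if w = v then k else expo m w)" for w
    using k by (auto simp: minus_poly_mapping.rep_eq lookup_single)
  have "supp (m - unit_exp v) \<subseteq> supp m"
    using k by (auto simp: in_keys_iff e split: if_splits)
  then have "dpow c (m - unit_exp v) = (\<Prod>w\<in>supp m. ?f w (if w = v then k else expo m w))"
    unfolding dpow_def by (subst mon_prod_superset[of "supp m"]) (auto simp: e)
  also have "\<dots> = ?f v k * (\<Prod>w\<in>supp m - {v}. ?f w (expo m w))"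
    using assms by (subst prod.remove[of _ v]) auto
  finally have 1: "dpow c (m - unit_exp v) = ?f v k * (\<Prod>w\<in>supp m - {v}. ?f w (expo m w))" .
  have "dpow c m = ?f v (Suc k) * (\<Prod>w\<in>supp m - {v}. ?f w (expo m w))"
    unfolding dpow_def mon_prod_def using assms by (subst prod.remove[of _ v]) (auto simp: k)
  moreover have "of_nat (Suc k) * ?f v (Suc k) = c v * ?f v k"
    unfolding mult.assoc[symmetric] inv_fact_Suc by (simp add: mult_ac)
  ultimately show ?thesis using 1 k by (simp only: mult.assoc[symmetric])
qed

definition mexp :: "('v \<Rightarrow> 'a::fact_inverse) \<Rightarrow> ('v, 'a) mps" where
  "mexp c = Abs_mps (dpow c)"

lemma mexp_add: "mexp (\<lambda>v. c v + d v) = mexp c * mexp d"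
  by (rule mps_eqI) (simp add: mexp_def mps_coeff_mult dpow_add_fun)

lemma mdeg_0 [simp]: "mdeg 0 = 0"
  by (simp add: mdeg_def)

text \<open>The inner sum has at most one term, since \<open>unit_exp\<close> is injective; it is 0
  unless m is a single variable. Infinitely many coefficients may be nonzero.\<close>

definition mps_linear :: "('v \<Rightarrow> 'a::comm_ring_1) \<Rightarrow> ('v, 'a) mps" where
  "mps_linear c = Abs_mps (\<lambda>m. \<Sum>v | m = unit_exp v. c v)"

lemma unit_exp_eq_iff [simp]: "unit_exp v = unit_exp w \<longleftrightarrow> v = w"
proof
  assume "unit_exp v = unit_exp w"
  then have "supp (unit_exp v) = supp (unit_exp w)" by (rule arg_cong)
  then show "v = w" by simp
qed simp

lemma unit_exp_split:
  assumes "v \<in> supp m"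
  shows "unit_exp v + (m - unit_exp v) = m"
  using assms by (intro poly_mapping_eqI) (auto simp: lookup_add minus_poly_mapping.rep_eq lookup_single in_keys_iff when_def)

lemma mdeg_unit: "mdeg (unit_exp v) = 1"
  unfolding mdeg_def by (simp add: Sum_any.expand_set lookup_single when_def)

lemma mdeg_sum: "mdeg m = (\<Sum>v\<in>supp m. expo m v)"
  unfolding mdeg_def by (rule Sum_any.expand_superset) (auto simp: in_keys_iff)

lemma mps_coeff_linear_mult:
  "mps_coeff (mps_linear c * f) m = (\<Sum>v\<in>supp m. c v * mps_coeff f (m - unit_exp v))"
proof -
  let ?i = "\<lambda>v. (unit_exp v, m - unit_exp v)"
  have "mps_coeff (mps_linear c * f) m = (\<Sum>p\<in>monom_splits m. mps_coeff (mps_linear c) (fst p) * mps_coeff f (snd p))"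
    by (simp add: mps_coeff_mult case_prod_unfold)
  also have "\<dots> = (\<Sum>p\<in>?i ` supp m. mps_coeff (mps_linear c) (fst p) * mps_coeff f (snd p))"
  proof (rule sum.mono_neutral_right)
    show "?i ` supp m \<subseteq> monom_splits m" by (auto simp: monom_splits_def unit_exp_split)
    show "\<forall>p\<in>monom_splits m - ?i ` supp m. mps_coeff (mps_linear c) (fst p) * mps_coeff f (snd p) = 0"
    proof
      fix p assume p: "p \<in> monom_splits m - ?i ` supp m"
      have "fst p \<noteq> unit_exp v" for v
      proof
        assume v: "fst p = unit_exp v"
        then have m: "m = unit_exp v + snd p" using p by (auto simp: monom_splits_def)
        then have "v \<in> supp m" by (simp add: in_keys_iff lookup_add)
        moreover have "p = ?i v" using m v by (simp add: prod_eq_iff)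
        ultimately show False using p by blast
      qed
      then show "mps_coeff (mps_linear c) (fst p) * mps_coeff f (snd p) = 0"
        by (simp add: mps_linear_def)
    qed
  qed simp
  also have "\<dots> = (\<Sum>v\<in>supp m. mps_coeff (mps_linear c) (unit_exp v) * mps_coeff f (m - unit_exp v))"
    by (subst sum.reindex) (auto simp: inj_on_def)
  also have "\<dots> = (\<Sum>v\<in>supp m. c v * mps_coeff f (m - unit_exp v))"
    by (simp add: mps_linear_def)
  finally show ?thesis .
qed

text \<open>The multinomial theorem. One more linear factor removes one variable from m,
  \<open>dpow_rec\<close> restores it at the price of its exponent, and the exponents add up to the
  degree, which turns n! into (n+1)!.\<close>

lemma mps_coeff_linear_power:
  fixes c :: "'v \<Rightarrow> 'a::fact_inverse"
  shows "mps_coeff (mps_linear c ^ n) m = (if mdeg m = n then of_nat (fact n) * dpow c m else 0)"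
proof (induction n arbitrary: m)
  case 0
  show ?case using mdeg_pos[of m] by (cases "m = 0") (auto simp: mps_coeff_1 mdeg_def)
next
  case (Suc n)
  have deg: "mdeg m = Suc (mdeg (m - unit_exp v))" if "v \<in> supp m" for v
    using mdeg_add[of "unit_exp v" "m - unit_exp v"] unit_exp_split[OF that] mdeg_unit[of v] by simp
  have "mps_coeff (mps_linear c ^ Suc n) m =
      (\<Sum>v\<in>supp m. c v * (if mdeg (m - unit_exp v) = n then of_nat (fact n) * dpow c (m - unit_exp v) else 0))"
    by (simp add: mps_coeff_linear_mult Suc.IH)
  also have "\<dots> = (if mdeg m = Suc n then \<Sum>v\<in>supp m. of_nat (fact n) * (of_nat (expo m v) * dpow c m) else 0)"
    by (auto simp: deg mult.left_commute[of "c _"] dpow_rec intro!: sum.cong sum.neutral)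
  also have "(\<Sum>v\<in>supp m. of_nat (fact n) * (of_nat (expo m v) * dpow c m)) = of_nat (fact n * mdeg m) * dpow c m"
    by (simp add: mdeg_sum sum_distrib_left sum_distrib_right mult_ac)
  finally show ?case by (simp add: mult_ac)
qed

text \<open>A monomial of degree d occurs only in the d-th power of a linear form, so each
  coefficient of the exponential series is a single term, in which 1/d! cancels the d! of the
  multinomial theorem.\<close>

lemma mps_exp_linear:
  fixes c :: "'v \<Rightarrow> 'a::{fact_inverse, t2_space}"
  shows "mps_exp (mps_linear c) = mexp c"
  unfolding mps_exp_def
proof (intro infsumI)
  show "((\<lambda>n. mps_const (inverse (of_nat (fact n))) * mps_linear c ^ n) has_sum mexp c) UNIV"
    unfolding has_sum_mps_iff
  proof
    fix m
    show "((\<lambda>n. mps_coeff (mps_const (inv_fact n) * mps_linear c ^ n) m) has_sum mps_coeff (mexp c) m) UNIV"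
      by (rule has_sum_finite_neutralI[of "{mdeg m}"])
        (auto simp: mps_coeff_const_mult mps_coeff_linear_power mexp_def mult.assoc[symmetric] inverse_fact)
  qed
qed

lemma infsum_var_linear:
  fixes k :: "nat \<Rightarrow> 'a::{comm_ring_1, t2_space}"
  assumes "inj \<iota>"
  shows "(\<Sum>\<^sub>\<infinity>n. mps_var (\<iota> n) * mps_const (k n)) = mps_linear (\<lambda>v. \<Sum>n | v = \<iota> n. k n)"
proof (rule infsumI, unfold has_sum_mps_iff, rule)
  fix m
  show "((\<lambda>n. mps_coeff (mps_var (\<iota> n) * mps_const (k n)) m) has_sum
      mps_coeff (mps_linear (\<lambda>v. \<Sum>n | v = \<iota> n. k n)) m) UNIV"
  proof (cases "\<exists>n. m = unit_exp (\<iota> n)")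
    case True
    then obtain n where n: "m = unit_exp (\<iota> n)" by blast
    show ?thesis
      by (rule has_sum_finite_neutralI[of "{n}"])
        (use assms in \<open>auto simp: n inj_eq mult.commute[of _ "mps_const _"] mps_coeff_const_mult mps_var_def mps_linear_def\<close>)
  next
    case False
    have "mps_coeff (mps_linear (\<lambda>v. \<Sum>n | v = \<iota> n. k n)) m = 0"
      using False by (auto simp: mps_linear_def intro!: sum.neutral)
    then show ?thesis
      using False by (intro has_sum_finite_neutralI[of "{}"])
        (auto simp: mult.commute[of _ "mps_const _"] mps_coeff_const_mult mps_var_def)
  qed
qed

lemma infsum_var_diff_linear:
  fixes k :: "nat \<Rightarrow> 'a::{comm_ring_1, t2_space}"
  assumes "inj \<iota>" "inj \<kappa>" "range \<iota> \<inter> range \<kappa> = {}"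
  shows "(\<Sum>\<^sub>\<infinity>n. (mps_var (\<iota> n) - mps_var (\<kappa> n)) * mps_const (k n)) =
    mps_linear (\<lambda>v. (\<Sum>n | v = \<iota> n. k n) - (\<Sum>n | v = \<kappa> n. k n))"
proof (rule infsumI, unfold has_sum_mps_iff, rule)
  fix m
  have ne: "\<iota> i \<noteq> \<kappa> j" for i j using assms(3) by blast
  let ?l = "mps_linear (\<lambda>v. (\<Sum>n | v = \<iota> n. k n) - (\<Sum>n | v = \<kappa> n. k n))"
  show "((\<lambda>n. mps_coeff ((mps_var (\<iota> n) - mps_var (\<kappa> n)) * mps_const (k n)) m) has_sum mps_coeff ?l m) UNIV"
  proof (cases "\<exists>n. m = unit_exp (\<iota> n) \<or> m = unit_exp (\<kappa> n)")
    case True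
    then obtain n where n: "m = unit_exp (\<iota> n) \<or> m = unit_exp (\<kappa> n)" by blast
    show ?thesis
      by (rule has_sum_finite_neutralI[of "{n}"])
        (use n assms ne ne[symmetric] in \<open>auto simp: inj_eq mult.commute[of _ "mps_const _"] mps_coeff_const_mult mps_var_def mps_linear_def\<close>)
  next
    case False
    have "mps_coeff ?l m = 0"
      using False by (auto simp: mps_linear_def intro!: sum.neutral)
    then show ?thesis
      using False by (intro has_sum_finite_neutralI[of "{}"])
        (auto simp: mult.commute[of _ "mps_const _"] mps_coeff_const_mult mps_var_def)
  qed
qed

section \<open>Monomials, constants and renaming of variables\<close>

definition mps_monom :: "('v \<Rightarrow>\<^sub>0 nat) \<Rightarrow> ('v, 'a::comm_ring_1) mps" where
  "mps_monom p = Abs_mps (\<lambda>m. if m = p then 1 else 0)"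

lemma mps_monom_0: "mps_monom 0 = 1"
  by (rule mps_eqI) (simp add: mps_monom_def mps_coeff_1)

lemma mps_monom_mult: "mps_monom p * mps_monom q = mps_monom (p + q)"
proof (rule mps_eqI)
  fix m
  have "mps_coeff (mps_monom p * mps_monom q :: ('a, 'b) mps) m =
      (\<Sum>x\<in>monom_splits m \<inter> {(p, q)}. 1)"
    unfolding mps_coeff_mult
    by (rule sum.mono_neutral_cong_right) (auto simp: mps_monom_def split: if_splits)
  also have "\<dots> = mps_coeff (mps_monom (p + q)) m"
    by (auto simp: mps_monom_def monom_splits_def)
  finally show "mps_coeff (mps_monom p * mps_monom q) m = mps_coeff (mps_monom (p + q) :: ('a, 'b) mps) m" .
qed

lemma mps_var_power: "mps_var v ^ n = mps_monom (Poly_Mapping.single v n)"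
proof (induction n)
  case (Suc n)
  have "mps_var v = (mps_monom (unit_exp v) :: ('a, 'b) mps)"
    by (simp add: mps_var_def mps_monom_def)
  then have "mps_var v ^ Suc n = (mps_monom (unit_exp v) * mps_monom (Poly_Mapping.single v n) :: ('a, 'b) mps)"
    using Suc by (simp only: power_Suc)
  then show ?case by (simp add: mps_monom_mult single_add[symmetric])
qed (simp add: mps_monom_0)

lemma mps_const_1 [simp]: "mps_const 1 = 1"
  by (rule mps_eqI) (simp add: mps_const_def mps_coeff_1)

lemma mps_const_mult: "mps_const (a * b) = mps_const a * mps_const b"
  by (rule mps_eqI) (simp add: mps_coeff_const_mult, simp add: mps_const_def)

lemma mps_const_add: "mps_const (a + b) = mps_const a + mps_const b"
  by (rule mps_eqI) (simp add: mps_const_def)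

lemma mps_const_0 [simp]: "mps_const 0 = 0"
  by (rule mps_eqI) (simp add: mps_const_def)

lemma mps_const_of_nat: "mps_const (of_nat k) = of_nat k"
  by (induction k) (simp_all add: mps_const_add)

lemma mps_const_power: "mps_const a ^ n = mps_const (a ^ n)"
  by (induction n) (simp_all add: mps_const_mult)

lemma mps_const_prod: "mps_const (prod f A) = (\<Prod>x\<in>A. mps_const (f x))"
  by (induction A rule: infinite_finite_induct) (simp_all add: mps_const_mult)

definition push_exp :: "('v \<Rightarrow> 'w) \<Rightarrow> ('v \<Rightarrow>\<^sub>0 nat) \<Rightarrow> ('w \<Rightarrow>\<^sub>0 nat)" where
  "push_exp \<iota> a = (\<Sum>v\<in>supp a. Poly_Mapping.single (\<iota> v) (expo a v))"

lemma expo_push_sum: "expo (push_exp \<iota> a) w = (\<Sum>v\<in>supp a. expo a v when \<iota> v = w)"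
  by (simp add: push_exp_def lookup_sum lookup_single)

lemma expo_push_exp:
  assumes "inj \<iota>"
  shows "expo (push_exp \<iota> a) (\<iota> v) = expo a v"
proof -
  have "expo (push_exp \<iota> a) (\<iota> v) = (\<Sum>u\<in>supp a. if u = v then expo a v else 0)"
    unfolding expo_push_sum using assms by (intro sum.cong) (auto simp: inj_eq when_def)
  also have "\<dots> = expo a v" by (simp add: in_keys_iff)
  finally show ?thesis .
qed

lemma expo_push_exp_outside: "w \<notin> range \<iota> \<Longrightarrow> expo (push_exp \<iota> a) w = 0"
  unfolding expo_push_sum by (intro sum.neutral) (auto simp: when_def)

lemma supp_push_exp: "inj \<iota> \<Longrightarrow> supp (push_exp \<iota> a) = \<iota> ` supp a"
proof (intro set_eqI)
  fix w assume inj: "inj \<iota>"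
  show "w \<in> supp (push_exp \<iota> a) \<longleftrightarrow> w \<in> \<iota> ` supp a"
    by (cases "w \<in> range \<iota>") (auto simp: in_keys_iff expo_push_exp[OF inj] expo_push_exp_outside)
qed

lemma push_exp_inj:
  assumes "inj \<iota>" "push_exp \<iota> a = push_exp \<iota> b"
  shows "a = b"
  using assms by (intro poly_mapping_eqI) (metis expo_push_exp)

lemma push_exp_surj:
  assumes "inj \<iota>" "supp m \<subseteq> range \<iota>"
  shows "\<exists>a. m = push_exp \<iota> a"
proof
  show "m = push_exp \<iota> (Poly_Mapping.map_key \<iota> m)"
  proof (rule poly_mapping_eqI)
    fix w
    show "expo m w = expo (push_exp \<iota> (Poly_Mapping.map_key \<iota> m)) w"
    proof (cases "w \<in> range \<iota>")
      case True
      then show ?thesis using assms(1) by (auto simp: expo_push_exp map_key.rep_eq)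
    next
      case False
      then show ?thesis using assms(2) by (auto simp: expo_push_exp_outside in_keys_iff)
    qed
  qed
qed

lemma prod_var_powers:
  "(\<Prod>v\<in>supp a. mps_var (\<iota> v) ^ expo a v) = (mps_monom (push_exp \<iota> a) :: ('w, 'b::comm_ring_1) mps)"
proof -
  have "(\<Prod>v\<in>A. mps_monom (f v)) = (mps_monom (\<Sum>v\<in>A. f v) :: ('w, 'b) mps)" for f :: "'a \<Rightarrow> ('w \<Rightarrow>\<^sub>0 nat)" and A
    by (induction A rule: infinite_finite_induct) (auto simp: mps_monom_0 mps_monom_mult)
  then show ?thesis by (simp add: mps_var_power push_exp_def)
qed

lemma dpow_push:
  assumes "inj \<iota>"
  shows "dpow d (push_exp \<iota> a) = dpow (\<lambda>v. d (\<iota> v)) a"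
proof -
  have "inj_on \<iota> (supp a)" using assms by (rule inj_on_subset) simp
  then show ?thesis
    unfolding dpow_def mon_prod_def supp_push_exp[OF assms]
    by (subst prod.reindex) (auto simp: expo_push_exp[OF assms])
qed

lemma dpow_eq_0:
  assumes "v \<in> supp m" "d v = 0"
  shows "dpow d m = 0"
  unfolding dpow_def mon_prod_def using assms by (intro prod_zero bexI[of _ v]) (auto simp: in_keys_iff power_0_left)

lemma dpow_scale: 
  "dpow (\<lambda>v. c v * d v) m = dpow c m * (\<Prod>v\<in>supp m. d v ^ expo m v)"
  by (simp add: dpow_def mon_prod_def power_mult_distrib prod.distrib[symmetric] mult_ac)

text \<open>The binomial theorem with the substituted series as arguments. The divided power absorbs
  the binomial coefficients, so the two summands of a substituted variable separate
  completely.\<close>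

lemma subst_term_split:
  fixes y z :: "'v \<Rightarrow> ('w, 'b::fact_inverse) mps" and c :: "'v \<Rightarrow> 'b"
  shows "mps_const (dpow c m) * (\<Prod>v\<in>supp m. (y v + z v) ^ expo m v) =
    (\<Sum>(a, b)\<in>monom_splits m. (mps_const (dpow c a) * (\<Prod>v\<in>supp a. y v ^ expo a v)) *
        (mps_const (dpow c b) * (\<Prod>v\<in>supp b. z v ^ expo b v)))"
proof -
  define f where "f y v n = mps_const (inv_fact n * c v ^ n) * y v ^ n" for y :: "'v \<Rightarrow> ('w, 'b) mps" and v n
  have f: "mon_prod (f y) m = mps_const (dpow c m) * (\<Prod>v\<in>supp m. y v ^ expo m v)" for y m
    unfolding mon_prod_def f_def dpow_def mps_const_prod by (rule prod.distrib)
  have "mon_prod (f (\<lambda>v. y v + z v)) m = (\<Sum>(a, b)\<in>monom_splits m. mon_prod (f y) a * mon_prod (f z) b)"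
  proof (rule mon_prod_convolution)
    fix v n
    have e: "mps_const (inv_fact n * c v ^ n) * (of_nat (n choose i) :: ('w, 'b) mps) =
        mps_const (inv_fact i * c v ^ i) * mps_const (inv_fact (n - i) * c v ^ (n - i) :: 'b)"
      if "i \<le> n" for i
    proof -
      have "mps_const (inv_fact n * c v ^ n) * of_nat (n choose i) =
          (mps_const (inv_fact n * c v ^ n * of_nat (n choose i)) :: ('w, 'b) mps)"
        by (simp only: mps_const_mult mps_const_of_nat)
      also have "inv_fact n * c v ^ n * of_nat (n choose i) = inv_fact n * of_nat (n choose i) * (c v ^ i * c v ^ (n - i))"
        using that by (simp add: power_add[symmetric] mult_ac)
      also have "\<dots> = inv_fact i * c v ^ i * (inv_fact (n - i) * c v ^ (n - i))"
        using that by (simp only: inv_fact_binomial mult_ac)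
      finally show ?thesis by (simp only: mps_const_mult)
    qed
    have "f (\<lambda>v. y v + z v) v n = (\<Sum>i\<le>n. (mps_const (inv_fact n * c v ^ n) * of_nat (n choose i)) * (y v ^ i * z v ^ (n - i)))"
      by (simp add: f_def binomial_ring sum_distrib_left mult.assoc)
    also have "\<dots> = (\<Sum>i\<le>n. f y v i * f z v (n - i))"
      by (intro sum.cong refl, subst e) (simp_all only: f_def atMost_iff mult_ac)
    finally show "f (\<lambda>v. y v + z v) v n = (\<Sum>i\<le>n. f y v i * f z v (n - i))" .
  qed (simp_all add: f_def)
  then show ?thesis by (simp only: f)
qed

section \<open>Substitutions into exponentials\<close>

lemma dpow_add_disjoint:
  assumes "supp p \<inter> supp q = {}"
  shows "dpow d (p + q) = dpow d p * dpow d q"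
proof -
  let ?f = "\<lambda>v n. inv_fact n * d v ^ n"
  have 0: "v \<in> supp p \<Longrightarrow> expo q v = 0" "v \<in> supp q \<Longrightarrow> expo p v = 0" for v
    using assms by (auto simp: in_keys_iff)
  have "supp (p + q) \<subseteq> supp p \<union> supp q" by (rule Poly_Mapping.keys_add)
  then have "dpow d (p + q) = (\<Prod>v\<in>supp p \<union> supp q. ?f v (expo (p + q) v))"
    unfolding dpow_def by (intro mon_prod_superset) auto
  also have "\<dots> = (\<Prod>v\<in>supp p. ?f v (expo (p + q) v)) * (\<Prod>v\<in>supp q. ?f v (expo (p + q) v))"
    using assms by (intro prod.union_disjoint) auto
  also have "(\<Prod>v\<in>supp p. ?f v (expo (p + q) v)) = dpow d p"
    unfolding dpow_def mon_prod_def by (intro prod.cong refl) (simp add: lookup_add 0)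
  also have "(\<Prod>v\<in>supp q. ?f v (expo (p + q) v)) = dpow d q"
    unfolding dpow_def mon_prod_def by (intro prod.cong refl) (simp add: lookup_add 0)
  finally show ?thesis .
qed

text \<open>With c = 1 the divided power is 1/m!. Being a unit, it can be cancelled, which carries
  vanishing statements from divided powers over to bare monomials.\<close>

lemma dpow_one_unit: "\<exists>u. u * dpow (\<lambda>_. 1) m = (1 :: 'a::fact_inverse)"
proof
  show "(\<Prod>v\<in>supp m. of_nat (fact (expo m v))) * dpow (\<lambda>_. 1) m = (1 :: 'a)"
    by (simp only: dpow_def mon_prod_def prod.distrib[symmetric] power_one mult_1_right
        mult.commute[of "of_nat _"] inverse_fact prod.neutral_const)
qed

lemma mps_coeff_monom_prod:
  "mps_coeff (mps_const \<alpha> * mps_monom p * (mps_const \<beta> * mps_monom q)) M = (if M = p + q then \<alpha> * \<beta> else 0)"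
proof -
  have "mps_const \<alpha> * mps_monom p * (mps_const \<beta> * mps_monom q) = mps_const (\<alpha> * \<beta>) * (mps_monom (p + q) :: ('b, 'a) mps)"
    by (simp only: mps_const_mult mps_monom_mult[symmetric] mult_ac)
  then show ?thesis by (simp add: mps_coeff_const_mult mps_monom_def)
qed

section \<open>Substituting the difference of the two alphabets\<close>

definition toda_diff :: "(nat, complex fps) mps \<Rightarrow> (toda_var, complex fps) mps" where
  "toda_diff = mps_subst (\<lambda>c. c) (\<lambda>n. mps_var (Tm n) - mps_var (Tb n))"

abbreviation part_m :: "(toda_var \<Rightarrow>\<^sub>0 nat) \<Rightarrow> (nat \<Rightarrow>\<^sub>0 nat)" where "part_m \<equiv> Poly_Mapping.map_key Tm"
abbreviation part_b :: "(toda_var \<Rightarrow>\<^sub>0 nat) \<Rightarrow> (nat \<Rightarrow>\<^sub>0 nat)" where "part_b \<equiv> Poly_Mapping.map_key Tb"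

lemma inj_Tm [simp]: "inj Tm" and inj_Tb [simp]: "inj Tb"
  by (auto simp: inj_def)

lemma expo_push_toda [simp]:
  "expo (push_exp Tm a) (Tm n) = expo a n" "expo (push_exp Tm a) (Tb n) = 0"
  "expo (push_exp Tb a) (Tb n) = expo a n" "expo (push_exp Tb a) (Tm n) = 0"
  by (auto simp: expo_push_exp expo_push_exp_outside image_iff)

lemma toda_exp_eq_iff: "M = push_exp Tm a + push_exp Tb b \<longleftrightarrow> a = part_m M \<and> b = part_b M"
proof
  assume "M = push_exp Tm a + push_exp Tb b"
  then show "a = part_m M \<and> b = part_b M"
    by (auto intro!: poly_mapping_eqI simp: map_key.rep_eq lookup_add)
next
  assume "a = part_m M \<and> b = part_b M"
  then show "M = push_exp Tm a + push_exp Tb b"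
    by (intro poly_mapping_eqI, case_tac k) (auto simp: map_key.rep_eq lookup_add)
qed

abbreviation diff_monom :: "(nat \<Rightarrow>\<^sub>0 nat) \<Rightarrow> (toda_var, complex fps) mps" where
  "diff_monom m \<equiv> \<Prod>n\<in>supp m. (mps_var (Tm n) - mps_var (Tb n)) ^ expo m n"

text \<open>M determines its part in each alphabet, so at most one pair of the binomial splitting
  contributes. The signs of the second alphabet are absorbed by replacing c with -c there.\<close>

lemma mps_coeff_diff_term:
  "dpow c m * mps_coeff (diff_monom m) M =
     (if m = part_m M + part_b M then dpow c (part_m M) * dpow (\<lambda>n. - c n) (part_b M) else 0)"
proof -
  have neg: "mps_const (dpow c b) * (\<Prod>n\<in>supp b. (- mps_var (Tb n)) ^ expo b n) =
      mps_const (dpow (\<lambda>n. - c n) b) * (mps_monom (push_exp Tb b) :: (toda_var, complex fps) mps)" for b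
  proof -
    have "- mps_var (Tb n) = mps_const (- 1) * (mps_var (Tb n) :: (toda_var, complex fps) mps)" for n
      by (rule mps_eqI) (simp add: mps_coeff_const_mult)
    then have "(\<Prod>n\<in>supp b. (- mps_var (Tb n)) ^ expo b n) =
        mps_const (\<Prod>n\<in>supp b. (- 1) ^ expo b n) * (\<Prod>n\<in>supp b. mps_var (Tb n) ^ expo b n :: (toda_var, complex fps) mps)"
      by (simp only: power_mult_distrib prod.distrib mps_const_prod mps_const_power)
    then show ?thesis
      using dpow_scale[of c "\<lambda>_. - 1" b] by (simp add: prod_var_powers mps_const_mult mult.assoc)
  qed
  have "dpow c m * mps_coeff (diff_monom m) M =
      mps_coeff (mps_const (dpow c m) * (\<Prod>n\<in>supp m. (mps_var (Tm n) + - mps_var (Tb n)) ^ expo m n)) M"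
    by (simp add: mps_coeff_const_mult)
  also have "\<dots> = (\<Sum>(a, b)\<in>monom_splits m. if M = push_exp Tm a + push_exp Tb b
      then dpow c a * dpow (\<lambda>n. - c n) b else 0)"
    by (simp only: subst_term_split neg prod_var_powers mps_coeff_sum mps_coeff_monom_prod case_prod_unfold)
  also have "\<dots> = (\<Sum>p\<in>monom_splits m. if p = (part_m M, part_b M)
      then dpow c (part_m M) * dpow (\<lambda>n. - c n) (part_b M) else 0)"
    by (intro sum.cong refl) (auto simp: toda_exp_eq_iff split: if_splits)
  also have "\<dots> = (if (part_m M, part_b M) \<in> monom_splits m
      then dpow c (part_m M) * dpow (\<lambda>n. - c n) (part_b M) else 0)"
    by simp
  finally show ?thesis by (auto simp: monom_splits_def)
qed

lemma mps_coeff_diff_monom: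
  assumes "m \<noteq> part_m M + part_b M"
  shows "mps_coeff (diff_monom m) M = 0"
proof -
  obtain u :: "complex fps" where u: "u * dpow (\<lambda>_. 1) m = 1" using dpow_one_unit by blast
  have "mps_coeff (diff_monom m) M = u * (dpow (\<lambda>_. 1) m * mps_coeff (diff_monom m) M)"
    by (simp add: u mult.assoc[symmetric])
  also have "\<dots> = 0" using assms by (simp add: mps_coeff_diff_term)
  finally show ?thesis .
qed

text \<open>Only one monomial of f can reach M, so the infinite sum that defines the substitution
  has at most one nonzero term in each coefficient. This holds for every f, in particular for the
  remainder of a truncation.\<close>

lemma mps_coeff_toda_diff:
  "mps_coeff (toda_diff f) M =
     mps_coeff f (part_m M + part_b M) * mps_coeff (diff_monom (part_m M + part_b M)) M"
proof -
  have "toda_diff f = Abs_mps (\<lambda>M. mps_coeff f (part_m M + part_b M) * mps_coeff (diff_monom (part_m M + part_b M)) M)"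
    unfolding toda_diff_def mps_subst_def
  proof (rule infsumI, unfold has_sum_mps_iff, rule)
    fix M
    show "((\<lambda>m. mps_coeff (mps_const (mps_coeff f m) * diff_monom m) M) has_sum
        mps_coeff (Abs_mps (\<lambda>M. mps_coeff f (part_m M + part_b M) * mps_coeff (diff_monom (part_m M + part_b M)) M)) M) UNIV"
      by (rule has_sum_finite_neutralI[of "{part_m M + part_b M}"])
        (auto simp: mps_coeff_const_mult mps_coeff_diff_monom)
  qed
  then show ?thesis by simp
qed

lemma toda_diff_add: "toda_diff (f + g) = toda_diff f + toda_diff g"
  by (rule mps_eqI) (simp add: mps_coeff_toda_diff algebra_simps)

lemma toda_diff_const_mult: "toda_diff (mps_const c * f) = mps_const c * toda_diff f"
  by (rule mps_eqI) (simp add: mps_coeff_toda_diff mps_coeff_const_mult mult.assoc)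

lemma toda_diff_mexp: "toda_diff (mexp c) = mexp (case_toda_var c (\<lambda>n. - c n))"
proof (rule mps_eqI)
  fix M
  let ?d = "case_toda_var c (\<lambda>n. - c n)"
  have M: "M = push_exp Tm (part_m M) + push_exp Tb (part_b M)"
    by (simp add: toda_exp_eq_iff)
  have "supp (push_exp Tm (part_m M)) \<inter> supp (push_exp Tb (part_b M)) = {}"
    by (auto simp: supp_push_exp)
  from dpow_add_disjoint[OF this, of ?d]
  have "dpow ?d M = dpow c (part_m M) * dpow (\<lambda>n. - c n) (part_b M)"
    using M by (simp add: dpow_push)
  then show "mps_coeff (toda_diff (mexp c)) M = mps_coeff (mexp ?d) M"
    by (simp add: mps_coeff_toda_diff mexp_def mps_coeff_diff_term)
qed

section \<open>Miwa shifts as substitutions with Laurent coefficients\<close>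

lemma has_sum_flsI:
  fixes g :: "'c \<Rightarrow> 'a::comm_ring_1 fls"
  assumes neg: "\<And>x k. x \<in> A \<Longrightarrow> k < 0 \<Longrightarrow> fls_nth (g x) k = 0"
    and F: "\<And>n. finite (F n)" "\<And>n. F n \<subseteq> A"
    and out: "\<And>n x. x \<in> A - F n \<Longrightarrow> fls_nth (g x) (int n) = 0"
  shows "(g has_sum fps_to_fls (Abs_fps (\<lambda>n. \<Sum>x\<in>F n. fls_nth (g x) (int n)))) A"
proof -
  define h where "h x = fls_regpart (g x)" for x
  let ?l = "Abs_fps (\<lambda>n. \<Sum>x\<in>F n. fls_nth (g x) (int n))"
  have gh: "g x = fps_to_fls (h x)" if "x \<in> A" for x
    using neg[OF that] by (intro fls_eqI) (auto simp: h_def)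
  \<comment> \<open>Without negative powers the terms are power series, where convergence means that
    each coefficient is eventually constant along finite sets; \<open>dist_fps_to_fls\<close>
    carries the limit back to Laurent series.\<close>
  have "(h has_sum ?l) A"
    unfolding has_sum_def tendsto_fps_iff
  proof
    fix n
    have "\<forall>\<^sub>F X in finite_subsets_at_top A. finite X \<and> F n \<subseteq> X \<and> X \<subseteq> A"
      using F by (intro eventually_finite_subsets_at_top_weakI[THEN eventually_conj] eventually_conj)
        (auto simp: eventually_finite_subsets_at_top)
    then show "\<forall>\<^sub>F X in finite_subsets_at_top A. fps_nth (sum h X) n = fps_nth ?l n"
    proof (rule eventually_mono)
      fix X assume X: "finite X \<and> F n \<subseteq> X \<and> X \<subseteq> A"
      then have "(\<Sum>x\<in>X. fls_nth (g x) (int n)) = (\<Sum>x\<in>F n. fls_nth (g x) (int n))"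
        using out by (intro sum.mono_neutral_right) auto
      then show "fps_nth (sum h X) n = fps_nth ?l n" by (simp add: fps_sum_nth h_def)
    qed
  qed
  have "((\<lambda>x. fps_to_fls (h x)) has_sum fps_to_fls ?l) A"
  proof -
    have *: "(\<Sum>x\<in>X. fps_to_fls (h x)) = fps_to_fls (sum h X)" for X
      by (induction X rule: infinite_finite_induct) auto
    show ?thesis
      using \<open>(h has_sum ?l) A\<close> unfolding has_sum_def tendsto_iff * dist_fps_to_fls .
  qed
  then show ?thesis using gh by (metis (mono_tags, lifting) has_sum_cong)
qed

lemma fls_const_prod: "fls_const (prod f A) = (\<Prod>x\<in>A. fls_const (f x :: 'a::comm_ring_1))"
  by (induction A rule: infinite_finite_induct) (auto simp: fls_const_mult_const[symmetric])

lemma dpow_fls_const: "dpow (\<lambda>v. fls_const (c v)) m = fls_const (dpow c m :: 'a::fact_inverse)"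
proof -
  have "inv_fact n * fls_const a ^ n = fls_const (inv_fact n * a ^ n :: 'a)" for n a
    by (simp only: fls_const_power[symmetric] fls_of_nat fls_inverse_const fls_const_mult_const)
  then show ?thesis unfolding dpow_def mon_prod_def fls_const_prod by simp
qed

text \<open>
  \<open>\<iota>\<close> renames the two alphabets and \<open>\<epsilon>\<close> holds the coefficients of the shift by \<open>\<plusminus>[w]\<close>; it vanishes on the
  alphabet that is not shifted.
\<close>

definition toda_subst :: "(toda_var \<Rightarrow> 'w) \<Rightarrow> (toda_var \<Rightarrow> complex fps) \<Rightarrow> (toda_var, complex fps) mps \<Rightarrow>
    ('w, complex fps fls) mps" where
  "toda_subst \<iota> \<epsilon> = mps_subst fls_const (\<lambda>v. mps_var (\<iota> v) + mps_const (fls_const (\<epsilon> v) * fls_X ^ toda_wt v))"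

abbreviation miwa_monom :: "(toda_var \<Rightarrow> 'w) \<Rightarrow> (toda_var \<Rightarrow> complex fps) \<Rightarrow> (toda_var \<Rightarrow>\<^sub>0 nat) \<Rightarrow>
    ('w, complex fps fls) mps" where
  "miwa_monom \<iota> \<epsilon> m \<equiv> \<Prod>v\<in>supp m. (mps_var (\<iota> v) + mps_const (fls_const (\<epsilon> v) * fls_X ^ toda_wt v)) ^ expo m v"

text \<open>In the splitting the renamed variables depend only on a and the shift only on b: the
  former yields one monomial, the latter a constant times the power of w given by the weight of
  b.\<close>

lemma fls_nth_miwa_term:
  fixes \<iota> :: "toda_var \<Rightarrow> 'w"
  shows "dpow c m * fls_nth (mps_coeff (miwa_monom \<iota> \<epsilon> m) M) k =
     (\<Sum>(a, b)\<in>monom_splits m. if M = push_exp \<iota> a \<and> k = int (wt toda_wt b)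
        then dpow c a * dpow (\<lambda>v. c v * \<epsilon> v) b else 0)"
proof -
  let ?c = "\<lambda>v. fls_const (c v)" and ?z = "\<lambda>v. mps_const (fls_const (\<epsilon> v) * fls_X ^ toda_wt v) :: ('w, complex fps fls) mps"
  have z: "mps_const (dpow ?c b) * (\<Prod>v\<in>supp b. ?z v ^ expo b v) =
      mps_const (fls_const (dpow (\<lambda>v. c v * \<epsilon> v) b) * fls_X ^ wt toda_wt b) * mps_monom 0" for b
  proof -
    have "(\<Prod>v\<in>supp b. ?z v ^ expo b v) =
        mps_const (fls_const (\<Prod>v\<in>supp b. \<epsilon> v ^ expo b v) * fls_X ^ wt toda_wt b)"
      by (simp add: mps_const_power mps_const_prod[symmetric] power_mult_distrib prod.distrib fls_const_prod
          fls_const_power wt_sum power_sum power_mult)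
    then show ?thesis
      by (simp add: mps_monom_0 dpow_scale dpow_fls_const mps_const_mult[symmetric] mult.assoc[symmetric])
  qed
  have "dpow c m * fls_nth (mps_coeff (miwa_monom \<iota> \<epsilon> m) M) k =
      fls_nth (mps_coeff (mps_const (dpow ?c m) * (miwa_monom \<iota> \<epsilon> m)) M) k"
    by (simp add: mps_coeff_const_mult dpow_fls_const)
  also have "\<dots> = fls_nth (\<Sum>(a, b)\<in>monom_splits m. if M = push_exp \<iota> a + 0
      then dpow ?c a * (fls_const (dpow (\<lambda>v. c v * \<epsilon> v) b) * fls_X ^ wt toda_wt b) else 0) k"
    by (simp only: subst_term_split z prod_var_powers mps_coeff_sum mps_coeff_monom_prod case_prod_unfold)
  also have "\<dots> = (\<Sum>(a, b)\<in>monom_splits m. if M = push_exp \<iota> a \<and> k = int (wt toda_wt b)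
        then dpow c a * dpow (\<lambda>v. c v * \<epsilon> v) b else 0)"
    unfolding fls_nth_sum
    by (intro sum.cong refl)
      (auto simp: dpow_fls_const fls_X_power_conv_shift_1 fls_times_both_shifted_simp mult.assoc[symmetric])
  finally show ?thesis .
qed

text \<open>A monomial contributing to M and w^k splits into a part that is renamed to M and a part
  of weight k, which gives the bound. Weight is used instead of degree because only finitely many
  monomials have bounded weight.\<close>

abbreviation miwa_bound :: "(toda_var \<Rightarrow> 'w) \<Rightarrow> ('w \<Rightarrow>\<^sub>0 nat) \<Rightarrow> int \<Rightarrow> (toda_var \<Rightarrow>\<^sub>0 nat) set" where
  "miwa_bound \<iota> M k \<equiv> {m. wt toda_wt m \<le> wt toda_wt (Poly_Mapping.map_key \<iota> M) + nat k}"

lemma map_key_push_exp: "inj \<iota> \<Longrightarrow> Poly_Mapping.map_key \<iota> (push_exp \<iota> a) = a"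
  by (intro poly_mapping_eqI) (simp add: map_key.rep_eq expo_push_exp)

lemma fls_nth_miwa_monom_eq_0:
  assumes "inj \<iota>" "k < 0 \<or> m \<notin> miwa_bound \<iota> M k"
  shows "fls_nth (mps_coeff (miwa_monom \<iota> \<epsilon> m) M) k = 0"
proof -
  obtain u :: "complex fps" where u: "u * dpow (\<lambda>_. 1) m = 1" using dpow_one_unit by blast
  have "fls_nth (mps_coeff (miwa_monom \<iota> \<epsilon> m) M) k =
      u * (dpow (\<lambda>_. 1) m * fls_nth (mps_coeff (miwa_monom \<iota> \<epsilon> m) M) k)"
    by (simp add: u mult.assoc[symmetric])
  also have "\<dots> = 0"
    unfolding fls_nth_miwa_term using assms
    by (auto simp: monom_splits_def wt_add map_key_push_exp intro!: sum.neutral)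
  finally show ?thesis .
qed

lemma fls_nth_toda_subst:
  assumes "inj \<iota>"
  shows "fls_nth (mps_coeff (toda_subst \<iota> \<epsilon> f) M) k =
    (if k < 0 then 0 else \<Sum>m\<in>miwa_bound \<iota> M k. mps_coeff f m * fls_nth (mps_coeff (miwa_monom \<iota> \<epsilon> m) M) k)"
proof -
  let ?g = "\<lambda>M m. fls_const (mps_coeff f m) * mps_coeff (miwa_monom \<iota> \<epsilon> m) M"
  have "toda_subst \<iota> \<epsilon> f = Abs_mps (\<lambda>M. fps_to_fls (Abs_fps (\<lambda>n. \<Sum>m\<in>miwa_bound \<iota> M (int n). fls_nth (?g M m) (int n))))"
    unfolding toda_subst_def mps_subst_def
  proof (rule infsumI, unfold has_sum_mps_iff mps_coeff_Abs mps_coeff_const_mult, rule)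
    fix M
    show "(?g M has_sum fps_to_fls (Abs_fps (\<lambda>n. \<Sum>m\<in>miwa_bound \<iota> M (int n). fls_nth (?g M m) (int n)))) UNIV"
      using assms by (intro has_sum_flsI) (auto simp: fls_nth_miwa_monom_eq_0 finite_toda_wt)
  qed
  then show ?thesis by simp
qed

lemma toda_subst_add:
  assumes "inj \<iota>" shows "toda_subst \<iota> \<epsilon> (f + g) = toda_subst \<iota> \<epsilon> f + toda_subst \<iota> \<epsilon> g"
  by (intro mps_eqI fls_eqI) (simp add: fls_nth_toda_subst[OF assms] algebra_simps sum.distrib)

lemma toda_subst_const_mult:
  assumes "inj \<iota>" shows "toda_subst \<iota> \<epsilon> (mps_const c * f) = mps_const (fls_const c) * toda_subst \<iota> \<epsilon> f"
  by (intro mps_eqI fls_eqI)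
    (simp add: fls_nth_toda_subst[OF assms] mps_coeff_const_mult mult.assoc sum_distrib_left)

definition extend_coeff :: "('v \<Rightarrow> 'w) \<Rightarrow> ('v \<Rightarrow> 'a::zero) \<Rightarrow> 'w \<Rightarrow> 'a" where
  "extend_coeff \<iota> c w = (if w \<in> range \<iota> then c (inv \<iota> w) else 0)"

text \<open>The scalar series in w obtained from the exponential of the linear form e by putting
  w^(toda_wt v) for the variable v.\<close>

definition miwa_factor :: "(toda_var \<Rightarrow> complex fps) \<Rightarrow> complex fps fps" where
  "miwa_factor e = Abs_fps (\<lambda>k. \<Sum>b | wt toda_wt b = k. dpow e b)"

text \<open>The exponential of a sum factors: the renamed variables give an exponential again, the
  shifts a scalar series in w. So a Miwa shift acts on a single summand of the partition function by
  multiplication.\<close>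

lemma toda_subst_mexp:
  assumes "inj \<iota>"
  shows "toda_subst \<iota> \<epsilon> (mexp c) =
    mexp (\<lambda>w. fls_const (extend_coeff \<iota> c w)) * mps_const (fps_to_fls (miwa_factor (\<lambda>v. c v * \<epsilon> v)))"
proof (intro mps_eqI fls_eqI)
  fix M k
  let ?c = "extend_coeff \<iota> c"
  let ?u = "dpow (\<lambda>v. c v * \<epsilon> v)"
  have rhs: "fls_nth (mps_coeff (mexp (\<lambda>w. fls_const (?c w)) * mps_const (fps_to_fls (miwa_factor (\<lambda>v. c v * \<epsilon> v)))) M) k =
      dpow ?c M * (if k < 0 then 0 else \<Sum>b | wt toda_wt b = nat k. ?u b)"
    by (simp add: mult.commute[of _ "mps_const _"] mps_coeff_const_mult mexp_def dpow_fls_const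
        mult.commute[of _ "fls_const _"] miwa_factor_def)
  have fin: "finite (miwa_bound \<iota> M k)" by (rule finite_toda_wt)
  show "fls_nth (mps_coeff (toda_subst \<iota> \<epsilon> (mexp c)) M) k =
      fls_nth (mps_coeff (mexp (\<lambda>w. fls_const (?c w)) * mps_const (fps_to_fls (miwa_factor (\<lambda>v. c v * \<epsilon> v)))) M) k"
  proof (cases "k < 0")
    case True
    then show ?thesis unfolding rhs by (simp add: fls_nth_toda_subst[OF assms])
  next
    case False
    then have lhs: "fls_nth (mps_coeff (toda_subst \<iota> \<epsilon> (mexp c)) M) k =
        (\<Sum>m\<in>miwa_bound \<iota> M k. \<Sum>(a, b)\<in>monom_splits m. if M = push_exp \<iota> a \<and> k = int (wt toda_wt b)
        then dpow c a * ?u b else 0)"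
      by (simp only: fls_nth_toda_subst[OF assms] if_False mexp_def mps_coeff_Abs fls_nth_miwa_term)
    show ?thesis
    proof (cases "supp M \<subseteq> range \<iota>")
      case True
      then obtain a0 where M: "M = push_exp \<iota> a0" using push_exp_surj[OF assms] by blast
      \<comment> \<open>Once M fixes the first part as a0, the double sum over m and its splittings
        is a single sum over b.\<close>
      let ?i = "\<lambda>b. (a0 + b, a0, b)"
      have inj_iff: "push_exp \<iota> a = push_exp \<iota> b \<longleftrightarrow> a = b" for a b
        using push_exp_inj[OF assms] by blast
      have "fls_nth (mps_coeff (toda_subst \<iota> \<epsilon> (mexp c)) M) k =
          (\<Sum>(m, a, b)\<in>Sigma (miwa_bound \<iota> M k) monom_splits.
            if M = push_exp \<iota> a \<and> k = int (wt toda_wt b) then dpow c a * ?u b else 0)"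
        unfolding lhs by (rule sum.Sigma) (use fin in auto)
      also have "\<dots> = (\<Sum>(m, a, b)\<in>?i ` {b. wt toda_wt b = nat k}.
            if M = push_exp \<iota> a \<and> k = int (wt toda_wt b) then dpow c a * ?u b else 0)"
        using False
        by (intro sum.mono_neutral_right[OF finite_SigmaI[OF fin finite_monom_splits]])
          (auto simp: M inj_iff monom_splits_def wt_add map_key_push_exp[OF assms] split: if_splits)
      also have "\<dots> = (\<Sum>b | wt toda_wt b = nat k. dpow c a0 * ?u b)"
        using False by (subst sum.reindex) (auto simp: M inj_on_def intro!: sum.cong)
      also have "\<dots> = dpow c a0 * (\<Sum>b | wt toda_wt b = nat k. ?u b)"
        by (rule sum_distrib_left[symmetric])
      also have "dpow c a0 = dpow ?c M"
        using assms by (simp add: M dpow_push extend_coeff_def)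
      finally show ?thesis unfolding rhs using False by simp
    next
      case no: False
      then obtain w where w: "w \<in> supp M" "w \<notin> range \<iota>" by blast
      then have "M \<noteq> push_exp \<iota> a" for a using expo_push_exp_outside[of w \<iota> a] by (auto simp: in_keys_iff)
      moreover have "dpow ?c M = 0" using w by (intro dpow_eq_0) (auto simp: extend_coeff_def)
      ultimately show ?thesis unfolding rhs lhs by (simp add: case_prod_unfold)
    qed
  qed
qed

section \<open>Residues of rational functions\<close>

abbreviation cconst :: "complex \<Rightarrow> complex fps fls" where "cconst c \<equiv> fls_const (fps_const c)"

text \<open>
  Laurent polynomials in \<open>w\<close> without positive powers are handled as polynomials in \<open>z = w\<^sup>-\<^sup>1\<close>, so that the
  coefficient of \<open>w\<^sup>1\<close> is a residue at infinity in \<open>z\<close>.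
\<close>

definition eval_inv :: "complex poly \<Rightarrow> complex fps fls" where
  "eval_inv p = poly (map_poly cconst p) fls_X_inv"

lemma eval_inv_0 [simp]: "eval_inv 0 = 0"
  by (simp add: eval_inv_def)

lemma eval_inv_pCons: "eval_inv (pCons a p) = cconst a + fls_X_inv * eval_inv p"
  by (simp add: eval_inv_def map_poly_pCons)

lemma eval_inv_add: "eval_inv (p + q) = eval_inv p + eval_inv q"
proof (induction p q rule: poly_induct2)
  case (pCons a p b q)
  have "cconst (a + b) = cconst a + cconst b"
    by (intro fls_eqI fps_ext) simp
  then show ?case by (simp add: eval_inv_pCons pCons.IH algebra_simps)
qed simp

lemma eval_inv_smult: "eval_inv (smult c p) = cconst c * eval_inv p"
proof (induction p)
  case (pCons a p)
  have "cconst (c * a) = cconst c * cconst a"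
    by (simp only: fps_const_mult[symmetric] fls_const_mult_const)
  then show ?case by (simp add: eval_inv_pCons pCons.IH algebra_simps)
qed simp

lemma eval_inv_mult: "eval_inv (p * q) = eval_inv p * eval_inv q"
  by (induction p) (simp_all add: eval_inv_pCons eval_inv_add eval_inv_smult algebra_simps)

lemma eval_inv_1 [simp]: "eval_inv 1 = 1"
  by (simp add: eval_inv_pCons one_pCons)

lemma eval_inv_const: "eval_inv [:c:] = cconst c"
  by (simp add: eval_inv_pCons)

lemma eval_inv_power: "eval_inv (p ^ n) = eval_inv p ^ n"
  by (induction n) (simp_all add: eval_inv_mult)

lemma eval_inv_prod: "eval_inv (\<Prod>x\<in>A. f x) = (\<Prod>x\<in>A. eval_inv (f x))"
  by (induction A rule: infinite_finite_induct) (simp_all add: eval_inv_mult)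

lemma eval_inv_sum: "eval_inv (\<Sum>x\<in>A. f x) = (\<Sum>x\<in>A. eval_inv (f x))"
  by (induction A rule: infinite_finite_induct) (simp_all add: eval_inv_add)

lemma eval_inv_monom: "eval_inv (monom 1 n) = fls_X_inv ^ n"
  by (induction n) (simp_all add: monom_Suc eval_inv_pCons)

lemma fls_nth_eval_inv: "k > 0 \<Longrightarrow> fls_nth (eval_inv p) k = 0"
  by (induction p arbitrary: k) (simp_all add: eval_inv_pCons fls_X_inv_times_conv_shift)

lemma fps_geometric: "(1 - fps_const c * fps_X) * Abs_fps (\<lambda>i. c ^ i) = (1 :: 'a::comm_ring_1 fps)"
proof (rule fps_ext)
  fix n
  have *: "(1 - fps_const c * fps_X) * Abs_fps (\<lambda>i. c ^ i) =
      Abs_fps (\<lambda>i. c ^ i) - fps_const c * (fps_X * Abs_fps (\<lambda>i. c ^ i))"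
    by (simp only: left_diff_distrib mult_1 mult.assoc)
  show "fps_nth ((1 - fps_const c * fps_X) * Abs_fps (\<lambda>i. c ^ i)) n = fps_nth 1 n"
    unfolding * fps_sub_nth fps_mult_left_const_nth fps_X_mult_nth fps_nth_Abs_fps by (cases n) simp_all
qed

text \<open>The expansion w / (1 - b w) of 1 / (z - b) at infinity, where w = 1 / z.\<close>

definition geom_inv :: "complex \<Rightarrow> complex fps fls" where
  "geom_inv b = fps_to_fls (Abs_fps (\<lambda>i. fps_const b ^ i)) * fls_X"

lemma fls_X_inv_X: "fls_X_inv * fls_X = (1 :: 'a::comm_ring_1 fls)"
  by (simp add: fls_X_inv_times_conv_shift fls_X_conv_shift_1)

lemma eval_inv_linear: "eval_inv [:- b, 1:] = fls_X_inv - cconst b"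
proof -
  have "cconst (- b) = - cconst b" by (intro fls_eqI fps_ext) simp
  then show ?thesis by (simp add: eval_inv_pCons)
qed

lemma geom_inv: "geom_inv b * eval_inv [:- b, 1:] = 1"
proof -
  let ?c = "fps_const (fps_const b :: complex fps)"
  have "fls_X * eval_inv [:- b, 1:] = fls_X_inv * fls_X - cconst b * fls_X"
    unfolding eval_inv_linear by (simp only: right_diff_distrib mult.commute)
  also have "\<dots> = 1 - cconst b * fls_X" by (simp only: fls_X_inv_X)
  also have "\<dots> = fps_to_fls (1 - ?c * fps_X)"
    by (simp add: fls_times_fps_to_fls)
  finally have "geom_inv b * eval_inv [:- b, 1:] = fps_to_fls (Abs_fps (\<lambda>i. fps_const b ^ i) * (1 - ?c * fps_X))"
    by (simp add: geom_inv_def mult.assoc fls_times_fps_to_fls)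
  then show ?thesis by (simp only: mult.commute[of "Abs_fps _"] fps_geometric) simp
qed

lemma fls_nth_geom_inv: "fls_nth (geom_inv b) 1 = 1"
  by (simp add: geom_inv_def fls_X_times_conv_shift(2))

lemma prod_linear_factors_dvd:
  fixes p :: "'a::idom poly"
  assumes "finite B" "\<And>b. b \<in> B \<Longrightarrow> poly p b = 0"
  shows "(\<Prod>b\<in>B. [:- b, 1:]) dvd p"
  using assms
proof (induction B arbitrary: p rule: finite_induct)
  case (insert b B)
  then obtain q where q: "p = [:- b, 1:] * q"
    by (auto simp: poly_eq_0_iff_dvd dvd_def)
  have "poly q c = 0" if "c \<in> B" for c
  proof -
    have "c \<noteq> b" using that insert.hyps by auto
    moreover have "poly p c = 0" using insert.prems that by simp
    ultimately show ?thesis by (simp add: q)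
  qed
  then have "(\<Prod>b\<in>B. [:- b, 1:]) dvd q" by (rule insert.IH)
  then show ?case unfolding q prod.insert[OF insert.hyps] by (rule mult_dvd_mono[OF dvd_refl])
qed simp

text \<open>Partial fractions. Subtracting the Lagrange interpolation of P at B leaves a multiple of
  the denominator; the quotient Q is a polynomial in z and does not reach w^1, while each 1 / (z -
  b) contributes 1 there. The hypothesis has its denominator cleared, so \<rho> may be given as any
  Laurent series; cancelling the denominator identifies it with the partial fraction
  expansion.\<close>

lemma residue_sum:
  assumes B: "finite B" and \<rho>: "\<rho> * eval_inv (\<Prod>b\<in>B. [:- b, 1:]) = eval_inv P"
  shows "fls_nth \<rho> 1 = fps_const (\<Sum>b\<in>B. poly P b / (\<Prod>c\<in>B - {b}. b - c))"
proof -
  define r where "r b = poly P b / (\<Prod>c\<in>B - {b}. b - c)" for b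
  let ?\<Pi> = "\<lambda>B. \<Prod>b\<in>B. [:- b, 1::complex:]"
  let ?D = "P - (\<Sum>b\<in>B. smult (r b) (?\<Pi> (B - {b})))"
  have "poly ?D x = 0" if "x \<in> B" for x
  proof -
    \<comment> \<open>At x only the summand b = x survives, because all others contain the factor x
      - x.\<close>
    have "(\<Sum>b\<in>B. r b * (\<Prod>c\<in>B - {b}. x - c)) = (\<Sum>b\<in>{x}. r b * (\<Prod>c\<in>B - {b}. x - c))"
      using B that by (intro sum.mono_neutral_right) auto
    moreover have "(\<Prod>c\<in>B - {x}. x - c) \<noteq> 0" using B by auto
    ultimately show ?thesis by (simp add: poly_sum poly_prod r_def)
  qed
  then have "?\<Pi> B dvd ?D" by (rule prod_linear_factors_dvd[OF B])
  then obtain Q where Q: "?D = ?\<Pi> B * Q" by (auto simp: dvd_def)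
  define \<sigma> where "\<sigma> = eval_inv Q + (\<Sum>b\<in>B. cconst (r b) * geom_inv b)"
  have geom: "geom_inv b * eval_inv (?\<Pi> B) = eval_inv (?\<Pi> (B - {b}))" if "b \<in> B" for b
    by (simp only: prod.remove[OF B that] eval_inv_mult mult.assoc[symmetric] geom_inv mult_1)
  have P: "P = Q * ?\<Pi> B + (\<Sum>b\<in>B. smult (r b) (?\<Pi> (B - {b})))"
    using Q by (simp add: algebra_simps)
  have "eval_inv P = eval_inv Q * eval_inv (?\<Pi> B) + (\<Sum>b\<in>B. cconst (r b) * eval_inv (?\<Pi> (B - {b})))"
    by (subst P) (simp only: eval_inv_add eval_inv_mult eval_inv_sum eval_inv_smult)
  also have "\<dots> = \<sigma> * eval_inv (?\<Pi> B)"
    unfolding \<sigma>_def distrib_right sum_distrib_right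
    by (intro arg_cong2[where f = "(+)"] sum.cong refl) (simp add: geom mult.assoc)
  finally have "\<rho> * eval_inv (?\<Pi> B) = \<sigma> * eval_inv (?\<Pi> B)" using \<rho> by simp
  moreover have "eval_inv (?\<Pi> B) \<noteq> 0"
  proof -
    have "eval_inv [:- b, 1:] \<noteq> 0" for b using geom_inv[of b] by auto
    then show ?thesis using B by (simp add: eval_inv_prod)
  qed
  ultimately have "\<rho> = \<sigma>" by simp
  then have "fls_nth \<rho> 1 = (\<Sum>b\<in>B. fps_const (r b))"
    by (simp add: \<sigma>_def fls_nth_eval_inv fls_nth_sum fls_nth_geom_inv)
  also have "\<dots> = fps_const (\<Sum>b\<in>B. r b)"
    by (induction B rule: infinite_finite_induct) simp_all
  finally show ?thesis by (simp add: r_def)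
qed

section \<open>The scalar factor of a Miwa shift as a rational function\<close>

lemma fps_ode_unique:
  fixes f h :: "'a::{idom, ring_char_0} fps"
  assumes "fps_deriv f = g * f" "fps_deriv h = g * h" "fps_nth f 0 = fps_nth h 0"
  shows "f = h"
proof (rule fps_ext)
  fix n
  show "fps_nth f n = fps_nth h n"
  proof (induction n rule: less_induct)
    case (less n)
    show ?case
    proof (cases n)
      case (Suc k)
      \<comment> \<open>The equation expresses this coefficient through lower ones; characteristic
        zero allows \<open>of_nat (Suc k)\<close> to be cancelled at the end.\<close>
      have "of_nat (Suc k) * fps_nth f (Suc k) = (\<Sum>i=0..k. fps_nth g i * fps_nth f (k - i))"
        using assms(1) by (simp add: fps_eq_iff fps_mult_nth)
      also have "\<dots> = (\<Sum>i=0..k. fps_nth g i * fps_nth h (k - i))"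
        by (intro sum.cong refl) (simp add: less.IH Suc)
      also have "\<dots> = of_nat (Suc k) * fps_nth h (Suc k)"
        using assms(2) by (simp add: fps_eq_iff fps_mult_nth)
      finally show ?thesis using Suc by (simp del: of_nat_Suc)
    qed (use assms in simp)
  qed
qed

lemma wt_eq_0_iff: "wt toda_wt b = 0 \<longleftrightarrow> b = 0"
proof
  have pos: "toda_wt v \<noteq> 0" for v by (cases v) auto
  assume "wt toda_wt b = 0"
  then have "expo b v = 0" for v using pos by (cases "v \<in> supp b") (auto simp: wt_sum in_keys_iff)
  then show "b = 0" by (intro poly_mapping_eqI) simp
qed (simp add: wt_sum)

lemma miwa_factor_0: "fps_nth (miwa_factor e) 0 = 1"
  by (simp add: miwa_factor_def wt_eq_0_iff)

text \<open>The logarithmic derivative of the exponential of \<Sum> e_v w^(wt v);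
  \<open>Tm n\<close> and \<open>Tb n\<close> both have weight n + 1. In coefficients, the weight of
  b is distributed over its variables and \<open>dpow_rec\<close> removes one of them.\<close>

lemma miwa_factor_deriv:
  "fps_deriv (miwa_factor e) = Abs_fps (\<lambda>n. of_nat (Suc n) * (e (Tm n) + e (Tb n))) * miwa_factor e"
proof (rule fps_ext)
  fix n
  let ?W = "\<lambda>k. {b. wt toda_wt b = k}"
  let ?V = "Tm ` {..n} \<union> Tb ` {..n}"
  have fin: "finite (?W k)" for k by (rule finite_subset[OF _ finite_toda_wt[of k]]) auto
  have wt1: "wt toda_wt (unit_exp v) = toda_wt v" for v by (simp add: wt_sum)
  have wt_v: "wt toda_wt b = toda_wt v + wt toda_wt (b - unit_exp v)" if "v \<in> supp b" for v b
    using wt_add[of toda_wt "unit_exp v" "b - unit_exp v"] unit_exp_split[OF that] wt1 by simp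
  have "v \<in> {v. toda_wt v \<le> Suc n} \<longleftrightarrow> v \<in> ?V" for v by (cases v) auto
  then have V: "{v. toda_wt v \<le> Suc n} = ?V" by blast
  have "fps_nth (fps_deriv (miwa_factor e)) n = (\<Sum>b\<in>?W (Suc n). of_nat (wt toda_wt b) * dpow e b)"
    by (simp add: miwa_factor_def sum_distrib_left)
  also have "\<dots> = (\<Sum>b\<in>?W (Suc n). \<Sum>v\<in>supp b. of_nat (toda_wt v) * (e v * dpow e (b - unit_exp v)))"
  proof (intro sum.cong refl)
    fix b
    have "of_nat (wt toda_wt b) * dpow e b = (\<Sum>v\<in>supp b. of_nat (toda_wt v) * (of_nat (expo b v) * dpow e b))"
      by (simp only: wt_sum of_nat_sum of_nat_mult sum_distrib_right mult.assoc)
    then show "of_nat (wt toda_wt b) * dpow e b = (\<Sum>v\<in>supp b. of_nat (toda_wt v) * (e v * dpow e (b - unit_exp v)))"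
      by (simp add: dpow_rec)
  qed
  also have "\<dots> = (\<Sum>(b, v)\<in>Sigma (?W (Suc n)) supp. of_nat (toda_wt v) * (e v * dpow e (b - unit_exp v)))"
    using fin by (intro sum.Sigma) auto
  \<comment> \<open>A monomial of weight n + 1 with a marked variable is replaced by the marked
    variable and the remaining monomial; the inner sums become coefficients of the Miwa
    factor.\<close>
  also have "\<dots> = (\<Sum>(v, b)\<in>Sigma {v. toda_wt v \<le> Suc n} (\<lambda>v. ?W (Suc n - toda_wt v)). of_nat (toda_wt v) * (e v * dpow e b))"
    by (rule sum.reindex_bij_witness[where i = "\<lambda>(v, b). (unit_exp v + b, v)" and j = "\<lambda>(b, v). (v, b - unit_exp v)"])
      (auto simp: unit_exp_split wt_add wt1 wt_v in_keys_iff lookup_add)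
  also have "\<dots> = (\<Sum>v\<in>?V. \<Sum>b\<in>?W (Suc n - toda_wt v). of_nat (toda_wt v) * (e v * dpow e b))"
    unfolding V using fin by (intro sum.Sigma[symmetric]) auto
  also have "\<dots> = (\<Sum>v\<in>?V. of_nat (toda_wt v) * e v * fps_nth (miwa_factor e) (Suc n - toda_wt v))"
    by (simp add: miwa_factor_def sum_distrib_left mult.assoc)
  also have "\<dots> = (\<Sum>i\<le>n. of_nat (Suc i) * e (Tm i) * fps_nth (miwa_factor e) (n - i)) +
      (\<Sum>i\<le>n. of_nat (Suc i) * e (Tb i) * fps_nth (miwa_factor e) (n - i))"
    by (subst sum.union_disjoint) (auto simp: sum.reindex inj_on_def)
  also have "\<dots> = fps_nth (Abs_fps (\<lambda>n. of_nat (Suc n) * (e (Tm n) + e (Tb n))) * miwa_factor e) n"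
    by (simp only: fps_mult_nth fps_nth_Abs_fps atLeast0AtMost sum.distrib[symmetric] distrib_left distrib_right)
  finally show "fps_nth (fps_deriv (miwa_factor e)) n =
      fps_nth (Abs_fps (\<lambda>n. of_nat (Suc n) * (e (Tm n) + e (Tb n))) * miwa_factor e) n" .
qed

definition char_fps :: "complex set \<Rightarrow> complex fps fps" where
  "char_fps S = (\<Prod>x\<in>S. 1 - fps_const (fps_const x) * fps_X)"

definition power_sums :: "complex set \<Rightarrow> complex fps fps" where
  "power_sums S = Abs_fps (\<lambda>n. fps_const (\<Sum>x\<in>S. x ^ Suc n))"

text \<open>Newton's identities as a differential equation: each factor 1 - x w has logarithmic
  derivative -x / (1 - x w), a geometric series.\<close>

lemma char_fps_deriv:
  assumes "finite S"
  shows "fps_deriv (char_fps S) = - power_sums S * char_fps S"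
  using assms
proof (induction S rule: finite_induct)
  case empty
  have "power_sums {} = 0" by (rule fps_ext) (simp add: power_sums_def)
  then show ?case by (simp add: char_fps_def)
next
  case (insert x S)
  let ?c = "fps_const (fps_const x :: complex fps)" and ?f = "1 - fps_const (fps_const x :: complex fps) * fps_X"
  have ps: "power_sums (insert x S) = power_sums {x} + power_sums S"
    using insert.hyps by (intro fps_ext) (simp add: power_sums_def)
  have "power_sums {x} = ?c * Abs_fps (\<lambda>i. fps_const x ^ i)"
    by (rule fps_ext) (simp add: power_sums_def fps_const_power)
  then have "power_sums {x} * ?f = ?c * (?f * Abs_fps (\<lambda>i. fps_const x ^ i))"
    by (simp only: mult_ac)
  also have "\<dots> = ?c" by (simp only: fps_geometric mult_1_right)
  finally have "power_sums {x} * ?f = ?c" .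
  then have d: "fps_deriv ?f = - power_sums {x} * ?f" by simp
  have "char_fps (insert x S) = ?f * char_fps S" using insert.hyps by (simp add: char_fps_def)
  then show ?case by (simp only: ps fps_deriv_mult insert.IH d) (simp add: algebra_simps)
qed

lemma char_fps_0: "fps_nth (char_fps S) 0 = 1"
  unfolding char_fps_def by (induction S rule: infinite_finite_induct) simp_all

instance fps :: (ring_char_0) ring_char_0 ..

text \<open>Both sides solve the same first-order linear equation with the same constant term, so no
  logarithm of a power series has to be taken.\<close>

lemma miwa_char_fps:
  fixes f :: "complex fps fps"
  assumes "finite D" "finite E" "fps_nth f 0 = 1" "fps_deriv f = (power_sums E - power_sums D) * f"
  shows "f * char_fps E = char_fps D"
proof (rule fps_ode_unique)
  show "fps_deriv (f * char_fps E) = - power_sums D * (f * char_fps E)"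
    unfolding fps_deriv_mult char_fps_deriv[OF assms(2)] assms(4) by (simp add: algebra_simps)
  show "fps_deriv (char_fps D) = - power_sums D * char_fps D"
    using assms by (intro char_fps_deriv)
  show "fps_nth (f * char_fps E) 0 = fps_nth (char_fps D) 0"
    using assms by (simp add: char_fps_0)
qed

lemma eval_inv_char_fps:
  assumes "finite S"
  shows "eval_inv (\<Prod>x\<in>S. [:- x, 1:]) = fls_X_intpow (- int (card S)) * fps_to_fls (char_fps S)"
proof -
  have "eval_inv [:- x, 1:] = fls_X_inv * fps_to_fls (1 - fps_const (fps_const x) * fps_X)" for x
    using fls_X_inv_X[where ?'a = "complex fps"]
    by (simp add: eval_inv_linear fls_times_fps_to_fls right_diff_distrib mult.left_commute[of fls_X_inv])
  moreover have "fps_to_fls (char_fps S) = (\<Prod>x\<in>S. fps_to_fls (1 - fps_const (fps_const x) * fps_X))"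
    unfolding char_fps_def by (induction S rule: infinite_finite_induct) (simp_all add: fls_times_fps_to_fls)
  ultimately show ?thesis
    by (simp only: eval_inv_prod prod.distrib prod_constant fls_X_inv_power_conv_shift_1 minus_minus)
qed

text \<open>f is \<Prod>(1 - a w) / \<Prod>(1 - b w); the power of w in front supplies one factor z
  for each a and removes one for each b, leaving \<Prod>(z - a) / \<Prod>(z - b).\<close>

lemma residue_rational:
  fixes f :: "complex fps fps"
  assumes "finite D" "finite E" "fps_nth f 0 = 1" "fps_deriv f = (power_sums E - power_sums D) * f"
  shows "fls_nth (eval_inv p * (fls_X_intpow (int (card E) - int (card D)) * fps_to_fls f)) 1 =
    fps_const (\<Sum>b\<in>E. poly p b * (\<Prod>a\<in>D. b - a) / (\<Prod>c\<in>E - {b}. b - c))"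
proof -
  have "eval_inv p * (fls_X_intpow (int (card E) - int (card D)) * fps_to_fls f) * eval_inv (\<Prod>x\<in>E. [:- x, 1:]) =
      eval_inv p * ((fls_X_intpow (int (card E) - int (card D)) * fls_X_intpow (- int (card E))) * fps_to_fls (f * char_fps E))"
    by (simp only: eval_inv_char_fps[OF assms(2)] fls_times_fps_to_fls mult_ac)
  also have "\<dots> = eval_inv p * (fls_X_intpow (- int (card D)) * fps_to_fls (char_fps D))"
    by (simp only: miwa_char_fps[OF assms] fls_X_intpow_times_fls_X_intpow) simp
  also have "\<dots> = eval_inv (p * (\<Prod>x\<in>D. [:- x, 1:]))"
    by (simp only: eval_inv_mult eval_inv_char_fps[OF assms(1)])
  finally show ?thesis
    using residue_sum[OF assms(2)] by (simp add: poly_prod)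
qed

section \<open>Exponentials with coefficients polynomial in z\<close>

instance complex :: fact_inverse
  by standard simp

text \<open>For an exponent linear in the times with coefficients polynomial in z, this is the
  coefficient of m in its exponential: again a polynomial, to which \<open>residue_rational\<close>
  applies.\<close>

definition dpow_poly :: "('v \<Rightarrow> complex poly) \<Rightarrow> ('v \<Rightarrow>\<^sub>0 nat) \<Rightarrow> complex poly" where
  "dpow_poly P = mon_prod (\<lambda>v n. smult (inv_fact n) (P v ^ n))"

lemma poly_dpow_poly: "poly (dpow_poly P m) x = dpow (\<lambda>v. poly (P v) x) m"
  by (simp add: dpow_poly_def dpow_def mon_prod_def poly_prod)

lemma eval_inv_dpow_poly: "eval_inv (dpow_poly P m) = dpow (\<lambda>v. eval_inv (P v)) m"
proof -
  have "cconst (inv_fact n) = inv_fact n" for n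
    by (simp only: fls_of_nat fls_inverse_const fps_of_nat[symmetric] fps_const_inverse)
  then show ?thesis
    by (simp add: dpow_poly_def dpow_def mon_prod_def eval_inv_prod eval_inv_smult eval_inv_power)
qed

section \<open>The number of standard tableaux\<close>

definition vandermonde :: "int set \<Rightarrow> int" where
  "vandermonde F = (\<Prod>x\<in>F. \<Prod>y\<in>{y \<in> F. y < x}. x - y)"

text \<open>The new element is paired with all others, above or below it, whence the absolute
  values. They disappear later, in ratios and squares.\<close>

lemma vandermonde_insert:
  assumes "finite F" "x \<notin> F"
  shows "vandermonde (insert x F) = vandermonde F * (\<Prod>y\<in>F. \<bar>x - y\<bar>)"
proof -
  have 1: "{y \<in> insert x F. y < x} = {y \<in> F. y < x}" by auto
  have 2: "(\<Prod>y\<in>{y \<in> insert x F. y < z}. z - y) = (if x < z then z - x else 1) * (\<Prod>y\<in>{y \<in> F. y < z}. z - y)"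
    if "z \<in> F" for z
  proof -
    have "{y \<in> insert x F. y < z} = (if x < z then insert x {y \<in> F. y < z} else {y \<in> F. y < z})" by auto
    then show ?thesis using assms by simp
  qed
  have "vandermonde (insert x F) =
      (\<Prod>y\<in>{y \<in> F. y < x}. x - y) * (\<Prod>z\<in>F. (if x < z then z - x else 1) * (\<Prod>y\<in>{y \<in> F. y < z}. z - y))"
    unfolding vandermonde_def prod.insert[OF assms] 1 by (intro arg_cong2[where f = "(*)"] refl prod.cong 2)
  also have "\<dots> = vandermonde F * ((\<Prod>y\<in>{y \<in> F. y < x}. x - y) * (\<Prod>y\<in>F. if x < y then y - x else 1))"
    by (simp add: prod.distrib vandermonde_def)
  also have "(\<Prod>y\<in>{y \<in> F. y < x}. x - y) = (\<Prod>y\<in>F. if y < x then x - y else 1)"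
    using assms by (simp add: prod.inter_filter)
  also have "\<dots> * (\<Prod>y\<in>F. if x < y then y - x else 1) = (\<Prod>y\<in>F. \<bar>x - y\<bar>)"
    unfolding prod.distrib[symmetric] using assms by (intro prod.cong refl) auto
  finally show ?thesis .
qed

lemma vandermonde_nonzero: "finite F \<Longrightarrow> vandermonde F \<noteq> 0"
  by (simp add: vandermonde_def)

text \<open>Frobenius' product for dim \<lambda> / |\<lambda>|!, where L is the set of shifted
  parts; \<open>dim_formula\<close> proves it.\<close>

definition plancherel :: "int set \<Rightarrow> complex" where
  "plancherel L = of_int (vandermonde L) / (\<Prod>l\<in>L. fact (nat l))"

text \<open>
  Both sides are computed from the residue of \<open>z \<Prod>(z - 1 - y) / (z - y)\<close>: the left-hand side from the finite
  poles, the right-hand side from the expansion at infinity.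
\<close>

lemma sum_shift_ratio:
  fixes L :: "complex set"
  assumes L: "finite L"
  shows "(\<Sum>l\<in>L. l * (\<Prod>y\<in>L - {l}. (l - 1 - y) / (l - y))) = \<Sum>L - of_nat (card L) * (of_nat (card L) - 1) / 2"
proof -
  define G where "G y = fps_X * Abs_fps (\<lambda>i. fps_const y ^ i)" for y :: complex
  have geom: "geom_inv y = fps_to_fls (G y)" for y
    by (simp add: geom_inv_def G_def fls_times_fps_to_fls mult.commute)
  let ?P = "[:0, 1:] * (\<Prod>y\<in>L. [:- (1 + y), 1:])"
  let ?h = "\<lambda>L. \<Prod>y\<in>L. 1 - G y"
  \<comment> \<open>Each factor starts 1 - w - y w^2. Order 2 is required because the additional
    factor z moves the coefficient of w^2 to the residue position w^1.\<close>
  have h: "fps_nth (?h L) 0 = 1 \<and> fps_nth (?h L) 1 = - of_nat (card L) \<and>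
      fps_nth (?h L) 2 = fps_const (of_nat (card L) * (of_nat (card L) - 1) / 2 - \<Sum>L)"
    using L
  proof (induction L rule: finite_induct)
    case (insert y L)
    have G: "fps_nth (G y) 0 = 0" "fps_nth (G y) 1 = 1" "fps_nth (G y) 2 = fps_const y"
      by (simp_all add: G_def numeral_2_eq_2)
    have 2: "fps_nth (f * g) 2 = fps_nth f 0 * fps_nth g 2 + fps_nth f 1 * fps_nth g 1 + fps_nth f 2 * fps_nth g 0"
      for f g :: "complex fps fps" by (simp add: fps_mult_nth numeral_2_eq_2)
    have "of_nat n = fps_const (of_nat n :: complex)" for n by (simp add: fps_of_nat)
    then have c: "fps_const (of_nat n * (of_nat n - 1) / 2 - S) + of_nat n - fps_const y =
        fps_const ((1 + of_nat n) * of_nat n / 2 - (y + S) :: complex)" for n S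
      by (simp add: field_simps)
    show ?case
      using insert G c[of "card L" "\<Sum>L"] by (simp add: 2 fps_mult_nth_1 algebra_simps)
  qed simp
  define \<rho> where "\<rho> = fls_X_inv * fps_to_fls (?h L)"
  have "\<rho> * eval_inv (\<Prod>b\<in>L. [:- b, 1:]) = eval_inv ?P"
  proof -
    have "(1 - geom_inv y) * eval_inv [:- y, 1:] = eval_inv [:- (1 + y), 1:]" for y
    proof -
      have "[:- (1 + y), 1:] = [:- y, 1:] + [:- 1 :: complex:]" by simp
      then have "eval_inv [:- (1 + y), 1:] = eval_inv [:- y, 1:] + cconst (- 1)"
        by (simp only: eval_inv_add eval_inv_const)
      moreover have "cconst (- 1) = - 1" by (intro fls_eqI fps_ext) simp
      ultimately show ?thesis by (simp add: left_diff_distrib geom_inv)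
    qed
    moreover have "fps_to_fls (?h L) = (\<Prod>y\<in>L. 1 - geom_inv y)"
      by (induction L rule: infinite_finite_induct) (simp_all add: fls_times_fps_to_fls geom)
    moreover have "eval_inv [:0, 1:] = fls_X_inv" using eval_inv_linear[of 0] by simp
    ultimately show ?thesis
      by (simp only: \<rho>_def eval_inv_mult eval_inv_prod mult.assoc prod.distrib[symmetric])
  qed
  from residue_sum[OF L this] have "fls_nth \<rho> 1 = fps_const (\<Sum>b\<in>L. poly ?P b / (\<Prod>c\<in>L - {b}. b - c))" .
  moreover have "fls_nth \<rho> 1 = fps_nth (?h L) 2"
    by (simp add: \<rho>_def fls_X_inv_times_conv_shift)
  ultimately have "(\<Sum>b\<in>L. poly ?P b / (\<Prod>c\<in>L - {b}. b - c)) = of_nat (card L) * (of_nat (card L) - 1) / 2 - \<Sum>L"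
    using h by simp
  \<comment> \<open>At z = b the factor with y = b equals -1; this is the sign on the right.\<close>
  moreover have "poly ?P b / (\<Prod>c\<in>L - {b}. b - c) = - (b * (\<Prod>y\<in>L - {b}. (b - 1 - y) / (b - y)))" if "b \<in> L" for b
    using L that by (simp add: poly_prod prod.remove[of L b] prod_dividef algebra_simps)
  ultimately have "- (\<Sum>l\<in>L. l * (\<Prod>y\<in>L - {l}. (l - 1 - y) / (l - y))) = of_nat (card L) * (of_nat (card L) - 1) / 2 - \<Sum>L"
    by (simp add: sum_negf)
  then show ?thesis by (simp add: minus_equation_iff[of _ "_ - _"])
qed

text \<open>Only factors containing l change. Lowering l multiplies the reciprocal factorial by l,
  and l - 1 - y never has the sign opposite to l - y for an integer y other than l, so the absolute
  values cancel in the ratio.\<close>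

lemma plancherel_step:
  assumes L: "finite L" "L \<subseteq> {0..}" and l: "l \<in> L" "l \<ge> 1" "l - 1 \<notin> L"
  shows "plancherel (insert (l - 1) (L - {l})) =
    plancherel L * (of_int l * (\<Prod>y\<in>L - {l}. (of_int l - 1 - of_int y) / (of_int l - of_int y)))"
proof -
  let ?M = "L - {l}"
  define p where "p = (\<Prod>y\<in>?M. of_int (l - y) :: complex)"
  have M: "finite ?M" and notin: "l \<notin> ?M" using L by auto
  have ratio: "(of_int \<bar>l - 1 - y\<bar> :: complex) / of_int \<bar>l - y\<bar> = (of_int l - 1 - of_int y) / (of_int l - of_int y)"
    if "y \<in> ?M" for y
  proof (cases "y < l")
    case False
    then have "\<bar>l - 1 - y\<bar> = - (l - 1 - y)" "\<bar>l - y\<bar> = - (l - y)" using that by auto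
    then show ?thesis by (simp only: of_int_minus minus_divide_divide) simp
  qed simp
  have "plancherel (insert (l - 1) ?M) =
      of_int (vandermonde ?M) * (\<Prod>y\<in>?M. of_int \<bar>l - 1 - y\<bar>) / (fact (nat (l - 1)) * (\<Prod>l\<in>?M. fact (nat l)))"
    using M l by (simp add: plancherel_def vandermonde_insert)
  also have "(fact (nat (l - 1)) :: complex) = fact (nat l) / of_int l"
    using l fact_reduce[of "nat l", where ?'a = complex] by (simp add: nat_diff_distrib)
  also have "(\<Prod>y\<in>?M. of_int \<bar>l - 1 - y\<bar> :: complex) = (\<Prod>y\<in>?M. of_int \<bar>l - y\<bar>) *
      (\<Prod>y\<in>?M. (of_int l - 1 - of_int y) / (of_int l - of_int y))"
    unfolding prod.distrib[symmetric]
    by (intro prod.cong refl) (auto simp: ratio[symmetric])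
  also have "of_int (vandermonde ?M) * ((\<Prod>y\<in>?M. of_int \<bar>l - y\<bar>) *
      (\<Prod>y\<in>?M. (of_int l - 1 - of_int y) / (of_int l - of_int y))) / (fact (nat l) / of_int l * (\<Prod>l\<in>?M. fact (nat l))) =
      (of_int (vandermonde ?M) * (\<Prod>y\<in>?M. of_int \<bar>l - y\<bar>)) / (fact (nat l) * (\<Prod>l\<in>?M. fact (nat l))) *
      (of_int l * (\<Prod>y\<in>?M. (of_int l - 1 - of_int y) / (of_int l - of_int y :: complex)))"
    by simp
  also have "(of_int (vandermonde ?M) * (\<Prod>y\<in>?M. of_int \<bar>l - y\<bar>)) / (fact (nat l) * (\<Prod>l\<in>?M. fact (nat l))) =
      plancherel (insert l ?M)"
    unfolding plancherel_def vandermonde_insert[OF M notin] prod.insert[OF M notin] by simp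
  also have "insert l ?M = L" using l by auto
  finally show ?thesis .
qed

text \<open>In \<open>sum_shift_ratio\<close> the element l = 0 contributes 0, and so does every l
  with l - 1 in L, through the factor y = l - 1. What remains are the moves that correspond to
  removing a box.\<close>

lemma plancherel_recursion:
  assumes L: "finite L" "L \<subseteq> {0..}"
  shows "(\<Sum>l | l \<in> L \<and> l \<ge> 1 \<and> l - 1 \<notin> L. plancherel (insert (l - 1) (L - {l}))) =
    (of_int (\<Sum>L) - of_nat (card L) * (of_nat (card L) - 1) / 2) * plancherel L"
proof -
  let ?t = "\<lambda>l. of_int l * (\<Prod>y\<in>L - {l}. (of_int l - 1 - of_int y) / (of_int l - of_int y)) :: complex"
  have zero: "?t l = 0" if "l \<in> L" "\<not> (l \<ge> 1 \<and> l - 1 \<notin> L)" for l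
  proof (cases "l \<ge> 1")
    case True
    then have "l - 1 \<in> L - {l}" using that by auto
    then have "(\<Prod>y\<in>L - {l}. (of_int l - 1 - of_int y) / (of_int l - of_int y) :: complex) = 0"
      using L by (intro prod_zero) (auto intro!: bexI[of _ "l - 1"])
    then show ?thesis by simp
  next
    case False
    then show ?thesis using that L by (cases "l = 0") auto
  qed
  have "(\<Sum>l | l \<in> L \<and> l \<ge> 1 \<and> l - 1 \<notin> L. plancherel (insert (l - 1) (L - {l}))) =
      (\<Sum>l | l \<in> L \<and> l \<ge> 1 \<and> l - 1 \<notin> L. plancherel L * ?t l)"
    using L by (intro sum.cong refl plancherel_step) auto
  also have "\<dots> = (\<Sum>l\<in>L. plancherel L * ?t l)"
    using L zero by (intro sum.mono_neutral_left) auto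
  also have "\<dots> = plancherel L * (\<Sum>l\<in>of_int ` L. l * (\<Prod>y\<in>of_int ` L - {l}. (l - 1 - y) / (l - y)))"
  proof -
    have im: "of_int ` L - {of_int l :: complex} = of_int ` (L - {l})" for l by auto
    show ?thesis
      unfolding sum_distrib_left
      by (subst sum.reindex) (auto simp: inj_on_def im prod.reindex)
  qed
  also have "(\<Sum>l\<in>of_int ` L. l * (\<Prod>y\<in>of_int ` L - {l}. (l - 1 - y) / (l - y))) =
      of_int (\<Sum>L) - of_nat (card L) * (of_nat (card L) - 1) / (2::complex)"
    using L by (subst sum_shift_ratio) (auto simp: card_image inj_on_def sum.reindex)
  finally show ?thesis by (simp add: mult.commute)
qed

lemma plancherel_interval: "plancherel {0..<int N} = 1"
proof (induction N)
  case (Suc N)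
  have "{0..<int (Suc N)} = insert (int N) {0..<int N}" by auto
  moreover have "(\<Prod>y\<in>{0..<int N}. \<bar>int N - y\<bar>) = fact N"
  proof -
    have "(\<Prod>y\<in>{0..<int N}. \<bar>int N - y\<bar>) = (\<Prod>k\<in>{1..N}. int k)"
      by (rule prod.reindex_bij_witness[where i = "\<lambda>k. int (N - k)" and j = "\<lambda>y. nat (int N - y)"]) auto
    then show ?thesis by (simp add: fact_prod)
  qed
  ultimately show ?case using Suc by (simp add: plancherel_def vandermonde_insert)
qed (simp add: plancherel_def vandermonde_def)

section \<open>The branching rule for standard tableaux\<close>

lemma young_diagram_card:
  assumes "lam \<in> partitions"
  shows "finite (young_diagram lam)" "card (young_diagram lam) = partition_size lam"
proof -
  have fin: "finite {i. lam i \<noteq> 0}" using assms by (simp add: partitions_def)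
  have Y: "young_diagram lam = Sigma {i. lam i \<noteq> 0} (\<lambda>i. {..<lam i})"
    by (auto simp: young_diagram_def)
  show "finite (young_diagram lam)" unfolding Y using fin by simp
  show "card (young_diagram lam) = partition_size lam"
    unfolding Y using fin by (simp add: partition_size_def Sum_any.expand_set)
qed

lemma finite_standard_tableaux:
  assumes "lam \<in> partitions"
  shows "finite (standard_tableaux lam)"
proof (rule finite_subset)
  show "standard_tableaux lam \<subseteq> Pi\<^sub>E (young_diagram lam) (\<lambda>_. {1..partition_size lam})"
    by (auto simp: standard_tableaux_def PiE_def dest: bij_betwE)
  show "finite (Pi\<^sub>E (young_diagram lam) (\<lambda>_. {1..partition_size lam}))"
    using young_diagram_card[OF assms] by (intro finite_PiE) auto
qed

definition remove_box :: "nat \<Rightarrow> (nat \<Rightarrow> nat) \<Rightarrow> (nat \<Rightarrow> nat)" where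
  "remove_box i lam = lam(i := lam i - 1)"

lemma remove_box:
  assumes lam: "lam \<in> partitions" and i: "lam (Suc i) < lam i"
  shows "remove_box i lam \<in> partitions"
    and "young_diagram (remove_box i lam) = young_diagram lam - {(i, lam i - 1)}"
    and "partition_size lam = Suc (partition_size (remove_box i lam))"
proof -
  have mono: "antimono lam" and fin: "finite {i. lam i \<noteq> 0}" using lam by (auto simp: partitions_def)
  have "remove_box i lam b \<le> remove_box i lam a" if "a \<le> b" for a b
  proof (cases "a = i \<and> b \<noteq> i")
    case True
    then have "lam b \<le> lam (Suc i)" using that by (intro antimonoD[OF mono]) auto
    then show ?thesis using True i by (simp add: remove_box_def)
  next
    case False
    then show ?thesis using antimonoD[OF mono that] by (auto simp: remove_box_def)
  qed
  moreover have "finite {j. remove_box i lam j \<noteq> 0}"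
    by (rule finite_subset[OF _ fin]) (auto simp: remove_box_def)
  ultimately show part: "remove_box i lam \<in> partitions" by (simp add: partitions_def antimono_def)
  show Y: "young_diagram (remove_box i lam) = young_diagram lam - {(i, lam i - 1)}"
    by (auto simp: young_diagram_def remove_box_def split: if_splits)
  have "(i, lam i - 1) \<in> young_diagram lam" using i by (simp add: young_diagram_def)
  then show "partition_size lam = Suc (partition_size (remove_box i lam))"
    using young_diagram_card[OF lam] young_diagram_card[OF part] unfolding Y
    by (metis card_Suc_Diff1)
qed

text \<open>Deleting the corner and refilling it with the largest entry are inverse to each other.
  Nothing lies to the right of a corner or below it, so the refilled entry only has to exceed the
  others.\<close>

lemma standard_tableaux_corner:
  assumes lam: "lam \<in> partitions" and i: "lam (Suc i) < lam i"
  shows "card {t \<in> standard_tableaux lam. t (i, lam i - 1) = partition_size lam} = dim_partition (remove_box i lam)"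
proof -
  let ?c = "(i, lam i - 1)" and ?\<mu> = "remove_box i lam" and ?n = "partition_size lam"
  let ?Y = "young_diagram lam" and ?Y' = "young_diagram (remove_box i lam)"
  note \<mu> = remove_box[OF lam i]
  have c: "?c \<in> ?Y" using i by (simp add: young_diagram_def)
  then have Y: "?Y = insert ?c ?Y'" "?c \<notin> ?Y'" using \<mu>(2) by auto
  have mono: "antimono lam" "antimono ?\<mu>" using lam \<mu>(1) by (auto simp: partitions_def)
  have left: "(a, b) \<in> young_diagram m" if "(a, b') \<in> young_diagram m" "b < b'" for a b b' m
    using that by (simp add: young_diagram_def)
  have up: "(a, b) \<in> young_diagram m" if "(a', b) \<in> young_diagram m" "a < a'" "antimono m" for a a' b m
    using that antimonoD[of m a a'] by (simp add: young_diagram_def)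
  have "bij_betw (\<lambda>t. restrict t ?Y') {t \<in> standard_tableaux lam. t ?c = ?n} (standard_tableaux ?\<mu>)"
  proof (rule bij_betw_byWitness[where f' = "\<lambda>t. t(?c := ?n)"])
    show "\<forall>t\<in>{t \<in> standard_tableaux lam. t ?c = ?n}. (restrict t ?Y')(?c := ?n) = t"
      using Y by (auto simp: standard_tableaux_def extensional_def fun_eq_iff)
    show "\<forall>t\<in>standard_tableaux ?\<mu>. restrict (t(?c := ?n)) ?Y' = t"
      using Y by (auto simp: standard_tableaux_def extensional_def fun_eq_iff)
    show "(\<lambda>t. restrict t ?Y') ` {t \<in> standard_tableaux lam. t ?c = ?n} \<subseteq> standard_tableaux ?\<mu>"
    proof safe
      fix t assume t: "t \<in> standard_tableaux lam" "t ?c = ?n"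
      then have bij: "bij_betw t ?Y {1..?n}" by (simp add: standard_tableaux_def)
      have "bij_betw t (?Y - {?c}) ({1..?n} - {t ?c})"
        using bij c inj_on_image_set_diff[of t ?Y ?Y "{?c}"] by (auto simp: bij_betw_def inj_on_diff)
      moreover have "{1..?n} - {t ?c} = {1..partition_size ?\<mu>}" using t(2) \<mu>(3) by auto
      ultimately have "bij_betw t ?Y' {1..partition_size ?\<mu>}" using \<mu>(2) by simp
      then have "bij_betw (restrict t ?Y') ?Y' {1..partition_size ?\<mu>}" by (simp cong: bij_betw_cong)
      moreover have "restrict t ?Y' (a, b) < restrict t ?Y' (a, b')" if "b < b'" "(a, b') \<in> ?Y'" for a b b'
        using that left[OF that(2,1)] t(1) Y(1) by (auto simp: standard_tableaux_def)
      moreover have "restrict t ?Y' (a, b) < restrict t ?Y' (a', b)" if "a < a'" "(a', b) \<in> ?Y'" for a a' b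
        using that up[OF that(2,1) mono(2)] t(1) Y(1) by (auto simp: standard_tableaux_def)
      ultimately show "restrict t ?Y' \<in> standard_tableaux ?\<mu>"
        unfolding standard_tableaux_def by blast
    qed
    show "(\<lambda>t. t(?c := ?n)) ` standard_tableaux ?\<mu> \<subseteq> {t \<in> standard_tableaux lam. t ?c = ?n}"
    proof (intro image_subsetI CollectI conjI)
      fix t assume t: "t \<in> standard_tableaux ?\<mu>"
      let ?t = "t(?c := ?n)"
      have bij: "bij_betw t ?Y' {1..partition_size ?\<mu>}" using t by (simp add: standard_tableaux_def)
      then have less: "t x < ?n" if "x \<in> ?Y'" for x
        using bij_betwE[OF bij] that \<mu>(3) by fastforce
      have "bij_betw ?t ?Y' {1..partition_size ?\<mu>}"
        using bij Y(2) by (subst bij_betw_cong[of _ _ t]) auto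
      then have "bij_betw ?t (?Y' \<union> {?c}) ({1..partition_size ?\<mu>} \<union> {?t ?c})"
        using Y(2) \<mu>(3) by (intro notIn_Un_bij_betw) auto
      moreover have "{1..partition_size ?\<mu>} \<union> {?t ?c} = {1..?n}" using \<mu>(3) by auto
      ultimately have "bij_betw ?t ?Y {1..?n}" using Y(1) by simp
      moreover have "?t (a, b) < ?t (a, b')" if "b < b'" "(a, b') \<in> ?Y" for a b b'
      proof (cases "(a, b') = ?c")
        case True
        then have "(a, b) \<in> ?Y'" using left[OF that(2,1)] that Y by auto
        then show ?thesis using True that less by auto
      next
        case False
        then have 1: "(a, b') \<in> ?Y'" using that Y by auto
        then have 2: "(a, b) \<in> ?Y'" using left that(1) by blast
        have "t (a, b) < t (a, b')" using t 1 that(1) by (auto simp: standard_tableaux_def)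
        then show ?thesis using False 2 Y(2) by auto
      qed
      moreover have "?t (a, b) < ?t (a', b)" if "a < a'" "(a', b) \<in> ?Y" for a a' b
      proof (cases "(a', b) = ?c")
        case True
        then have "(a, b) \<in> ?Y'" using up[OF that(2,1) mono(1)] that Y by auto
        then show ?thesis using True that less by auto
      next
        case False
        then have 1: "(a', b) \<in> ?Y'" using that Y by auto
        then have 2: "(a, b) \<in> ?Y'" using up that(1) mono(2) by blast
        have "t (a, b) < t (a', b)" using t 1 that(1) by (auto simp: standard_tableaux_def)
        then show ?thesis using False 2 Y(2) by auto
      qed
      moreover have "?t \<in> extensional ?Y"
        using t Y by (auto simp: standard_tableaux_def extensional_def)
      ultimately show "?t \<in> standard_tableaux lam"
        unfolding standard_tableaux_def by blast
      show "?t ?c = ?n" by simp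
    qed
  qed
  then show ?thesis by (simp add: bij_betw_same_card dim_partition_def)
qed

text \<open>The box of the largest entry has no right or lower neighbour, whose entry would have to
  be larger still; so it is a corner, and the tableaux are classified by its row.\<close>

lemma dim_partition_branching:
  assumes lam: "lam \<in> partitions" and pos: "partition_size lam > 0"
  shows "dim_partition lam = (\<Sum>i | lam (Suc i) < lam i. dim_partition (remove_box i lam))"
proof -
  let ?n = "partition_size lam" and ?K = "{i. lam (Suc i) < lam i}"
  let ?A = "\<lambda>i. {t \<in> standard_tableaux lam. t (i, lam i - 1) = ?n}"
  have mono: "antimono lam" and fin: "finite {i. lam i \<noteq> 0}" using lam by (auto simp: partitions_def)
  have K: "finite ?K" by (rule finite_subset[OF _ fin]) auto
  have "standard_tableaux lam \<subseteq> (\<Union>i\<in>?K. ?A i)"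
  proof
    fix t assume t: "t \<in> standard_tableaux lam"
    then have bij: "bij_betw t (young_diagram lam) {1..?n}" by (simp add: standard_tableaux_def)
    then have "?n \<in> t ` young_diagram lam" using pos by (simp add: bij_betw_def)
    then obtain a b where ab: "(a, b) \<in> young_diagram lam" "t (a, b) = ?n" by auto
    have le: "t x \<le> ?n" if "x \<in> young_diagram lam" for x
      using bij_betwE[OF bij] that by auto
    have "(a, Suc b) \<notin> young_diagram lam"
    proof
      assume y: "(a, Suc b) \<in> young_diagram lam"
      have "t (a, b) < t (a, Suc b)" using t y lessI[of b] unfolding standard_tableaux_def by blast
      then show False using ab(2) le[OF y] by simp
    qed
    then have b: "b = lam a - 1" "lam a \<ge> 1" using ab(1) by (auto simp: young_diagram_def)
    have "(Suc a, b) \<notin> young_diagram lam"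
    proof
      assume y: "(Suc a, b) \<in> young_diagram lam"
      have "t (a, b) < t (Suc a, b)" using t y lessI[of a] unfolding standard_tableaux_def by blast
      then show False using ab(2) le[OF y] by simp
    qed
    then have "a \<in> ?K" using b by (auto simp: young_diagram_def)
    then show "t \<in> (\<Union>i\<in>?K. ?A i)" using t ab(2) b by auto
  qed
  then have "standard_tableaux lam = (\<Union>i\<in>?K. ?A i)" by auto
  then have "dim_partition lam = card (\<Union>i\<in>?K. ?A i)" by (simp add: dim_partition_def)
  also have "\<dots> = (\<Sum>i\<in>?K. card (?A i))"
  proof (rule card_UN_disjoint[OF K])
    show "\<forall>i\<in>?K. finite (?A i)" using finite_standard_tableaux[OF lam] by auto
    show "\<forall>i\<in>?K. \<forall>j\<in>?K. i \<noteq> j \<longrightarrow> ?A i \<inter> ?A j = {}"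
    proof (intro ballI impI)
      fix i j assume ij: "i \<in> ?K" "j \<in> ?K" "i \<noteq> j"
      then have "(i, lam i - 1) \<in> young_diagram lam" "(j, lam j - 1) \<in> young_diagram lam"
        by (auto simp: young_diagram_def)
      moreover have "inj_on t (young_diagram lam)" if "t \<in> ?A i" for t
        using that by (simp add: standard_tableaux_def bij_betw_def)
      ultimately show "?A i \<inter> ?A j = {}"
        using ij(3) by (smt (verit) disjoint_iff inj_onD mem_Collect_eq prod.inject)
    qed
  qed
  also have "\<dots> = (\<Sum>i\<in>?K. dim_partition (remove_box i lam))"
    by (intro sum.cong refl standard_tableaux_corner[OF lam]) simp
  finally show ?thesis .
qed

section \<open>Shifted parts and the dimension formula\<close>

definition beta_set :: "nat \<Rightarrow> (nat \<Rightarrow> nat) \<Rightarrow> int set" where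
  "beta_set N lam = (\<lambda>i. int (lam i) - int i + int N - 1) ` {..<N}"

lemma strict_beta:
  assumes "antimono lam" "i < j"
  shows "int (lam j) - int j < int (lam i) - int i"
  using antimonoD[OF assms(1), of i j] assms(2) by simp

lemma inj_beta:
  assumes "antimono lam"
  shows "inj (\<lambda>i. int (lam i) - int i + a)"
proof (rule injI)
  fix i j assume "int (lam i) - int i + a = int (lam j) - int j + a"
  then show "i = j" using strict_beta[OF assms, of i j] strict_beta[OF assms, of j i] by (cases i j rule: linorder_cases) auto
qed

lemma inj_beta': "antimono lam \<Longrightarrow> inj_on (\<lambda>i. int (lam i) - int i + int N - 1) A"
  using inj_beta[of lam "int N - 1"] by (simp add: inj_on_def inj_def algebra_simps)

lemma partition_size_sum:
  assumes "\<And>i. i \<ge> N \<Longrightarrow> lam i = 0"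
  shows "partition_size lam = (\<Sum>i<N. lam i)"
  unfolding partition_size_def by (rule Sum_any.expand_superset) (auto, metis assms less_irrefl leI)

text \<open>A removable box in row i is a shifted part that can be lowered by one to a free
  nonnegative place. The bound \<open>l i \<ge> 1\<close> decides the last of the N rows, below
  which no shifted part blocks the move.\<close>

lemma corner_iff:
  assumes lam: "lam \<in> partitions" and N: "\<And>i. i \<ge> N \<Longrightarrow> lam i = 0"
  defines "l \<equiv> \<lambda>i. int (lam i) - int i + int N - 1"
  shows "lam (Suc i) < lam i \<longleftrightarrow> i < N \<and> l i \<ge> 1 \<and> l i - 1 \<notin> beta_set N lam"
proof
  have mono: "antimono lam" using lam by (simp add: partitions_def)
  assume less: "lam (Suc i) < lam i"
  then have i: "i < N" using N[of i] by (cases "i < N") auto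
  moreover have "l i \<ge> 1" using less i by (simp add: l_def)
  moreover have "l i - 1 \<noteq> l j" for j
  proof
    assume eq: "l i - 1 = l j"
    then have "i < j"
      using strict_beta[OF mono, of j i] by (cases i j rule: linorder_cases) (auto simp: l_def)
    then have "lam j \<le> lam (Suc i)" by (intro antimonoD[OF mono]) simp
    then show False using eq less \<open>i < j\<close> by (simp add: l_def)
  qed
  ultimately show "i < N \<and> l i \<ge> 1 \<and> l i - 1 \<notin> beta_set N lam"
    by (auto simp: beta_set_def l_def)
next
  assume *: "i < N \<and> l i \<ge> 1 \<and> l i - 1 \<notin> beta_set N lam"
  have mono: "antimono lam" using lam by (simp add: partitions_def)
  show "lam (Suc i) < lam i"
  proof (rule ccontr)
    assume "\<not> lam (Suc i) < lam i"
    then have eq: "lam (Suc i) = lam i" using antimonoD[OF mono, of i "Suc i"] by simp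
    show False
    proof (cases "Suc i < N")
      case True
      then have "l i - 1 \<in> beta_set N lam"
        unfolding beta_set_def by (intro image_eqI[of _ _ "Suc i"]) (auto simp: l_def eq)
      then show False using * by simp
    next
      case False
      then have "lam (Suc i) = 0" by (intro N) simp
      then show False using * False eq by (simp add: l_def)
    qed
  qed
qed

lemma beta_set_remove_box:
  assumes lam: "lam \<in> partitions" and i: "lam (Suc i) < lam i" "i < N"
  defines "l \<equiv> \<lambda>i. int (lam i) - int i + int N - 1"
  shows "beta_set N (remove_box i lam) = insert (l i - 1) (beta_set N lam - {l i})"
proof -
  have mono: "antimono lam" using lam by (simp add: partitions_def)
  have "{..<N} = insert i ({..<N} - {i})" using i by auto
  then have "beta_set N (remove_box i lam) =
      insert (l i - 1) ((\<lambda>j. int (remove_box i lam j) - int j + int N - 1) ` ({..<N} - {i}))"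
    (is "_ = insert _ (?g ` _)")
  proof -
    have "beta_set N (remove_box i lam) = ?g ` insert i ({..<N} - {i})"
      unfolding beta_set_def using \<open>{..<N} = insert i ({..<N} - {i})\<close> by simp
    moreover have "?g i = l i - 1" using i(1) by (simp add: remove_box_def l_def of_nat_diff)
    ultimately show ?thesis by (simp only: image_insert)
  qed
  also have "(\<lambda>j. int (remove_box i lam j) - int j + int N - 1) ` ({..<N} - {i}) = l ` ({..<N} - {i})"
    by (intro image_cong refl) (simp add: remove_box_def l_def)
  also have "\<dots> = l ` {..<N} - {l i}"
    using inj_beta'[OF mono, of N UNIV] by (auto simp: l_def inj_on_def)
  finally show ?thesis by (simp add: beta_set_def l_def)
qed

text \<open>Both sides obey the same recursion on the number of boxes, the branching rule on the
  left and \<open>plancherel_recursion\<close> on the right. N stays fixed, since removing a box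
  creates no rows.\<close>

lemma dim_formula:
  assumes "lam \<in> partitions" "\<And>i. i \<ge> N \<Longrightarrow> lam i = 0"
  shows "of_nat (dim_partition lam) / fact (partition_size lam) = plancherel (beta_set N lam)"
  using assms
proof (induction "partition_size lam" arbitrary: lam)
  case 0
  then have z: "lam = (\<lambda>_. 0)"
    using partition_size_sum[of N lam] by (auto simp: fun_eq_iff) (metis lessThan_iff not_le)
  have "beta_set N lam = {0..<int N}"
    unfolding beta_set_def z
    by (auto simp: image_iff) (rule_tac x = "N - 1 - nat x" in bexI, auto)
  moreover have "young_diagram lam = {}" by (auto simp: young_diagram_def z)
  then have "standard_tableaux lam = {\<lambda>_. undefined}"
    using 0 by (auto simp: standard_tableaux_def bij_betw_def)
  ultimately show ?case using 0 by (simp add: plancherel_interval dim_partition_def)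
next
  case (Suc n)
  let ?L = "beta_set N lam" and ?l = "\<lambda>i. int (lam i) - int i + int N - 1"
  let ?K = "{i. lam (Suc i) < lam i}"
  have mono: "antimono lam" using Suc.prems by (simp add: partitions_def)
  have card: "card ?L = N" by (simp add: beta_set_def card_image inj_beta'[OF mono])
  have L: "finite ?L" "?L \<subseteq> {0..}" by (auto simp: beta_set_def)
  have "\<Sum>?L = int (partition_size lam) + (\<Sum>i<N. int N - 1 - int i)"
  proof -
    have "\<Sum>?L = (\<Sum>i<N. ?l i)"
      unfolding beta_set_def by (subst sum.reindex[OF inj_beta'[OF mono]]) (simp add: o_def)
    then show ?thesis
      by (simp add: partition_size_sum[OF Suc.prems(2)] sum.distrib[symmetric] algebra_simps)
  qed
  moreover have "(of_int (\<Sum>i<M. int M - 1 - int i) :: complex) = of_nat M * (of_nat M - 1) / 2" for M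
  proof (induction M)
    case (Suc M)
    have "(\<Sum>i<M. int (Suc M) - 1 - int i) = (\<Sum>i<M. int M - 1 - int i) + int M"
      by (simp add: sum.distrib sum_subtractf algebra_simps)
    then show ?case using Suc by (simp add: field_simps)
  qed simp
  \<comment> \<open>The shifted parts exceed the parts by 0, ..., N - 1, so the factor in
    \<open>plancherel_recursion\<close> is the number of boxes, which is the quotient of the two
    factorials.\<close>
  ultimately have sum: "of_int (\<Sum>?L) - of_nat (card ?L) * (of_nat (card ?L) - 1) / 2 = (of_nat (Suc n) :: complex)"
    using Suc.hyps(2) by (simp add: card)
  have "of_nat (dim_partition lam) / fact (partition_size lam) =
      (\<Sum>i\<in>?K. of_nat (dim_partition (remove_box i lam)) / fact (Suc n) :: complex)"
    using dim_partition_branching[OF Suc.prems(1)] Suc.hyps(2) by (simp add: sum_divide_distrib)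
  also have "\<dots> = (\<Sum>i\<in>?K. plancherel (insert (?l i - 1) (?L - {?l i})) / of_nat (Suc n))"
  proof (intro sum.cong refl)
    fix i assume i: "i \<in> ?K"
    then have "i < N" using Suc.prems(2)[of i] by (cases "i < N") auto
    note r = remove_box[OF Suc.prems(1), of i]
    have "of_nat (dim_partition (remove_box i lam)) / fact (partition_size (remove_box i lam)) =
        plancherel (beta_set N (remove_box i lam))"
      using i Suc.hyps(2) r Suc.prems(2) by (intro Suc.hyps(1)) (auto simp: remove_box_def)
    moreover have "partition_size (remove_box i lam) = n" using i r Suc.hyps(2) by simp
    ultimately show "of_nat (dim_partition (remove_box i lam)) / fact (Suc n) =
        plancherel (insert (?l i - 1) (?L - {?l i})) / of_nat (Suc n)"
      using i \<open>i < N\<close>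
      by (simp add: beta_set_remove_box[OF Suc.prems(1)] fact_Suc divide_divide_eq_left[symmetric] mult.commute[of _ "fact n"]
          del: of_nat_Suc divide_divide_eq_left)
  qed
  also have "\<dots> = (\<Sum>i\<in>?K. plancherel (insert (?l i - 1) (?L - {?l i}))) / of_nat (Suc n)"
    by (rule sum_divide_distrib[symmetric])
  also have "(\<Sum>i\<in>?K. plancherel (insert (?l i - 1) (?L - {?l i}))) =
      (\<Sum>l\<in>?l ` ?K. plancherel (insert (l - 1) (?L - {l})))"
    by (subst sum.reindex[OF inj_beta'[OF mono]]) simp
  also have "?l ` ?K = {l. l \<in> ?L \<and> l \<ge> 1 \<and> l - 1 \<notin> ?L}"
  proof -
    have "?K = {i. i < N \<and> ?l i \<ge> 1 \<and> ?l i - 1 \<notin> ?L}"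
      using corner_iff[OF Suc.prems(1,2)] by blast
    then show ?thesis by (auto simp: beta_set_def)
  qed
  also have "(\<Sum>l | l \<in> ?L \<and> l \<ge> 1 \<and> l - 1 \<notin> ?L. plancherel (insert (l - 1) (?L - {l}))) =
      of_nat (Suc n) * plancherel ?L"
    by (simp only: plancherel_recursion[OF L] sum)
  finally show ?case by (simp del: of_nat_Suc)
qed

section \<open>Maya diagrams\<close>

text \<open>\<open>lam i\<close> is the part with index i + 1, which absorbs the summand 1 in the
  mathematical formula. Keeping only the set makes the exchange of a bead an insertion and a
  removal, without renumbering of rows.\<close>

definition maya :: "int \<Rightarrow> (nat \<Rightarrow> nat) \<Rightarrow> int set" where
  "maya s lam = range (\<lambda>i. int (lam i) - int i + s)"

text \<open>The rows enumerate a diagram in strictly decreasing order, and such a sequence is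
  determined by its range: at the first disagreement the larger value would be missing from the
  other range.\<close>

lemma maya_inj:
  assumes "lam \<in> partitions" "mu \<in> partitions" "maya s lam = maya s mu"
  shows "lam = mu"
proof -
  define g where "g lam i = int (lam i) - int i + s" for lam i
  have maya_g: "maya s lam = range (g lam)" for lam by (auto simp: maya_def g_def)
  have dec: "g lam j < g lam i" if "lam \<in> partitions" "i < j" for lam i j
    using strict_beta[of lam i j] that by (simp add: partitions_def g_def)
  have step: "g lam i \<le> g mu i"
    if "lam \<in> partitions" "mu \<in> partitions" "range (g lam) = range (g mu)" "\<And>j. j < i \<Longrightarrow> g lam j = g mu j" for lam mu i
  proof (rule ccontr)
    assume less: "\<not> g lam i \<le> g mu i"
    have "g lam i \<in> range (g mu)" using that(3) by auto
    then obtain j where j: "g lam i = g mu j" by auto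
    have "j < i" using dec[OF that(2), of i j] less j by (cases i j rule: linorder_cases) auto
    then show False using that(4)[of j] dec[OF that(1), of j i] j by simp
  qed
  have "g lam i = g mu i" for i
  proof (induction i rule: less_induct)
    case (less i)
    show ?case
      using step[of lam mu i] step[of mu lam i] assms less by (intro antisym) (auto simp: maya_g)
  qed
  then show ?thesis by (auto simp: g_def)
qed

text \<open>
  Above \<open>- C\<close> the diagram has finitely many beads, one for each of the first \<open>C + s\<close> rows; all places
  up to \<open>- C\<close> are occupied. Diagrams of different charges are compared with a common \<open>C\<close>.
\<close>

definition cutoff :: "int \<Rightarrow> (nat \<Rightarrow> nat) \<Rightarrow> int \<Rightarrow> bool" where
  "cutoff s lam C \<longleftrightarrow> 0 \<le> C \<and> 0 \<le> C + s \<and> (\<forall>i. int i \<ge> C + s \<longrightarrow> lam i = 0)"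

lemma eventually_cutoff:
  assumes "lam \<in> partitions"
  shows "\<forall>\<^sub>F C in at_top. cutoff s lam C"
proof -
  have "finite {i. lam i \<noteq> 0}" using assms by (simp add: partitions_def)
  then obtain M where "\<And>i. lam i \<noteq> 0 \<Longrightarrow> i < M"
    by (metis (mono_tags, lifting) finite_nat_set_iff_bounded mem_Collect_eq)
  then have M: "\<And>i. i \<ge> M \<Longrightarrow> lam i = 0" by (meson not_le)
  have "cutoff s lam C" if "C \<ge> max (int M - s) (max 0 (- s))" for C
    using that M by (auto simp: cutoff_def)
  then show ?thesis by (rule eventually_mono[OF eventually_ge_at_top])
qed

definition beads :: "int \<Rightarrow> int set \<Rightarrow> int set" where
  "beads C A = A \<inter> {- C<..}"

text \<open>One recursion covers the three cases of the definition. The positive exponent matters at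
  s = 0, where the added power must vanish.\<close>

lemma c_4D_step: "c_4D (Suc k) s = c_4D (Suc k) (s - 1) + s ^ Suc k"
proof -
  consider "s > 1" | "s = 1" | "s = 0" | "s < 0" by linarith
  then show ?thesis
  proof cases
    case 1
    then have "{1..s} = insert s {1..s - 1}" by auto
    then show ?thesis using 1 by (simp add: c_4D_def)
  next
    case 4
    then have "{s..- 1} = insert s {s + 1..- 1}" by auto
    then show ?thesis using 4 by (simp add: c_4D_def)
  qed (simp_all add: c_4D_def)
qed

context
  fixes s C :: int and lam :: "nat \<Rightarrow> nat"
  assumes lam: "lam \<in> partitions" and cutoff: "cutoff s lam C"
begin

lemma maya_split:
  "beads C (maya s lam) = (\<lambda>i. int (lam i) - int i + s) ` {..<nat (C + s)}" (is "_ = ?g ` _")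
  "{..- C} \<subseteq> maya s lam"
proof -
  have small: "?g i > - C" if "i < nat (C + s)" for i using that by simp
  have large: "?g i = s - int i" if "i \<ge> nat (C + s)" for i
    using that cutoff by (simp add: cutoff_def)
  have "i < nat (C + s)" if "?g i > - C" for i
    using that large[of i] cutoff by (cases "i < nat (C + s)") (auto simp: cutoff_def)
  then show "beads C (maya s lam) = ?g ` {..<nat (C + s)}"
    using small by (auto simp: beads_def maya_def)
  show "{..- C} \<subseteq> maya s lam"
  proof
    fix x assume "x \<in> {..- C}"
    then have "nat (s - x) \<ge> nat (C + s)" "int (nat (s - x)) = s - x" using cutoff by (auto simp: cutoff_def)
    then show "x \<in> maya s lam"
      using large[of "nat (s - x)"] unfolding maya_def by (intro image_eqI[of _ _ "nat (s - x)"]) auto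
  qed
qed

lemma finite_beads: "finite (beads C (maya s lam))"
  by (simp add: maya_split)

text \<open>The charge counts beads relative to the C places of the vacuum of charge 0; this is what
  makes the prefactor z^(s'-s) match the degree of the rational function.\<close>

lemma card_beads: "int (card (beads C (maya s lam))) = C + s"
proof -
  have "inj_on (\<lambda>i. int (lam i) - int i + s) {..<nat (C + s)}"
    using lam inj_beta[of lam s] by (auto simp: partitions_def intro: inj_on_subset)
  then show ?thesis using cutoff by (simp add: maya_split card_image cutoff_def)
qed

text \<open>With N = C + s rows the shifted part of a row is its bead plus C - 1. This translation
  does not involve the charge, so diagrams of different charges can be compared bead by
  bead.\<close>

lemma dim_beads:
  "of_nat (dim_partition lam) / fact (partition_size lam) = plancherel ((\<lambda>x. x + C - 1) ` beads C (maya s lam))"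
proof -
  have "beta_set (nat (C + s)) lam = (\<lambda>x. x + C - 1) ` beads C (maya s lam)"
    unfolding maya_split beta_set_def image_image using cutoff by (intro image_cong refl) (simp add: cutoff_def)
  moreover have "lam i = 0" if "i \<ge> nat (C + s)" for i using that cutoff by (simp add: cutoff_def)
  ultimately show ?thesis using dim_formula[OF lam, of "nat (C + s)"] by simp
qed

text \<open>c_k(s) makes the subtracted power sum independent of the charge: by
  \<open>c_4D_step\<close> the sum over the vacuum places in (-C, s] minus c_k(s) does not change
  with s and may be evaluated at s = 0.\<close>

lemma phi_4D_beads:
  "phi_4D (Suc k) s lam = (\<Sum>x\<in>beads C (maya s lam). x ^ Suc k) - (\<Sum>x\<in>{- C<..0}. x ^ Suc k)"
proof -
  let ?N = "nat (C + s)" and ?g = "\<lambda>i. int (lam i) - int i + s"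
  define T where "T t = (\<Sum>x\<in>{- C<..t}. x ^ Suc k)" for t
  have C: "0 \<le> C" "0 \<le> C + s" using cutoff by (auto simp: cutoff_def)
  have T: "T t - c_4D (Suc k) t = T (- C) - c_4D (Suc k) (- C)" if "t \<ge> - C" for t
    using that
  proof (induction t rule: int_ge_induct)
    case (step t)
    then have "{- C<..t + 1} = insert (t + 1) {- C<..t}" by auto
    then have "T (t + 1) = (t + 1) ^ Suc k + T t" by (simp add: T_def)
    then show ?case using step.IH c_4D_step[of k "t + 1"] by simp
  qed simp
  have "Sum_any (\<lambda>i. (int (lam i) - int i + s) ^ Suc k - (- int i + s) ^ Suc k) =
      (\<Sum>i<?N. ?g i ^ Suc k - (- int i + s) ^ Suc k)"
  proof (rule Sum_any.expand_superset)
    show "{i. ?g i ^ Suc k - (- int i + s) ^ Suc k \<noteq> 0} \<subseteq> {..<?N}"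
    proof safe
      fix i assume "?g i ^ Suc k - (- int i + s) ^ Suc k \<noteq> 0"
      then have "?g i \<noteq> - int i + s" by (metis diff_self)
      then have "lam i \<noteq> 0" by auto
      then show "i < ?N" using cutoff unfolding cutoff_def by (meson leI lessThan_iff zless_nat_eq_int_zless not_le)
    qed
  qed simp
  also have "\<dots> = (\<Sum>i<?N. ?g i ^ Suc k) - (\<Sum>i<?N. (- int i + s) ^ Suc k)"
    by (rule sum_subtractf)
  also have "(\<Sum>i<?N. ?g i ^ Suc k) = (\<Sum>x\<in>beads C (maya s lam). x ^ Suc k)"
  proof -
    have "inj_on ?g {..<?N}" using lam inj_beta[of lam s] by (auto simp: partitions_def intro: inj_on_subset)
    then show ?thesis by (simp add: maya_split sum.reindex)
  qed
  also have "(\<Sum>i<?N. (- int i + s) ^ Suc k) = T s"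
    unfolding T_def
    by (rule sum.reindex_bij_witness[where i = "\<lambda>x. nat (s - x)" and j = "\<lambda>i. s - int i"]) (use C in auto)
  finally have "phi_4D (Suc k) s lam = (\<Sum>x\<in>beads C (maya s lam). x ^ Suc k) - (T s - c_4D (Suc k) s)"
    by (simp add: phi_4D_def)
  also have "T s - c_4D (Suc k) s = T 0 - c_4D (Suc k) 0" using T[of s] T[of 0] C by simp
  also have "\<dots> = (\<Sum>x\<in>{- C<..0}. x ^ Suc k)" by (simp add: T_def c_4D_def)
  finally show ?thesis .
qed

end

text \<open>The beads above -C, in decreasing order, are the first n rows; their number fixes the
  charge, and the remaining rows, of length 0, fill the places up to -C.\<close>

lemma maya_surj:
  assumes A: "{..- C} \<subseteq> A" and fin: "finite (beads C A)" and card: "int (card (beads C A)) = C + s"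
  shows "\<exists>lam\<in>partitions. maya s lam = A"
proof -
  define F where "F = beads C A"
  define xs where "xs = sorted_list_of_set F"
  define n where "n = card F"
  have F: "finite F" using fin by (simp add: F_def)
  have xs: "sorted_wrt (<) xs" "set xs = F" "length xs = n"
    using F by (simp_all add: xs_def n_def)
  have less: "xs ! i < xs ! j" if "i < j" "j < n" for i j
    using that xs by (simp add: sorted_wrt_iff_nth_less)
  \<comment> \<open>The beads are distinct integers above -C. With n = C + s this bound says that
    the row lengths are nonnegative, so \<open>nat\<close> in the definition of \<open>lam\<close>
    loses nothing.\<close>
  have lower: "xs ! k \<ge> - C + 1 + int k" if "k < n" for k
    using that
  proof (induction k)
    case 0
    then have "xs ! 0 \<in> F" using xs by auto
    then show ?case by (simp add: F_def beads_def)
  next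
    case (Suc k)
    then show ?case using less[of k "Suc k"] by simp
  qed
  have n: "int n = C + s" using card by (simp add: n_def F_def)
  define y where "y i = xs ! (n - 1 - i)" for i
  define lam where "lam i = (if i < n then nat (y i + int i - s) else 0)" for i
  have y_less: "y (Suc i) < y i" if "Suc i < n" for i
    unfolding y_def using that by (intro less) auto
  have lam_y: "int (lam i) = y i + int i - s" if "i < n" for i
  proof -
    have "n - 1 - i < n" "int (n - 1 - i) = int n - 1 - int i" using that by auto
    then have "y i \<ge> - C + 1 + (int n - 1 - int i)" unfolding y_def using lower by metis
    then show ?thesis using that n by (simp add: lam_def)
  qed
  have "lam (Suc i) \<le> lam i" for i
  proof (cases "Suc i < n")
    case True
    then show ?thesis using y_less[OF True] lam_y[of i] lam_y[of "Suc i"] by simp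
  qed (simp add: lam_def)
  then have "antimono lam" by (simp add: antimono_iff_le_Suc)
  moreover have "finite {i. lam i \<noteq> 0}"
    by (rule finite_subset[of _ "{..<n}"]) (auto simp: lam_def split: if_splits)
  ultimately have "lam \<in> partitions" by (simp add: partitions_def)
  moreover have "maya s lam = A"
  proof -
    have "maya s lam = (\<lambda>i. int (lam i) - int i + s) ` {..<n} \<union> (\<lambda>i. int (lam i) - int i + s) ` {n..}"
    proof -
      have "{..<n} \<union> {n..} = UNIV" by auto
      then show ?thesis unfolding maya_def image_Un[symmetric] by simp
    qed
    also have "(\<lambda>i. int (lam i) - int i + s) ` {..<n} = y ` {..<n}"
      by (intro image_cong refl) (simp add: lam_y)
    also have "y ` {..<n} = F"
    proof -
      have "(\<lambda>i. n - 1 - i) ` {..<n} = {..<n}"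
        by (auto simp: image_iff) (rule_tac x = "n - 1 - x" in bexI, auto)
      then have "y ` {..<n} = (!) xs ` {..<n}" unfolding y_def by (metis image_image)
      also have "\<dots> = set xs" by (auto simp: set_conv_nth xs)
      finally show ?thesis using xs by simp
    qed
    also have "(\<lambda>i. int (lam i) - int i + s) ` {n..} = (\<lambda>i. s - int i) ` {n..}"
      by (intro image_cong refl) (simp add: lam_def)
    also have "(\<lambda>i. s - int i) ` {n..} = {..- C}"
    proof (intro equalityI subsetI)
      fix x assume "x \<in> {..- C}"
      then show "x \<in> (\<lambda>i. s - int i) ` {n..}"
        using n by (intro image_eqI[of _ _ "nat (s - x)"]) auto
    qed (use n in auto)
    also have "F \<union> {..- C} = A" using A by (auto simp: F_def beads_def)
    finally show ?thesis .
  qed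
  ultimately show ?thesis by blast
qed

section \<open>Comparing two diagrams; inserting and removing a bead\<close>

lemma cutoff_pair:
  assumes "lam \<in> partitions" "mu \<in> partitions"
  obtains C where "cutoff s lam C" "cutoff t mu C"
proof -
  have "\<forall>\<^sub>F C in at_top. cutoff s lam C \<and> cutoff t mu C"
    using assms by (intro eventually_conj eventually_cutoff)
  then show ?thesis using that by (auto simp: eventually_at_top_linorder)
qed

lemma beads_diff:
  assumes "{..- C} \<subseteq> B"
  shows "A - B = beads C A - beads C B"
  using assms by (auto simp: beads_def not_less)

text \<open>Below a common cutoff both diagrams are full, so the infinite parts cancel in the
  differences, and so does the vacuum sum of \<open>phi_4D_beads\<close>. Regularised power sums
  thereby become ordinary ones over finite sets.\<close>

lemma maya_diff:
  assumes "lam \<in> partitions" "mu \<in> partitions"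
  shows "finite (maya s lam - maya t mu)"
    and "int (card (maya s lam - maya t mu)) - int (card (maya t mu - maya s lam)) = s - t"
    and "phi_4D (Suc k) s lam - phi_4D (Suc k) t mu =
      (\<Sum>x\<in>maya s lam - maya t mu. x ^ Suc k) - (\<Sum>x\<in>maya t mu - maya s lam. x ^ Suc k)"
proof -
  obtain C where C: "cutoff s lam C" "cutoff t mu C" using cutoff_pair[OF assms] .
  let ?F = "beads C (maya s lam)" and ?G = "beads C (maya t mu)"
  have FG: "maya s lam - maya t mu = ?F - ?G" "maya t mu - maya s lam = ?G - ?F"
    using maya_split(2)[OF assms(1) C(1)] maya_split(2)[OF assms(2) C(2)] by (auto intro!: beads_diff)
  have fin: "finite ?F" "finite ?G" using finite_beads assms C by auto
  show "finite (maya s lam - maya t mu)" unfolding FG using fin by simp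
  have sums: "sum f ?F - sum f ?G = sum f (?F - ?G) - sum f (?G - ?F)" for f :: "int \<Rightarrow> int"
    using sum.Int_Diff[OF fin(1), of f ?G] sum.Int_Diff[OF fin(2), of f ?F] by (simp add: Int_commute)
  show "int (card (maya s lam - maya t mu)) - int (card (maya t mu - maya s lam)) = s - t"
    using sums[of "\<lambda>_. 1"] card_beads[OF assms(1) C(1)] card_beads[OF assms(2) C(2)] by (simp add: FG)
  show "phi_4D (Suc k) s lam - phi_4D (Suc k) t mu =
      (\<Sum>x\<in>maya s lam - maya t mu. x ^ Suc k) - (\<Sum>x\<in>maya t mu - maya s lam. x ^ Suc k)"
    using sums[of "\<lambda>x. x ^ Suc k"] phi_4D_beads[OF assms(1) C(1)] phi_4D_beads[OF assms(2) C(2)] by (simp add: FG)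
qed

lemma maya_insert:
  assumes "lam \<in> partitions" "x \<notin> maya s lam"
  shows "\<exists>mu\<in>partitions. maya (s + 1) mu = insert x (maya s lam)"
proof -
  obtain C where C: "cutoff s lam C" using cutoff_pair[OF assms(1,1)] .
  note m = maya_split(2)[OF assms(1) C] finite_beads[OF assms(1) C] card_beads[OF assms(1) C]
  have "x > - C" using assms(2) m(1) by (auto simp: not_le[symmetric])
  then have b: "beads C (insert x (maya s lam)) = insert x (beads C (maya s lam))" by (auto simp: beads_def)
  have "x \<notin> beads C (maya s lam)" using assms(2) by (simp add: beads_def)
  then show ?thesis using m by (intro maya_surj[of C]) (auto simp: b)
qed

lemma maya_remove:
  assumes "lam \<in> partitions" "x \<in> maya s lam"
  shows "\<exists>mu\<in>partitions. maya (s - 1) mu = maya s lam - {x}"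
proof -
  \<comment> \<open>The place -C also has to lie below x, so that removing x leaves the full part of
    the diagram intact.\<close>
  have "\<forall>\<^sub>F C in at_top. cutoff s lam C \<and> - x < C"
    using assms by (intro eventually_conj eventually_cutoff eventually_gt_at_top)
  then obtain C where C: "cutoff s lam C" "- x < C" by (auto simp: eventually_at_top_linorder)
  note m = maya_split(2)[OF assms(1) C(1)] finite_beads[OF assms(1) C(1)] card_beads[OF assms(1) C(1)]
  have b: "beads C (maya s lam - {x}) = beads C (maya s lam) - {x}" by (auto simp: beads_def)
  have "x \<in> beads C (maya s lam)" using assms(2) C by (simp add: beads_def)
  from card_Suc_Diff1[OF m(2) this] have "int (card (beads C (maya s lam) - {x})) = C + (s - 1)"
    using m(3) by linarith
  then show ?thesis using m C by (intro maya_surj[of C]) (auto simp: b)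
qed

text \<open>c_1(s) = s(s+1)/2, so the exponent of \<Lambda>^2 is the first potential. Its
  conservation under an exchange is therefore the case k = 1 of the power sum computation.\<close>

lemma energy_eq_phi:
  assumes "lam \<in> partitions"
  shows "int (partition_size lam + nat (s * (s + 1) div 2)) = phi_4D (Suc 0) s lam"
proof -
  have c: "2 * c_4D (Suc 0) s = s * (s + 1)" for s
  proof (induction s rule: int_induct[where k = 0])
    case (step1 i)
    then show ?case using c_4D_step[of 0 "i + 1"] by (simp add: algebra_simps)
  next
    case (step2 i)
    then show ?case using c_4D_step[of 0 i] by (simp add: algebra_simps)
  qed (simp add: c_4D_def)
  have "0 \<le> s * (s + 1)" by (cases "s \<ge> 0") (auto simp: zero_le_mult_iff)
  then have "int (nat (s * (s + 1) div 2)) = c_4D (Suc 0) s" unfolding c[symmetric] by simp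
  moreover have "Sum_any (\<lambda>i. (int (lam i) - int i + s) - (- int i + s)) = int (partition_size lam)"
  proof -
    have "finite {i. lam i \<noteq> 0}" using assms by (simp add: partitions_def)
    then show ?thesis unfolding partition_size_def by (simp add: Sum_any.expand_set)
  qed
  ultimately show ?thesis by (simp add: phi_4D_def)
qed

section \<open>Weights under the exchange of a bead\<close>

definition plancherel_weight :: "(nat \<Rightarrow> nat) \<Rightarrow> complex" where
  "plancherel_weight lam = (of_nat (dim_partition lam) / fact (partition_size lam))\<^sup>2"

lemma plancherel_insert:
  assumes "finite M" "z \<notin> M"
  shows "(plancherel (insert z M))\<^sup>2 = (plancherel M)\<^sup>2 * (\<Prod>y\<in>M. (of_int (z - y))\<^sup>2) / (fact (nat z))\<^sup>2"
proof -
  have "(of_int \<bar>a\<bar>)\<^sup>2 = (of_int a :: complex)\<^sup>2" for a by (cases "a \<ge> 0") auto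
  then show ?thesis
    using assms by (simp add: plancherel_def vandermonde_insert power_mult_distrib power_divide prod_power_distrib
        del: of_int_abs)
qed

lemma plancherel_nonzero: "finite L \<Longrightarrow> plancherel L \<noteq> 0"
  by (simp add: plancherel_def vandermonde_nonzero)

text \<open>With F the beads of A and G those of B without x, the four diagrams have beads F, G with
  x, F with x, and G. The factorial belonging to x appears once on each side and cancels; what
  remains compares the products of x - y over F and over G.\<close>

lemma plancherel_weight_exchange:
  assumes part: "lam \<in> partitions" "mu \<in> partitions" "lam' \<in> partitions" "mu' \<in> partitions"
    and x: "x \<in> maya s mu" "x \<notin> maya s' lam"
    and lam': "maya (s' + 1) lam' = insert x (maya s' lam)" and mu': "maya (s - 1) mu' = maya s mu - {x}"
  shows "plancherel_weight lam * plancherel_weight mu * (\<Prod>a\<in>maya s' lam - maya s mu. (of_int (x - a))\<^sup>2) =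
    plancherel_weight lam' * plancherel_weight mu' * (\<Prod>b\<in>maya s mu - maya s' lam - {x}. (of_int (x - b))\<^sup>2)"
proof -
  have "\<forall>\<^sub>F C in at_top. cutoff s' lam C \<and> cutoff s mu C \<and> cutoff (s' + 1) lam' C \<and> cutoff (s - 1) mu' C"
    using part by (intro eventually_conj eventually_cutoff)
  then obtain C where C: "cutoff s' lam C" "cutoff s mu C" "cutoff (s' + 1) lam' C" "cutoff (s - 1) mu' C"
    by (auto simp: eventually_at_top_linorder)
  let ?A = "maya s' lam" and ?B = "maya s mu"
  define F G where "F = beads C ?A" and "G = beads C ?B - {x}"
  let ?\<tau> = "\<lambda>x. x + C - 1"
  let ?Q = "\<lambda>M. \<Prod>y\<in>M. (of_int (x - y))\<^sup>2 :: complex"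
  have xC: "x > - C" using maya_split(2)[OF part(1) C(1)] x by (auto simp: not_le[symmetric])
  have FG: "finite F" "finite G" "x \<notin> F" "x \<notin> G"
    using finite_beads part C x by (auto simp: beads_def F_def G_def)
  have beads: "beads C (maya (s' + 1) lam') = insert x F" "beads C (maya (s - 1) mu') = G" "beads C ?B = insert x G"
    using lam' mu' xC x by (auto simp: beads_def F_def G_def)
  have pw: "plancherel_weight l = (plancherel (?\<tau> ` beads C (maya t l)))\<^sup>2" if "l \<in> partitions" "cutoff t l C" for l t
    using dim_beads[OF that] by (simp add: plancherel_weight_def)
  have ins: "(plancherel (?\<tau> ` insert x M))\<^sup>2 = (plancherel (?\<tau> ` M))\<^sup>2 * ?Q M / (fact (nat (?\<tau> x)))\<^sup>2"
    if "finite M" "x \<notin> M" for M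
    using that by (simp add: plancherel_insert image_iff prod.reindex inj_on_def)
  have AB: "?A - ?B = F - G" "?B - ?A - {x} = G - F"
    using maya_split(2)[OF part(1) C(1)] maya_split(2)[OF part(2) C(2)] x by (auto simp: beads_def not_less F_def G_def)
  \<comment> \<open>Both products equal the product over the union of F and G.\<close>
  have "?Q G * ?Q (F - G) = ?Q (G \<union> (F - G))"
    using FG by (intro prod.union_disjoint[symmetric]) auto
  also have "G \<union> (F - G) = F \<union> (G - F)" by auto
  also have "?Q (F \<union> (G - F)) = ?Q F * ?Q (G - F)"
    using FG by (intro prod.union_disjoint) auto
  finally have Q: "?Q G * ?Q (F - G) = ?Q F * ?Q (G - F)" .
  have "plancherel_weight lam * plancherel_weight mu * ?Q (F - G) =
      (plancherel (?\<tau> ` F))\<^sup>2 * (plancherel (?\<tau> ` G))\<^sup>2 / (fact (nat (?\<tau> x)))\<^sup>2 * (?Q G * ?Q (F - G))"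
    unfolding pw[OF part(1) C(1)] pw[OF part(2) C(2)] F_def[symmetric] beads(3) ins[OF FG(2,4)] by simp
  also have "\<dots> = plancherel_weight lam' * plancherel_weight mu' * ?Q (G - F)"
    unfolding pw[OF part(3) C(3)] pw[OF part(4) C(4)] beads(1,2) ins[OF FG(1,3)] Q by simp
  finally show ?thesis unfolding AB .
qed

section \<open>The bilinear identity\<close>

lemma power_sums_of_int: "power_sums (of_int ` E) = Abs_fps (\<lambda>n. fps_const (of_int (\<Sum>x\<in>E. x ^ Suc n)))"
  by (simp add: power_sums_def sum.reindex inj_on_def)

text \<open>Serves both sides of the identity. The three exponentials merge into one with
  coefficients polynomial in the inverse of w, the two Miwa factors merge into the rational function
  with zeros D and poles E, and the hypothesis on k - j adjusts the power of w to its
  degree.\<close>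

lemma residue_exponentials:
  fixes D E :: "int set" and \<xi> :: "'w \<Rightarrow> complex fps fls"
  assumes fin: "finite D" "finite E" and inj: "inj \<iota>\<^sub>1" "inj \<iota>\<^sub>2"
    and P: "\<And>v. eval_inv (P v) = \<xi> v + fls_const (extend_coeff \<iota>\<^sub>1 c\<^sub>1 v) + fls_const (extend_coeff \<iota>\<^sub>2 c\<^sub>2 v)"
    and ps: "\<And>n. of_nat (Suc n) * (c\<^sub>1 (Tm n) * \<epsilon>\<^sub>1 (Tm n) + c\<^sub>1 (Tb n) * \<epsilon>\<^sub>1 (Tb n)) +
      of_nat (Suc n) * (c\<^sub>2 (Tm n) * \<epsilon>\<^sub>2 (Tm n) + c\<^sub>2 (Tb n) * \<epsilon>\<^sub>2 (Tb n)) =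
      fps_const (of_int ((\<Sum>x\<in>E. x ^ Suc n) - (\<Sum>x\<in>D. x ^ Suc n)))"
    and k: "k - j = 1 - (int (card E) - int (card D))"
  shows "fls_nth (mps_coeff (mps_const (fls_X_intpow j) * mexp \<xi> * toda_subst \<iota>\<^sub>1 \<epsilon>\<^sub>1 (mexp c\<^sub>1) * toda_subst \<iota>\<^sub>2 \<epsilon>\<^sub>2 (mexp c\<^sub>2)) M) k =
    fps_const (\<Sum>x\<in>E. dpow (\<lambda>v. poly (P v) (of_int x)) M * (\<Prod>a\<in>D. of_int (x - a)) / (\<Prod>c\<in>E - {x}. of_int (x - c)))"
proof -
  let ?d1 = "\<lambda>v. fls_const (extend_coeff \<iota>\<^sub>1 c\<^sub>1 v)" and ?d2 = "\<lambda>v. fls_const (extend_coeff \<iota>\<^sub>2 c\<^sub>2 v)"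
  let ?e1 = "\<lambda>v. c\<^sub>1 v * \<epsilon>\<^sub>1 v" and ?e2 = "\<lambda>v. c\<^sub>2 v * \<epsilon>\<^sub>2 v"
  define f where "f = miwa_factor ?e1 * miwa_factor ?e2"
  let ?D = "of_int ` D :: complex set" and ?E = "of_int ` E :: complex set"
  let ?j = "int (card ?E) - int (card ?D)"
  have card: "card ?D = card D" "card ?E = card E" by (simp_all add: card_image inj_on_def)
  have "mps_const (fls_X_intpow j) * mexp \<xi> * toda_subst \<iota>\<^sub>1 \<epsilon>\<^sub>1 (mexp c\<^sub>1) * toda_subst \<iota>\<^sub>2 \<epsilon>\<^sub>2 (mexp c\<^sub>2) =
      mps_const (fls_X_intpow j * (fps_to_fls (miwa_factor ?e1) * fps_to_fls (miwa_factor ?e2))) *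
      ((mexp \<xi> * mexp ?d1) * mexp ?d2)"
    by (simp only: toda_subst_mexp[OF inj(1)] toda_subst_mexp[OF inj(2)] mps_const_mult mult_ac)
  also have "(mexp \<xi> * mexp ?d1) * mexp ?d2 = mexp (\<lambda>v. eval_inv (P v))"
    by (simp only: mexp_add[symmetric] P)
  finally have eq: "mps_const (fls_X_intpow j) * mexp \<xi> * toda_subst \<iota>\<^sub>1 \<epsilon>\<^sub>1 (mexp c\<^sub>1) * toda_subst \<iota>\<^sub>2 \<epsilon>\<^sub>2 (mexp c\<^sub>2) =
      mps_const (fls_X_intpow j * (fps_to_fls (miwa_factor ?e1) * fps_to_fls (miwa_factor ?e2))) * mexp (\<lambda>v. eval_inv (P v))" .
  have "fls_nth (mps_coeff (mps_const (fls_X_intpow j) * mexp \<xi> * toda_subst \<iota>\<^sub>1 \<epsilon>\<^sub>1 (mexp c\<^sub>1) * toda_subst \<iota>\<^sub>2 \<epsilon>\<^sub>2 (mexp c\<^sub>2)) M) k =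
      fls_nth (fls_X_intpow j * (eval_inv (dpow_poly P M) * fps_to_fls f)) k"
    unfolding eq mps_coeff_const_mult by (simp only: mexp_def mps_coeff_Abs eval_inv_dpow_poly f_def fls_times_fps_to_fls mult_ac)
  \<comment> \<open>Powers of w only shift coefficients, so coefficient k with prefactor exponent j
    is coefficient 1 with exponent card E - card D.\<close>
  also have "\<dots> = fls_nth (fls_X_intpow ?j * (eval_inv (dpow_poly P M) * fps_to_fls f)) 1"
    unfolding fls_X_intpow_times_conv_shift(1) fls_shift_nth
    by (rule arg_cong[where f = "fls_nth _"]) (use k card in simp)
  also have "\<dots> = fls_nth (eval_inv (dpow_poly P M) * (fls_X_intpow ?j * fps_to_fls f)) 1"
    by (simp only: mult_ac)
  also have "\<dots> = fps_const (\<Sum>b\<in>?E. poly (dpow_poly P M) b * (\<Prod>a\<in>?D. b - a) / (\<Prod>c\<in>?E - {b}. b - c))"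
  proof (rule residue_rational)
    show "fps_nth f 0 = 1" by (simp add: f_def miwa_factor_0)
    have "fps_deriv f = (Abs_fps (\<lambda>n. of_nat (Suc n) * (?e1 (Tm n) + ?e1 (Tb n))) +
        Abs_fps (\<lambda>n. of_nat (Suc n) * (?e2 (Tm n) + ?e2 (Tb n)))) * f"
      by (simp only: f_def fps_deriv_mult miwa_factor_deriv distrib_right distrib_left mult_ac add_ac)
    also have "Abs_fps (\<lambda>n. of_nat (Suc n) * (?e1 (Tm n) + ?e1 (Tb n))) +
        Abs_fps (\<lambda>n. of_nat (Suc n) * (?e2 (Tm n) + ?e2 (Tb n))) = power_sums ?E - power_sums ?D"
      by (rule fps_ext) (simp only: fps_add_nth fps_sub_nth fps_nth_Abs_fps ps power_sums_of_int of_int_diff fps_const_sub)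
    finally show "fps_deriv f = (power_sums ?E - power_sums ?D) * f" .
  qed (use fin in auto)
  also have "(\<Sum>b\<in>?E. poly (dpow_poly P M) b * (\<Prod>a\<in>?D. b - a) / (\<Prod>c\<in>?E - {b}. b - c)) =
      (\<Sum>x\<in>E. dpow (\<lambda>v. poly (P v) (of_int x)) M * (\<Prod>a\<in>D. of_int (x - a)) / (\<Prod>c\<in>E - {x}. of_int (x - c)))"
  proof -
    have im: "?E - {of_int x} = of_int ` (E - {x})" for x by auto
    show ?thesis
      by (subst sum.reindex) (auto simp: inj_on_def im prod.reindex poly_dpow_poly)
  qed
  finally show ?thesis .
qed

section \<open>Truncation in \<Lambda>^2 and reduction to finite sums over pairs\<close>

definition energy :: "int \<Rightarrow> (nat \<Rightarrow> nat) \<Rightarrow> nat" where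
  "energy s lam = partition_size lam + nat (s * (s + 1) div 2)"

definition phi_fps :: "int \<Rightarrow> (nat \<Rightarrow> nat) \<Rightarrow> nat \<Rightarrow> complex fps" where
  "phi_fps s lam n = fps_const (of_int (phi_4D (Suc n) s lam))"

definition Z_weight :: "complex \<Rightarrow> int \<Rightarrow> (nat \<Rightarrow> nat) \<Rightarrow> complex fps" where
  "Z_weight hbar s lam = fps_const (plancherel_weight lam) * (fps_const (1 / hbar\<^sup>2) * fps_X) ^ energy s lam"

definition low_energy :: "nat \<Rightarrow> int \<Rightarrow> (nat \<Rightarrow> nat) set" where
  "low_energy N s = {lam \<in> partitions. energy s lam \<le> N}"

lemma Z_weight_eq: "Z_weight hbar s lam = fps_const (plancherel_weight lam * (1 / hbar\<^sup>2) ^ energy s lam) * fps_X ^ energy s lam"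
  by (simp add: Z_weight_def power_mult_distrib fps_const_power mult.assoc[symmetric])

lemma finite_low_energy: "finite (low_energy N s)"
proof (rule finite_subset)
  show "low_energy N s \<subseteq> (\<Union>k\<in>{..N}. {lam \<in> partitions. partition_size lam = k})"
    by (auto simp: low_energy_def energy_def)
qed (intro finite_UN_I finite_atMost finite_partitions_of_size)

lemma Z_4D_eq:
  "Z_4D hbar s = (\<Sum>\<^sub>\<infinity>lam\<in>partitions. mps_const (Z_weight hbar s lam) * mexp (phi_fps s lam))"
proof -
  have "mps_exp (\<Sum>\<^sub>\<infinity>n. mps_var n * mps_const (of_int (phi_4D (Suc n) s lam))) = mexp (phi_fps s lam)" for lam
  proof -
    have "(\<Sum>\<^sub>\<infinity>n. mps_var n * mps_const (of_int (phi_4D (Suc n) s lam) :: complex fps)) =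
        mps_linear (\<lambda>v. \<Sum>n | v = n. of_int (phi_4D (Suc n) s lam))"
      by (rule infsum_var_linear) simp
    moreover have "phi_fps s lam = (\<lambda>n. of_int (phi_4D (Suc n) s lam))"
      by (rule ext) (simp add: phi_fps_def fps_of_int)
    ultimately show ?thesis by (simp add: mps_exp_linear)
  qed
  then show ?thesis by (simp add: Z_4D_def Z_weight_def plancherel_weight_def energy_def)
qed

text \<open>
  The library topology of \<^typ>\<open>complex fps fls\<close> treats the coefficients as discrete, so after the
  substitution the sum over all partitions no longer converges. Hence the partition function is truncated
  modulo \<open>fps_X ^ Suc N\<close> before substituting.
\<close>

definition Z_low :: "nat \<Rightarrow> complex \<Rightarrow> int \<Rightarrow> (nat, complex fps) mps" where
  "Z_low N hbar s = (\<Sum>lam\<in>low_energy N s. mps_const (Z_weight hbar s lam) * mexp (phi_fps s lam))"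

lemma Z_4D_low:
  "\<exists>R. Z_4D hbar s = Z_low N hbar s + mps_const (fps_X ^ Suc N) * R"
proof -
  let ?t = "\<lambda>lam. mps_const (Z_weight hbar s lam) * mexp (phi_fps s lam)"
  have "?t summable_on partitions"
    using Z_4D_summable[of hbar s "\<lambda>lam. mexp (phi_fps s lam)"]
    by (simp add: Z_weight_def plancherel_weight_def energy_def)
  then have "(?t has_sum Z_4D hbar s) partitions" unfolding Z_4D_eq by (rule has_sum_infsum)
  then have sum: "((\<lambda>lam. mps_coeff (?t lam) m) has_sum mps_coeff (Z_4D hbar s) m) partitions" for m
    by (simp add: has_sum_mps_iff)
  have low: "fps_nth (mps_coeff (Z_4D hbar s) m) j = fps_nth (mps_coeff (Z_low N hbar s) m) j" if "j \<le> N" for m j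
  proof -
    have "\<forall>\<^sub>F X in finite_subsets_at_top partitions. fps_nth (\<Sum>lam\<in>X. mps_coeff (?t lam) m) j = fps_nth (mps_coeff (Z_4D hbar s) m) j"
      using sum[of m] by (simp add: has_sum_def tendsto_fps_iff)
    moreover have "\<forall>\<^sub>F X in finite_subsets_at_top partitions. finite X \<and> low_energy N s \<subseteq> X \<and> X \<subseteq> partitions"
      using finite_low_energy[of N s] unfolding eventually_finite_subsets_at_top
      by (intro exI[of _ "low_energy N s"]) (auto simp: low_energy_def)
    ultimately have "\<forall>\<^sub>F X in finite_subsets_at_top partitions.
        fps_nth (\<Sum>lam\<in>X. mps_coeff (?t lam) m) j = fps_nth (mps_coeff (Z_4D hbar s) m) j \<and>
        finite X \<and> low_energy N s \<subseteq> X \<and> X \<subseteq> partitions"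
      by (rule eventually_conj)
    \<comment> \<open>One finite set of partitions containing those of low energy already has the
      final value of this coefficient; its other members carry a power of \<Lambda>^2 above the j-th
      and contribute nothing.\<close>
    from eventually_happens'[OF finite_subsets_at_top_neq_bot this]
    obtain X where X: "fps_nth (\<Sum>lam\<in>X. mps_coeff (?t lam) m) j = fps_nth (mps_coeff (Z_4D hbar s) m) j"
      "finite X" "low_energy N s \<subseteq> X" "X \<subseteq> partitions" by blast
    have "fps_nth (mps_coeff (?t lam) m) j = 0" if "lam \<in> X - low_energy N s" for lam
    proof -
      have "energy s lam > j" using that X(4) \<open>j \<le> N\<close> by (auto simp: low_energy_def)
      then show ?thesis
        by (simp add: mps_coeff_const_mult Z_weight_eq mult.assoc fps_X_power_mult_nth)
    qed
    then have "(\<Sum>lam\<in>X. fps_nth (mps_coeff (?t lam) m) j) = (\<Sum>lam\<in>low_energy N s. fps_nth (mps_coeff (?t lam) m) j)"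
      using X by (intro sum.mono_neutral_right) auto
    then show ?thesis using X(1) by (simp add: Z_low_def fps_sum_nth)
  qed
  define R where "R = Abs_mps (\<lambda>m. fps_shift (Suc N) (mps_coeff (Z_4D hbar s) m - mps_coeff (Z_low N hbar s) m))"
  have "Z_4D hbar s = Z_low N hbar s + mps_const (fps_X ^ Suc N) * R"
  proof (rule mps_eqI, rule fps_ext)
    fix m j
    have "fps_nth (fps_X ^ Suc N * fps_shift (Suc N) f) j = (if j \<le> N then 0 else fps_nth f j)" for f :: "complex fps"
      by (subst fps_X_power_mult_nth) auto
    then show "fps_nth (mps_coeff (Z_4D hbar s) m) j = fps_nth (mps_coeff (Z_low N hbar s + mps_const (fps_X ^ Suc N) * R) m) j"
      by (simp add: mps_coeff_const_mult R_def low del: power_Suc)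
  qed
  then show ?thesis by blast
qed

definition phi_toda :: "int \<Rightarrow> (nat \<Rightarrow> nat) \<Rightarrow> toda_var \<Rightarrow> complex fps" where
  "phi_toda s lam = case_toda_var (phi_fps s lam) (\<lambda>n. - phi_fps s lam n)"

lemma toda_diff_Z_low:
  "toda_diff (Z_low N hbar s) = (\<Sum>lam\<in>low_energy N s. mps_const (Z_weight hbar s lam) * mexp (phi_toda s lam))"
proof -
  have 0: "toda_diff 0 = 0" using toda_diff_const_mult[of 0 0] by simp
  have "toda_diff (sum f A) = (\<Sum>x\<in>A. toda_diff (f x))" for f :: "(nat \<Rightarrow> nat) \<Rightarrow> _" and A
    by (induction A rule: infinite_finite_induct) (simp_all add: 0 toda_diff_add)
  then show ?thesis by (simp add: Z_low_def toda_diff_const_mult toda_diff_mexp phi_toda_def)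
qed

lemma toda_subst_sum_mexp:
  assumes "inj \<iota>"
  shows "toda_subst \<iota> \<epsilon> (\<Sum>x\<in>A. mps_const (w x) * mexp (c x)) =
    (\<Sum>x\<in>A. mps_const (fls_const (w x)) * toda_subst \<iota> \<epsilon> (mexp (c x)))"
proof -
  have "toda_subst \<iota> \<epsilon> 0 = 0" using toda_subst_const_mult[OF assms, of \<epsilon> 0 0] by simp
  then show ?thesis
    by (induction A rule: infinite_finite_induct) (simp_all add: toda_subst_add[OF assms] toda_subst_const_mult[OF assms])
qed

text \<open>\<open>toda_subst\<close> is linear over series in \<Lambda>^2, so all error terms keep
  the factor \<open>fps_X ^ Suc N\<close>, whatever the remainders are, and miss the coefficient
  N.\<close>

lemma bilinear_truncate:
  assumes inj: "inj \<iota>\<^sub>1" "inj \<iota>\<^sub>2"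
    and f: "f = f' + mps_const (fps_X ^ Suc N) * r" and g: "g = g' + mps_const (fps_X ^ Suc N) * q"
  shows "fps_nth (fls_nth (mps_coeff (pre * toda_subst \<iota>\<^sub>1 \<epsilon>\<^sub>1 f * toda_subst \<iota>\<^sub>2 \<epsilon>\<^sub>2 g) M) k) N =
    fps_nth (fls_nth (mps_coeff (pre * toda_subst \<iota>\<^sub>1 \<epsilon>\<^sub>1 f' * toda_subst \<iota>\<^sub>2 \<epsilon>\<^sub>2 g') M) k) N"
proof -
  let ?T = "toda_subst \<iota>\<^sub>1 \<epsilon>\<^sub>1" and ?S = "toda_subst \<iota>\<^sub>2 \<epsilon>\<^sub>2" and ?Q = "mps_const (fls_const (fps_X ^ Suc N)) :: ('a, complex fps fls) mps"
  define Y where "Y = pre * (?T f' * ?S q + ?T r * ?S g' + ?Q * ?T r * ?S q)"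
  have "pre * ?T f * ?S g = pre * (?T f' + ?Q * ?T r) * (?S g' + ?Q * ?S q)"
    by (simp only: f g toda_subst_add[OF inj(1)] toda_subst_add[OF inj(2)] toda_subst_const_mult[OF inj(1)] toda_subst_const_mult[OF inj(2)])
  also have "\<dots> = pre * ?T f' * ?S g' + ?Q * Y"
    by (simp only: Y_def distrib_left distrib_right mult_ac add_ac)
  finally show ?thesis
    by (simp add: mps_coeff_const_mult fps_X_power_mult_nth del: power_Suc)
qed

lemma fps_nth_Z_weight_mult:
  "fps_nth (Z_weight hbar s lam * Z_weight hbar t mu * fps_const v) N =
    (if energy s lam + energy t mu = N then plancherel_weight lam * plancherel_weight mu * (1 / hbar\<^sup>2) ^ N * v else 0)"
proof -
  have "Z_weight hbar s lam * Z_weight hbar t mu * fps_const v =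
      fps_const (plancherel_weight lam * plancherel_weight mu * (1 / hbar\<^sup>2) ^ (energy s lam + energy t mu) * v) *
      fps_X ^ (energy s lam + energy t mu)"
    by (simp only: Z_weight_eq power_add fps_const_mult[symmetric] mult_ac)
  then show ?thesis by (auto simp: fps_X_power_nth)
qed

definition toda_pairs :: "nat \<Rightarrow> int \<Rightarrow> int \<Rightarrow> ((nat \<Rightarrow> nat) \<times> (nat \<Rightarrow> nat)) set" where
  "toda_pairs N s' s = {(lam, mu). lam \<in> partitions \<and> mu \<in> partitions \<and> energy s' lam + energy s mu = N}"

lemma finite_toda_pairs: "finite (toda_pairs N s' s)"
  using finite_cartesian_product[OF finite_low_energy finite_low_energy]
  by (rule finite_subset[rotated, of "low_energy N s' \<times> low_energy N s"]) (auto simp: toda_pairs_def low_energy_def)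

text \<open>A pair of partitions contributes a monomial in \<Lambda>^2, with exponent its total
  energy, times a residue that is constant by assumption. So the coefficient N collects exactly the
  pairs of total energy N, and all of them carry the same power of \<open>hbar\<close>.\<close>

lemma bilinear_coeff:
  assumes inj: "inj \<iota>\<^sub>1" "inj \<iota>\<^sub>2"
    and v: "\<And>lam mu. lam \<in> partitions \<Longrightarrow> mu \<in> partitions \<Longrightarrow>
      fls_nth (mps_coeff (pre * toda_subst \<iota>\<^sub>1 \<epsilon>\<^sub>1 (mexp (phi_toda s' lam)) * toda_subst \<iota>\<^sub>2 \<epsilon>\<^sub>2 (mexp (phi_toda s mu))) M) k =
        fps_const (v lam mu)"
  shows "fps_nth (fls_nth (mps_coeff (pre * toda_subst \<iota>\<^sub>1 \<epsilon>\<^sub>1 (toda_diff (Z_4D hbar s')) * toda_subst \<iota>\<^sub>2 \<epsilon>\<^sub>2 (toda_diff (Z_4D hbar s))) M) k) N =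
    (1 / hbar\<^sup>2) ^ N * (\<Sum>(lam, mu)\<in>toda_pairs N s' s. plancherel_weight lam * plancherel_weight mu * v lam mu)"
proof -
  let ?T = "toda_subst \<iota>\<^sub>1 \<epsilon>\<^sub>1" and ?S = "toda_subst \<iota>\<^sub>2 \<epsilon>\<^sub>2"
  let ?P = "low_energy N s' \<times> low_energy N s"
  have "\<exists>r. toda_diff (Z_4D hbar t) = toda_diff (Z_low N hbar t) + mps_const (fps_X ^ Suc N) * r" for t
    using Z_4D_low[of hbar t N] by (metis toda_diff_add toda_diff_const_mult)
  then obtain r q where r: "toda_diff (Z_4D hbar s') = toda_diff (Z_low N hbar s') + mps_const (fps_X ^ Suc N) * r"
    and q: "toda_diff (Z_4D hbar s) = toda_diff (Z_low N hbar s) + mps_const (fps_X ^ Suc N) * q" by blast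
  have "fps_nth (fls_nth (mps_coeff (pre * ?T (toda_diff (Z_4D hbar s')) * ?S (toda_diff (Z_4D hbar s))) M) k) N =
      fps_nth (fls_nth (mps_coeff (pre * ?T (toda_diff (Z_low N hbar s')) * ?S (toda_diff (Z_low N hbar s))) M) k) N"
    by (rule bilinear_truncate[OF inj r q])
  also have "pre * ?T (toda_diff (Z_low N hbar s')) * ?S (toda_diff (Z_low N hbar s)) =
      (\<Sum>(lam, mu)\<in>?P. mps_const (fls_const (Z_weight hbar s' lam * Z_weight hbar s mu)) *
        (pre * ?T (mexp (phi_toda s' lam)) * ?S (mexp (phi_toda s mu))))"
  proof -
    have "pre * ?T (toda_diff (Z_low N hbar s')) * ?S (toda_diff (Z_low N hbar s)) =
        (\<Sum>lam\<in>low_energy N s'. \<Sum>mu\<in>low_energy N s. pre * (mps_const (fls_const (Z_weight hbar s' lam)) * ?T (mexp (phi_toda s' lam))) *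
          (mps_const (fls_const (Z_weight hbar s mu)) * ?S (mexp (phi_toda s mu))))"
      by (simp only: toda_diff_Z_low toda_subst_sum_mexp[OF inj(1)] toda_subst_sum_mexp[OF inj(2)]
          sum_distrib_left sum_distrib_right) (subst sum.swap, rule refl)
    also have "\<dots> = (\<Sum>lam\<in>low_energy N s'. \<Sum>mu\<in>low_energy N s. mps_const (fls_const (Z_weight hbar s' lam * Z_weight hbar s mu)) *
        (pre * ?T (mexp (phi_toda s' lam)) * ?S (mexp (phi_toda s mu))))"
      by (simp only: fls_const_mult_const[symmetric] mps_const_mult mult_ac)
    finally show ?thesis by (simp only: sum.cartesian_product)
  qed
  also have "fps_nth (fls_nth (mps_coeff \<dots> M) k) N =
      (\<Sum>(lam, mu)\<in>?P. fps_nth (Z_weight hbar s' lam * Z_weight hbar s mu *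
        fls_nth (mps_coeff (pre * ?T (mexp (phi_toda s' lam)) * ?S (mexp (phi_toda s mu))) M) k) N)"
    by (simp add: fls_nth_sum fps_sum_nth mps_coeff_const_mult case_prod_unfold)
  also have "\<dots> = (\<Sum>(lam, mu)\<in>?P. if energy s' lam + energy s mu = N
      then plancherel_weight lam * plancherel_weight mu * (1 / hbar\<^sup>2) ^ N * v lam mu else 0)"
  proof (intro sum.cong refl, clarify)
    fix lam mu assume "lam \<in> low_energy N s'" "mu \<in> low_energy N s"
    then have "lam \<in> partitions" "mu \<in> partitions" by (simp_all add: low_energy_def)
    from v[OF this] show "fps_nth (Z_weight hbar s' lam * Z_weight hbar s mu *
        fls_nth (mps_coeff (pre * ?T (mexp (phi_toda s' lam)) * ?S (mexp (phi_toda s mu))) M) k) N =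
      (if energy s' lam + energy s mu = N
        then plancherel_weight lam * plancherel_weight mu * (1 / hbar\<^sup>2) ^ N * v lam mu else 0)"
      by (simp only: fps_nth_Z_weight_mult)
  qed
  also have "\<dots> = (\<Sum>(lam, mu)\<in>toda_pairs N s' s. plancherel_weight lam * plancherel_weight mu * (1 / hbar\<^sup>2) ^ N * v lam mu)"
    using finite_low_energy
    by (intro sum.mono_neutral_cong_right) (auto simp: toda_pairs_def low_energy_def split: if_splits)
  finally show ?thesis by (simp add: sum_distrib_left case_prod_unfold mult_ac)
qed

text \<open>For x in E, the residue at z = x of \<Prod>(z - a) / \<Prod>(z - c) with a in D and c in
  E.\<close>

definition exchange_ratio :: "int \<Rightarrow> int set \<Rightarrow> int set \<Rightarrow> complex" where
  "exchange_ratio x D E = (\<Prod>a\<in>D. of_int (x - a)) / (\<Prod>c\<in>E - {x}. of_int (x - c))"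

section \<open>Shifts and exponents of the two sides\<close>

definition miwa_t :: "complex fps \<Rightarrow> toda_var \<Rightarrow> complex fps" where
  "miwa_t c = case_toda_var (\<lambda>n. c * inverse (of_nat (Suc n))) (\<lambda>_. 0)"

definition miwa_b :: "complex fps \<Rightarrow> toda_var \<Rightarrow> complex fps" where
  "miwa_b c = case_toda_var (\<lambda>_. 0) (\<lambda>n. c * inverse (of_nat (Suc n)))"

abbreviation "primed \<equiv> case_toda_var Um' Ub'"
abbreviation "unprimed \<equiv> case_toda_var Um Ub"

lemma inj_primed: "inj primed" "inj unprimed"
  by (auto simp: inj_def split: toda_var.splits)

lemma miwa_shift_const: "miwa_shift n = mps_const (fls_const (inverse (of_nat (Suc n))) * fls_X ^ Suc n)"
  by (simp only: miwa_shift_def fls_inverse_of_nat)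

lemma toda_eval_subst:
  assumes "\<And>v. case_toda_var x y v = mps_var (\<iota> v) + mps_const (fls_const (\<epsilon> v) * fls_X ^ toda_wt v)"
  shows "toda_eval f x y = toda_subst \<iota> \<epsilon> f"
proof -
  have "case_toda_var x y = (\<lambda>v. mps_var (\<iota> v) + mps_const (fls_const (\<epsilon> v) * fls_X ^ toda_wt v))"
    using assms by (rule ext)
  then show ?thesis by (simp only: toda_eval_def toda_subst_def)
qed

lemma mps_const_minus: "mps_const (- c) = - mps_const c"
  by (rule mps_eqI) (simp add: mps_const_def)

lemma fls_const_minus: "fls_const (- c) = - (fls_const c :: 'a::comm_ring_1 fls)"
  by (rule fls_eqI) simp

lemma toda_eval_shifts:
  "toda_eval f (\<lambda>n. mps_var (Um' n) - miwa_shift n) (\<lambda>n. mps_var (Ub' n)) = toda_subst primed (miwa_t (- 1)) f"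
  "toda_eval f (\<lambda>n. mps_var (Um n) + miwa_shift n) (\<lambda>n. mps_var (Ub n)) = toda_subst unprimed (miwa_t 1) f"
  "toda_eval f (\<lambda>n. mps_var (Um' n)) (\<lambda>n. mps_var (Ub' n) - miwa_shift n) = toda_subst primed (miwa_b (- 1)) f"
  "toda_eval f (\<lambda>n. mps_var (Um n)) (\<lambda>n. mps_var (Ub n) + miwa_shift n) = toda_subst unprimed (miwa_b 1) f"
  by (rule toda_eval_subst,
      auto simp: miwa_t_def miwa_b_def miwa_shift_const mps_const_minus fls_const_minus split: toda_var.split simp del: of_nat_Suc power_Suc)+

definition xi_coeff :: "(nat \<Rightarrow> 'v) \<Rightarrow> (nat \<Rightarrow> 'v) \<Rightarrow> 'v \<Rightarrow> complex fps fls" where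
  "xi_coeff a b v = (\<Sum>n | v = a n. fls_X_inv ^ Suc n) - (\<Sum>n | v = b n. fls_X_inv ^ Suc n)"

lemma mps_exp_xi:
  assumes "inj a" "inj b" "range a \<inter> range b = {}"
  shows "mps_exp (toda_xi (\<lambda>n. mps_var (a n) - mps_var (b n))) = mexp (xi_coeff a b)"
  unfolding toda_xi_def infsum_var_diff_linear[OF assms] mps_exp_linear xi_coeff_def ..

lemma extend_coeff_eq: "inj \<iota> \<Longrightarrow> extend_coeff \<iota> c (\<iota> v) = c v"
  by (simp add: extend_coeff_def)

lemma extend_coeff_toda [simp]:
  "extend_coeff primed c (Um' n) = c (Tm n)" "extend_coeff primed c (Ub' n) = c (Tb n)"
  "extend_coeff unprimed c (Um n) = c (Tm n)" "extend_coeff unprimed c (Ub n) = c (Tb n)"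
  "extend_coeff primed c (Um n) = 0" "extend_coeff primed c (Ub n) = 0"
  "extend_coeff unprimed c (Um' n) = 0" "extend_coeff unprimed c (Ub' n) = 0"
  using extend_coeff_eq[OF inj_primed(1), of c "Tm n"] extend_coeff_eq[OF inj_primed(1), of c "Tb n"]
    extend_coeff_eq[OF inj_primed(2), of c "Tm n"] extend_coeff_eq[OF inj_primed(2), of c "Tb n"]
  by (auto simp: extend_coeff_def split: toda_var.splits)

lemma eval_inv_diff: "eval_inv (p - q) = eval_inv p - eval_inv q"
  using eval_inv_add[of "p - q" q] by (simp add: eq_diff_eq)

text \<open>The coefficient of a time in the total exponent: a signed power of z from \<xi>, and a
  potential, negated on barred times because tau depends on the difference of the alphabets. In
  \<open>rhs_poly\<close> the polynomial variable is the inverse of z.\<close>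

definition lhs_poly :: "(nat \<Rightarrow> complex) \<Rightarrow> (nat \<Rightarrow> complex) \<Rightarrow> bilin_var \<Rightarrow> complex poly" where
  "lhs_poly a b v = (case v of Um' n \<Rightarrow> monom 1 (Suc n) + [:a n:] | Um n \<Rightarrow> - monom 1 (Suc n) + [:b n:]
    | Ub' n \<Rightarrow> [:- a n:] | Ub n \<Rightarrow> [:- b n:])"

definition rhs_poly :: "(nat \<Rightarrow> complex) \<Rightarrow> (nat \<Rightarrow> complex) \<Rightarrow> bilin_var \<Rightarrow> complex poly" where
  "rhs_poly a b v = (case v of Um' n \<Rightarrow> [:a n:] | Um n \<Rightarrow> [:b n:]
    | Ub' n \<Rightarrow> monom 1 (Suc n) + [:- a n:] | Ub n \<Rightarrow> - monom 1 (Suc n) + [:- b n:])"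

text \<open>Moving x adds a power of x to one potential and subtracts it from the other. On unbarred
  times this replaces the power that \<xi> contributes on the left; on barred times it is cancelled
  by the power that \<xi> contributes on the right.\<close>

lemma lhs_rhs_poly:
  assumes "\<And>n. a' n = a n + x ^ Suc n" "\<And>n. b' n = b n - x ^ Suc n"
  shows "poly (lhs_poly a b v) x = poly (rhs_poly a' b' v) x"
  using assms by (simp add: lhs_poly_def rhs_poly_def poly_monom split: bilin_var.split)

abbreviation "phi_complex s lam \<equiv> (\<lambda>n. of_int (phi_4D (Suc n) s lam) :: complex)"

lemma eval_inv_lhs_poly:
  "eval_inv (lhs_poly (phi_complex s' lam) (phi_complex s mu) v) = xi_coeff Um' Um v +
    fls_const (extend_coeff primed (phi_toda s' lam) v) + fls_const (extend_coeff unprimed (phi_toda s mu) v)"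
  by (cases v) (simp_all add: lhs_poly_def xi_coeff_def phi_toda_def phi_fps_def eval_inv_add eval_inv_diff
      eval_inv_monom eval_inv_const fls_const_minus flip: fps_const_neg del: power_Suc of_int_minus)

lemma eval_inv_rhs_poly:
  "eval_inv (rhs_poly (phi_complex s' lam) (phi_complex s mu) v) = xi_coeff Ub' Ub v +
    fls_const (extend_coeff primed (phi_toda s' lam) v) + fls_const (extend_coeff unprimed (phi_toda s mu) v)"
  by (cases v) (simp_all add: rhs_poly_def xi_coeff_def phi_toda_def phi_fps_def eval_inv_add eval_inv_diff
      eval_inv_monom eval_inv_const fls_const_minus flip: fps_const_neg del: power_Suc of_int_minus)

lemma of_nat_inverse_fps: "of_nat (Suc n) * (c * inverse (of_nat (Suc n))) = (c :: complex fps)"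
proof -
  have "of_nat (Suc n) * inverse (of_nat (Suc n)) = (1 :: complex fps)"
    by (simp only: fps_of_nat[symmetric] fps_const_inverse fps_const_mult) (simp del: of_nat_Suc)
  then show ?thesis by (simp only: mult.left_commute[of _ c] mult_1_right)
qed

lemma lhs_coeff:
  fixes s s' :: int
  assumes "lam \<in> partitions" "mu \<in> partitions"
  defines "D \<equiv> maya s' lam - maya s mu" and "E \<equiv> maya s mu - maya s' lam"
  shows "fls_nth (mps_coeff (mps_const (fls_X_intpow (s - s')) * mexp (xi_coeff Um' Um) *
      toda_subst primed (miwa_t (- 1)) (mexp (phi_toda s' lam)) * toda_subst unprimed (miwa_t 1) (mexp (phi_toda s mu))) M) 1 =
    fps_const (\<Sum>x\<in>E. dpow (\<lambda>v. poly (lhs_poly (phi_complex s' lam) (phi_complex s mu) v) (of_int x)) M * exchange_ratio x D E)"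
  unfolding exchange_ratio_def times_divide_eq_right
proof (rule residue_exponentials)
  note diff = maya_diff[OF assms(2,1), where s = s and t = s'] maya_diff[OF assms(1,2), where s = s' and t = s]
  show "finite D" "finite E" using diff unfolding D_def E_def by auto
  show "1 - (s - s') = 1 - (int (card E) - int (card D))" using diff(2) by (simp add: D_def E_def)
  show "of_nat (Suc n) * (phi_toda s' lam (Tm n) * miwa_t (- 1) (Tm n) + phi_toda s' lam (Tb n) * miwa_t (- 1) (Tb n)) +
      of_nat (Suc n) * (phi_toda s mu (Tm n) * miwa_t 1 (Tm n) + phi_toda s mu (Tb n) * miwa_t 1 (Tb n)) =
      fps_const (of_int ((\<Sum>x\<in>E. x ^ Suc n) - (\<Sum>x\<in>D. x ^ Suc n)))" for n
  proof -
    have "of_nat (Suc n) * (phi_toda s' lam (Tm n) * miwa_t (- 1) (Tm n) + phi_toda s' lam (Tb n) * miwa_t (- 1) (Tb n)) +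
      of_nat (Suc n) * (phi_toda s mu (Tm n) * miwa_t 1 (Tm n) + phi_toda s mu (Tb n) * miwa_t 1 (Tb n)) =
      - phi_fps s' lam n + phi_fps s mu n"
      by (simp add: phi_toda_def miwa_t_def of_nat_inverse_fps del: of_nat_Suc)
    also have "\<dots> = fps_const (of_int (phi_4D (Suc n) s mu - phi_4D (Suc n) s' lam))"
      by (simp add: phi_fps_def)
    finally show ?thesis by (simp only: diff(3) D_def E_def)
  qed
qed (rule inj_primed eval_inv_lhs_poly)+

lemma rhs_coeff:
  fixes s s' :: int
  assumes "lam \<in> partitions" "mu \<in> partitions"
  defines "D \<equiv> maya (s - 1) mu - maya (s' + 1) lam" and "E \<equiv> maya (s' + 1) lam - maya (s - 1) mu"
  shows "fls_nth (mps_coeff (mps_const (fls_X_intpow (s' - s)) * mexp (xi_coeff Ub' Ub) *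
      toda_subst primed (miwa_b (- 1)) (mexp (phi_toda (s' + 1) lam)) * toda_subst unprimed (miwa_b 1) (mexp (phi_toda (s - 1) mu))) M) (- 1) =
    fps_const (\<Sum>x\<in>E. dpow (\<lambda>v. poly (rhs_poly (phi_complex (s' + 1) lam) (phi_complex (s - 1) mu) v) (of_int x)) M * exchange_ratio x D E)"
  unfolding exchange_ratio_def times_divide_eq_right
proof (rule residue_exponentials)
  note diff = maya_diff[OF assms(1,2), where s = "s' + 1" and t = "s - 1"]
    maya_diff[OF assms(2,1), where s = "s - 1" and t = "s' + 1"]
  show "finite D" "finite E" using diff unfolding D_def E_def by auto
  \<comment> \<open>The charges s' + 1 and s - 1 differ by s' - s + 2; extracting the coefficient -1
    instead of 1 accounts for the additional 2.\<close>
  show "- 1 - (s' - s) = 1 - (int (card E) - int (card D))" using diff(2) by (simp add: D_def E_def)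
  show "of_nat (Suc n) * (phi_toda (s' + 1) lam (Tm n) * miwa_b (- 1) (Tm n) + phi_toda (s' + 1) lam (Tb n) * miwa_b (- 1) (Tb n)) +
      of_nat (Suc n) * (phi_toda (s - 1) mu (Tm n) * miwa_b 1 (Tm n) + phi_toda (s - 1) mu (Tb n) * miwa_b 1 (Tb n)) =
      fps_const (of_int ((\<Sum>x\<in>E. x ^ Suc n) - (\<Sum>x\<in>D. x ^ Suc n)))" for n
  proof -
    have "of_nat (Suc n) * (phi_toda (s' + 1) lam (Tm n) * miwa_b (- 1) (Tm n) + phi_toda (s' + 1) lam (Tb n) * miwa_b (- 1) (Tb n)) +
      of_nat (Suc n) * (phi_toda (s - 1) mu (Tm n) * miwa_b 1 (Tm n) + phi_toda (s - 1) mu (Tb n) * miwa_b 1 (Tb n)) =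
      phi_fps (s' + 1) lam n - phi_fps (s - 1) mu n"
      by (simp add: phi_toda_def miwa_b_def of_nat_inverse_fps del: of_nat_Suc)
    also have "\<dots> = fps_const (of_int (phi_4D (Suc n) (s' + 1) lam - phi_4D (Suc n) (s - 1) mu))"
      by (simp add: phi_fps_def)
    finally show ?thesis by (simp only: diff(3) D_def E_def)
  qed
qed (rule inj_primed eval_inv_rhs_poly)+

section \<open>The bijection between the terms of the two residue sums\<close>

abbreviation lhs_term where
  "lhs_term s' s M lam mu x \<equiv> plancherel_weight lam * plancherel_weight mu *
    (dpow (\<lambda>v. poly (lhs_poly (phi_complex s' lam) (phi_complex s mu) v) (of_int x)) M *
     exchange_ratio x (maya s' lam - maya s mu) (maya s mu - maya s' lam))"

abbreviation rhs_term where
  "rhs_term s' s M lam mu x \<equiv> plancherel_weight lam * plancherel_weight mu *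
    (dpow (\<lambda>v. poly (rhs_poly (phi_complex s' lam) (phi_complex s mu) v) (of_int x)) M *
     exchange_ratio x (maya s mu - maya s' lam) (maya s' lam - maya s mu))"

text \<open>Passing to the exchanged pair interchanges zeros and poles apart from x, so the residue
  p / q turns into q / p; the squared Vandermonde products make up for the difference.\<close>

lemma exchange_term:
  assumes part: "lam \<in> partitions" "mu \<in> partitions" "lam' \<in> partitions" "mu' \<in> partitions"
    and x: "x \<in> maya s mu - maya s' lam"
    and lam': "maya (s' + 1) lam' = insert x (maya s' lam)" and mu': "maya (s - 1) mu' = maya s mu - {x}"
  shows "lhs_term s' s M lam mu x = rhs_term (s' + 1) (s - 1) M lam' mu' x"
    and "energy (s' + 1) lam' + energy (s - 1) mu' = energy s' lam + energy s mu"
proof -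
  have phi: "phi_4D (Suc n) (s' + 1) lam' = phi_4D (Suc n) s' lam + x ^ Suc n"
    "phi_4D (Suc n) (s - 1) mu' = phi_4D (Suc n) s mu - x ^ Suc n" for n
  proof -
    have sets: "insert x (maya s' lam) - maya s' lam = {x}" "maya s' lam - insert x (maya s' lam) = {}"
      "maya s mu - (maya s mu - {x}) = {x}" "maya s mu - {x} - maya s mu = {}" using x by auto
    show "phi_4D (Suc n) (s' + 1) lam' = phi_4D (Suc n) s' lam + x ^ Suc n"
      using maya_diff(3)[OF part(3,1), of n "s' + 1" s'] unfolding lam' sets by simp
    show "phi_4D (Suc n) (s - 1) mu' = phi_4D (Suc n) s mu - x ^ Suc n"
      using maya_diff(3)[OF part(2,4), of n s "s - 1"] unfolding mu' sets by simp
  qed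
  \<comment> \<open>The total energy is the sum of the two first potentials, which change by x and
    -x.\<close>
  have "int (energy (s' + 1) lam' + energy (s - 1) mu') = int (energy s' lam + energy s mu)"
    unfolding of_nat_add energy_def
      energy_eq_phi[OF part(1), unfolded of_nat_add] energy_eq_phi[OF part(2), unfolded of_nat_add]
      energy_eq_phi[OF part(3), unfolded of_nat_add] energy_eq_phi[OF part(4), unfolded of_nat_add]
    using phi[of 0] by simp
  then show "energy (s' + 1) lam' + energy (s - 1) mu' = energy s' lam + energy s mu" by linarith
  define p where "p = (\<Prod>a\<in>maya s' lam - maya s mu. of_int (x - a) :: complex)"
  define q where "q = (\<Prod>b\<in>maya s mu - maya s' lam - {x}. of_int (x - b) :: complex)"
  have D: "maya (s - 1) mu' - maya (s' + 1) lam' = maya s mu - maya s' lam - {x}"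
    "maya (s' + 1) lam' - maya (s - 1) mu' - {x} = maya s' lam - maya s mu"
    using x by (auto simp: lam' mu')
  have fin: "finite (maya s' lam - maya s mu)" "finite (maya s mu - maya s' lam)"
    using maya_diff(1) part by auto
  then have "p \<noteq> 0" "q \<noteq> 0" using x by (auto simp: p_def q_def)
  moreover have "plancherel_weight lam * plancherel_weight mu * p\<^sup>2 = plancherel_weight lam' * plancherel_weight mu' * q\<^sup>2"
    using plancherel_weight_exchange[OF part _ _ lam' mu'] x by (simp add: p_def q_def prod_power_distrib)
  ultimately have pq: "plancherel_weight lam * plancherel_weight mu * (p / q) = plancherel_weight lam' * plancherel_weight mu' * (q / p)"
    by (simp add: field_simps power2_eq_square)
  have poly: "poly (lhs_poly (phi_complex s' lam) (phi_complex s mu) v) (of_int x) =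
      poly (rhs_poly (phi_complex (s' + 1) lam') (phi_complex (s - 1) mu') v) (of_int x)" for v
    by (rule lhs_rhs_poly) (simp_all add: phi del: power_Suc)
  have ratio: "exchange_ratio x (maya s' lam - maya s mu) (maya s mu - maya s' lam) = p / q"
    "exchange_ratio x (maya (s - 1) mu' - maya (s' + 1) lam') (maya (s' + 1) lam' - maya (s - 1) mu') = q / p"
    by (simp_all only: exchange_ratio_def D p_def q_def)
  show "lhs_term s' s M lam mu x = rhs_term (s' + 1) (s - 1) M lam' mu' x"
    unfolding poly ratio mult.left_commute[of _ "dpow _ _"] pq ..
qed

abbreviation "partition_of s A \<equiv> inv_into partitions (maya s) A"

lemma maya_partition_of:
  assumes "\<exists>lam\<in>partitions. maya s lam = A"
  shows "partition_of s A \<in> partitions" "maya s (partition_of s A) = A"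
proof -
  have "A \<in> maya s ` partitions" using assms by blast
  then show "partition_of s A \<in> partitions" "maya s (partition_of s A) = A"
    by (rule inv_into_into, rule f_inv_into_f)
qed

lemma partition_of_maya: "lam \<in> partitions \<Longrightarrow> partition_of s (maya s lam) = lam"
  by (rule inv_into_f_f) (auto intro: inj_onI maya_inj)

text \<open>Inserting x into A and removing it from B is undone by the reverse move, and x in B - A
  becomes x in A' - B'. Total energy is preserved, so pairs of energy N go to pairs of energy
  N.\<close>

lemma exchange_sum:
  "(\<Sum>(lam, mu)\<in>toda_pairs N s' s. \<Sum>x\<in>maya s mu - maya s' lam. lhs_term s' s M lam mu x) =
   (\<Sum>(lam, mu)\<in>toda_pairs N (s' + 1) (s - 1). \<Sum>x\<in>maya (s' + 1) lam - maya (s - 1) mu. rhs_term (s' + 1) (s - 1) M lam mu x)"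
proof -
  let ?L = "Sigma (toda_pairs N s' s) (\<lambda>(lam, mu). maya s mu - maya s' lam)"
  let ?R = "Sigma (toda_pairs N (s' + 1) (s - 1)) (\<lambda>(lam, mu). maya (s' + 1) lam - maya (s - 1) mu)"
  let ?j = "\<lambda>((lam, mu), x). ((partition_of (s' + 1) (insert x (maya s' lam)), partition_of (s - 1) (maya s mu - {x})), x)"
  let ?i = "\<lambda>((lam, mu), x). ((partition_of s' (maya (s' + 1) lam - {x}), partition_of s (insert x (maya (s - 1) mu))), x)"
  have "(\<Sum>(lam, mu)\<in>toda_pairs N s' s. \<Sum>x\<in>maya s mu - maya s' lam. lhs_term s' s M lam mu x) =
      (\<Sum>((lam, mu), x)\<in>?L. lhs_term s' s M lam mu x)"
    unfolding case_prod_unfold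
    by (rule sum.Sigma[unfolded case_prod_unfold]) (simp add: finite_toda_pairs, auto simp: toda_pairs_def maya_diff(1))
  also have "\<dots> = (\<Sum>((lam, mu), x)\<in>?R. rhs_term (s' + 1) (s - 1) M lam mu x)"
  proof (rule sum.reindex_bij_witness[where i = ?i and j = ?j])
    fix t assume "t \<in> ?L"
    then obtain lam mu x where t: "t = ((lam, mu), x)" "lam \<in> partitions" "mu \<in> partitions"
      "energy s' lam + energy s mu = N" "x \<in> maya s mu - maya s' lam"
      by (auto simp: toda_pairs_def)
    let ?lam = "partition_of (s' + 1) (insert x (maya s' lam))" and ?mu = "partition_of (s - 1) (maya s mu - {x})"
    have lam': "?lam \<in> partitions" "maya (s' + 1) ?lam = insert x (maya s' lam)"
      using maya_partition_of[OF maya_insert[OF t(2), where s = s']] t(5) by auto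
    have mu': "?mu \<in> partitions" "maya (s - 1) ?mu = maya s mu - {x}"
      using maya_partition_of[OF maya_remove[OF t(3), where s = s]] t(5) by auto
    note e = exchange_term[OF t(2,3) lam'(1) mu'(1) t(5) lam'(2) mu'(2)]
    show "?j t \<in> ?R"
      using t(4,5) lam' mu' e(2) by (auto simp: t(1) toda_pairs_def)
    have "insert x (maya s' lam) - {x} = maya s' lam" "insert x (maya s mu - {x}) = maya s mu" using t(5) by auto
    then show "?i (?j t) = t" by (simp add: t(1) lam' mu' partition_of_maya t(2,3))
    show "(\<lambda>((lam, mu), x). rhs_term (s' + 1) (s - 1) M lam mu x) (?j t) =
        (\<lambda>((lam, mu), x). lhs_term s' s M lam mu x) t"
      by (simp only: t(1) prod.case e(1))
  next
    fix t assume "t \<in> ?R"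
    then obtain lam mu x where t: "t = ((lam, mu), x)" "lam \<in> partitions" "mu \<in> partitions"
      "energy (s' + 1) lam + energy (s - 1) mu = N" "x \<in> maya (s' + 1) lam - maya (s - 1) mu"
      by (auto simp: toda_pairs_def)
    let ?lam = "partition_of s' (maya (s' + 1) lam - {x})" and ?mu = "partition_of s (insert x (maya (s - 1) mu))"
    have lam': "?lam \<in> partitions" "maya s' ?lam = maya (s' + 1) lam - {x}"
      using maya_partition_of[OF maya_remove[OF t(2), where s = "s' + 1", simplified]] t(5) by auto
    have mu': "?mu \<in> partitions" "maya s ?mu = insert x (maya (s - 1) mu)"
      using maya_partition_of[OF maya_insert[OF t(3), where s = "s - 1", simplified]] t(5) by auto
    have ins: "maya (s' + 1) lam = insert x (maya s' ?lam)" "maya (s - 1) mu = maya s ?mu - {x}"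
      "x \<in> maya s ?mu - maya s' ?lam" using t(5) by (auto simp: lam' mu')
    note e = exchange_term[OF lam'(1) mu'(1) t(2,3) ins(3,1,2)]
    show "?i t \<in> ?L"
      using t(4) ins(3) lam'(1) mu'(1) e(2) by (auto simp: t(1) toda_pairs_def)
    show "?j (?i t) = t"
      by (simp only: t(1) prod.case ins(1,2)[symmetric] partition_of_maya[OF t(2)] partition_of_maya[OF t(3)])
  qed
  also have "\<dots> = (\<Sum>(lam, mu)\<in>toda_pairs N (s' + 1) (s - 1). \<Sum>x\<in>maya (s' + 1) lam - maya (s - 1) mu. rhs_term (s' + 1) (s - 1) M lam mu x)"
    unfolding case_prod_unfold
    by (rule sum.Sigma[unfolded case_prod_unfold, symmetric]) (simp add: finite_toda_pairs, auto simp: toda_pairs_def maya_diff(1))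
  finally show ?thesis .
qed

lemma Z_4D_bilinear:
  "toda_bilinear_lhs (\<lambda>s. toda_diff (Z_4D hbar s)) s s' = toda_bilinear_rhs (\<lambda>s. toda_diff (Z_4D hbar s)) s s'"
proof (intro mps_eqI fps_ext)
  fix M N
  have um: "inj Um" "inj Um'" "inj Ub" "inj Ub'" "range Um' \<inter> range Um = {}" "range Ub' \<inter> range Ub = {}"
    by (auto simp: inj_def)
  have "fps_nth (mps_coeff (toda_bilinear_lhs (\<lambda>s. toda_diff (Z_4D hbar s)) s s') M) N =
      (1 / hbar\<^sup>2) ^ N * (\<Sum>(lam, mu)\<in>toda_pairs N s' s. plancherel_weight lam * plancherel_weight mu *
        (\<Sum>x\<in>maya s mu - maya s' lam. dpow (\<lambda>v. poly (lhs_poly (phi_complex s' lam) (phi_complex s mu) v) (of_int x)) M *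
          exchange_ratio x (maya s' lam - maya s mu) (maya s mu - maya s' lam)))"
    unfolding toda_bilinear_lhs_def mps_map_def mps_coeff_Abs toda_eval_shifts mps_exp_xi[OF um(2,1,5)]
    by (rule bilinear_coeff[OF inj_primed]) (rule lhs_coeff)
  also have "\<dots> = (1 / hbar\<^sup>2) ^ N * (\<Sum>(lam, mu)\<in>toda_pairs N (s' + 1) (s - 1). plancherel_weight lam * plancherel_weight mu *
        (\<Sum>x\<in>maya (s' + 1) lam - maya (s - 1) mu.
          dpow (\<lambda>v. poly (rhs_poly (phi_complex (s' + 1) lam) (phi_complex (s - 1) mu) v) (of_int x)) M *
          exchange_ratio x (maya (s - 1) mu - maya (s' + 1) lam) (maya (s' + 1) lam - maya (s - 1) mu)))"
    by (simp only: sum_distrib_left[of "plancherel_weight _ * plancherel_weight _"] exchange_sum)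
  also have "\<dots> = fps_nth (mps_coeff (toda_bilinear_rhs (\<lambda>s. toda_diff (Z_4D hbar s)) s s') M) N"
    unfolding toda_bilinear_rhs_def mps_map_def mps_coeff_Abs toda_eval_shifts mps_exp_xi[OF um(4,3,6)]
    by (rule bilinear_coeff[OF inj_primed, symmetric]) (rule rhs_coeff)
  finally show "fps_nth (mps_coeff (toda_bilinear_lhs (\<lambda>s. toda_diff (Z_4D hbar s)) s s') M) N =
      fps_nth (mps_coeff (toda_bilinear_rhs (\<lambda>s. toda_diff (Z_4D hbar s)) s s') M) N" .
qed

section \<open>Nonvanishing of the partition function\<close>

lemma partition_size_0: 
  assumes "lam \<in> partitions"
  shows "partition_size lam = 0 \<longleftrightarrow> lam = (\<lambda>_. 0)"
  using assms by (auto simp: partitions_def partition_size_def Sum_any.expand_set)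

text \<open>By the product formula: the beads are distinct, so the Vandermonde product does not
  vanish.\<close>

lemma plancherel_weight_nonzero:
  assumes "lam \<in> partitions"
  shows "plancherel_weight lam \<noteq> 0"
proof -
  obtain C where C: "cutoff 0 lam C" using cutoff_pair[OF assms assms] .
  have "plancherel ((\<lambda>x. x + C - 1) ` beads C (maya 0 lam)) \<noteq> 0"
    using finite_beads[OF assms C] by (intro plancherel_nonzero) simp
  then show ?thesis using dim_beads[OF assms C] by (simp add: plancherel_weight_def)
qed

lemma toda_diff_Z_4D_nonzero:
  assumes "hbar \<noteq> 0"
  shows "toda_diff (Z_4D hbar s) \<noteq> 0"
proof -
  define N where "N = nat (s * (s + 1) div 2)"
  let ?z = "\<lambda>_. 0 :: nat"
  have z: "?z \<in> partitions" by (simp add: partitions_def antimono_def)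
  have size: "partition_size ?z = 0" using partition_size_0[OF z] by simp
  \<comment> \<open>N is the least energy at charge s and only the empty partition attains it, so in
    the constant term with respect to the times the coefficient of \<Lambda>^(2N) is a single
    nonzero number.\<close>
  have low: "low_energy N s = {?z}"
    using z size by (auto simp: low_energy_def energy_def N_def partition_size_0)
  obtain R where "Z_4D hbar s = Z_low N hbar s + mps_const (fps_X ^ Suc N) * R" using Z_4D_low by blast
  then have "fps_nth (mps_coeff (Z_4D hbar s) 0) N = fps_nth (mps_coeff (Z_low N hbar s) 0) N"
    by (simp add: mps_coeff_const_mult fps_X_power_mult_nth del: power_Suc)
  also have "\<dots> = plancherel_weight ?z * (1 / hbar\<^sup>2) ^ N"
    unfolding Z_low_def low
    by (simp add: mps_coeff_const_mult mexp_def Z_weight_eq energy_def size N_def[symmetric] fps_X_power_nth)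
  also have "\<dots> \<noteq> 0" using plancherel_weight_nonzero[OF z] assms by simp
  finally have "mps_coeff (Z_4D hbar s) 0 \<noteq> 0" by auto
  moreover have "mps_coeff (toda_diff (Z_4D hbar s)) 0 = mps_coeff (Z_4D hbar s) 0"
    by (simp add: mps_coeff_toda_diff mps_coeff_1)
  ultimately show ?thesis by auto
qed

theorem theorem9:
  fixes hbar :: complex
  assumes "hbar \<noteq> 0"
  shows "tau_1D_toda (\<lambda>s. Z_4D hbar s)"
  using toda_diff_Z_4D_nonzero[OF assms] Z_4D_bilinear[of hbar]
  by (simp add: tau_1D_toda_def tau_2D_toda_def toda_diff_def)

end
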